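(* Let $n\ge2$, $\kappa\ge0$, $1\le\ell\le n$, $x\in\mathbb{R}^n$, and let $e_\ell$ be the $\ell$th standard basis vector of $\mathbb{R}^n$. Then the Dunkl kernel for the root system $A_{n-1}$ satisfies $$E_\kappa(x,e_\ell)=V_\kappa\big(e^{\langle\cdot,e_\ell\rangle}\big)(x)=e^{x_n}\,\Phi_2^{(n-1)}[b_1,\ldots,b_{n-1};\,n\kappa+1;\,x_1-x_n,\ldots,x_{n-1}-x_n],$$ where $b_j=\kappa$ for $j\neq\ell$ and, if $\ell\le n-1$, $b_\ell=\kappa+1$ (so for $\ell=n$ all $b_1,\ldots,b_{n-1}$ equal $\kappa$). Moreover, if $\kappa>0$, this equals $$n\,c_\kappa\int_{T^{n-1}}e^{\sum_{j=1}^n x_jt_j}\,t_\ell\prod_{j=1}^n t_j^{\kappa-1}\,dt_1\cdots dt_{n-1},$$ where $t_n=1-\sum_{j=1}^{n-1}t_j$ and $c_\kappa=\Gamma(n\kappa)/\Gamma(\kappa)^n$.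
   Context: Dunkl operators (symmetric group $S_n$, root system $A_{n-1}$): for $\kappa\ge 0$ and $1\le i\le n$, acting on polynomials (or smooth functions) on $\mathbb{R}^n$, $$D_i f(x)=\frac{\partial f}{\partial x_i}(x)+\kappa\sum_{j\ne i}\frac{f(x)-f(x(i,j))}{x_i-x_j},$$ where $x(i,j)$ is $x$ with its $i$th and $j$th coordinates exchanged. Intertwining operator: let $\mathcal{P}_m^n$ be the space of homogeneous polynomials of degree $m$ in $n$ variables. $V_\kappa$ is the unique linear operator on polynomials with $V_\kappa(\mathcal{P}_m^n)\subseteq\mathcal{P}_m^n$ for all $m$, $V_\kappa 1=1$, and $D_iV_\kappa=V_\kappa\partial_i$ for $1\le i\le n$. It is extended to exponentials by $V_\kappa[e^{\langle\cdot,y\rangle}](x)=\sum_{m\ge0}\frac1{m!}V_\kappa[\langle\cdot,y\rangle^m](x)$, where $\langle x,y\rangle=\sum_i x_iy_i$. Dunkl kernel: $E_\kappa(x,y)=V_\kappa[e^{\langle\cdot,y\rangle}](x)$. Humbert function: for $c\notin\{0,-1,-2,\dots\}$, $$\Phi_2^{(N)}[b_1,\ldots,b_N;c;z_1,\ldots,z_N]=\sum_{m_1,\ldots,m_N\ge0}\frac{(b_1)_{m_1}\cdots(b_N)_{m_N}}{(c)_{m_1+\cdots+m_N}}\frac{z_1^{m_1}}{m_1!}\cdots\frac{z_N^{m_N}}{m_N!},$$ with $(a)_m=a(a+1)\cdots(a+m-1)$, $(a)_0=1$. Simplex: $T^{n-1}=\{(t_1,\ldots,t_{n-1}):t_j>0,\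 \sum_{j=1}^{n-1}t_j<1\}\subset\mathbb{R}^{n-1}$. *)

theory Defs
  imports "HOL-Analysis.Analysis"
begin

text \<open>
  Points of $R^n$ are functions \<open>x :: nat \<Rightarrow> real\<close> of which only the coordinates
  \<open>x 1, \<dots>, x n\<close> are used. Polynomials in \<open>n\<close> variables are polynomial functions of
  these coordinates.
\<close>

definition multi_indices :: "nat \<Rightarrow> (nat \<Rightarrow> nat) set" where
  "multi_indices n = {1..n} \<rightarrow>\<^sub>E UNIV"

definition monomial_fun :: "nat \<Rightarrow> (nat \<Rightarrow> nat) \<Rightarrow> (nat \<Rightarrow> real) \<Rightarrow> real" where
  "monomial_fun n \<alpha> x = (\<Prod>i=1..n. x i ^ \<alpha> i)"

definition polynomials :: "nat \<Rightarrow> ((nat \<Rightarrow> real) \<Rightarrow> real) set" where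
  "polynomials n = {p. \<exists>A c. finite A \<and> A \<subseteq> multi_indices n \<and>
     p = (\<lambda>x. \<Sum>\<alpha>\<in>A. c \<alpha> * monomial_fun n \<alpha> x)}"

definition homogeneous_polynomials :: "nat \<Rightarrow> nat \<Rightarrow> ((nat \<Rightarrow> real) \<Rightarrow> real) set" where
  "homogeneous_polynomials n m = {p. \<exists>A c. finite A \<and>
     A \<subseteq> {\<alpha> \<in> multi_indices n. (\<Sum>i=1..n. \<alpha> i) = m} \<and>
     p = (\<lambda>x. \<Sum>\<alpha>\<in>A. c \<alpha> * monomial_fun n \<alpha> x)}"

definition inner_n :: "nat \<Rightarrow> (nat \<Rightarrow> real) \<Rightarrow> (nat \<Rightarrow> real) \<Rightarrow> real" where
  "inner_n n x y = (\<Sum>i=1..n. x i * y i)"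

definition std_basis :: "nat \<Rightarrow> nat \<Rightarrow> real" where
  "std_basis l = (\<lambda>j. if j = l then 1 else 0)"

definition partial_deriv ::
    "nat \<Rightarrow> ((nat \<Rightarrow> real) \<Rightarrow> real) \<Rightarrow> (nat \<Rightarrow> real) \<Rightarrow> real" where
  "partial_deriv i f x = deriv (\<lambda>t. f (x(i := t))) (x i)"

definition swap_coords :: "nat \<Rightarrow> nat \<Rightarrow> (nat \<Rightarrow> real) \<Rightarrow> (nat \<Rightarrow> real)" where
  "swap_coords i j x = x(i := x j, j := x i)"

text \<open>
  The quotient $(f(x) - f(x(i,j)))/(x_i - x_j)$ is understood on the hyperplane $x_i = x_j$ as
  its continuous extension, here the limit along the \<open>i\<close>th coordinate. Division by zero
  would give 0 there and \<open>D\<^sub>i\<close> would not map polynomials to polynomials.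
\<close>

definition dunkl_quotient ::
    "nat \<Rightarrow> nat \<Rightarrow> ((nat \<Rightarrow> real) \<Rightarrow> real) \<Rightarrow> (nat \<Rightarrow> real) \<Rightarrow> real" where
  "dunkl_quotient i j f x =
     (if x i \<noteq> x j then (f x - f (swap_coords i j x)) / (x i - x j)
      else Lim (at (x i)) (\<lambda>t. (f (x(i := t)) - f (swap_coords i j (x(i := t)))) / (t - x j)))"

definition dunkl_op ::
    "nat \<Rightarrow> real \<Rightarrow> nat \<Rightarrow> ((nat \<Rightarrow> real) \<Rightarrow> real) \<Rightarrow> (nat \<Rightarrow> real) \<Rightarrow> real" where
  "dunkl_op n \<kappa> i f x =
     partial_deriv i f x + \<kappa> * (\<Sum>j\<in>{1..n} - {i}. dunkl_quotient i j f x)"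

definition is_intertwining ::
    "nat \<Rightarrow> real \<Rightarrow> (((nat \<Rightarrow> real) \<Rightarrow> real) \<Rightarrow> ((nat \<Rightarrow> real) \<Rightarrow> real)) \<Rightarrow> bool" where
  "is_intertwining n \<kappa> V \<longleftrightarrow>
     (\<forall>p\<in>polynomials n. \<forall>q\<in>polynomials n. V (\<lambda>x. p x + q x) = (\<lambda>x. V p x + V q x)) \<and>
     (\<forall>a. \<forall>p\<in>polynomials n. V (\<lambda>x. a * p x) = (\<lambda>x. a * V p x)) \<and>
     (\<forall>m. V ` homogeneous_polynomials n m \<subseteq> homogeneous_polynomials n m) \<and>
     V (\<lambda>x. 1) = (\<lambda>x. 1) \<and>
     (\<forall>i\<in>{1..n}. \<forall>p\<in>polynomials n. dunkl_op n \<kappa> i (V p) = V (partial_deriv i p))"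

text \<open>
  The operator acts on polynomials only; \<open>extensional\<close> fixes the irrelevant values on other
  functions, so that the definite description is determined.
\<close>

definition intertwining_op ::
    "nat \<Rightarrow> real \<Rightarrow> ((nat \<Rightarrow> real) \<Rightarrow> real) \<Rightarrow> ((nat \<Rightarrow> real) \<Rightarrow> real)" where
  "intertwining_op n \<kappa> =
     (THE V. V \<in> extensional (polynomials n) \<and> is_intertwining n \<kappa> V)"

definition intertwining_exp ::
    "nat \<Rightarrow> real \<Rightarrow> (nat \<Rightarrow> real) \<Rightarrow> (nat \<Rightarrow> real) \<Rightarrow> real" where
  "intertwining_exp n \<kappa> y x =
     (\<Sum>m. 1 / fact m * intertwining_op n \<kappa> (\<lambda>z. inner_n n z y ^ m) x)"

definition dunkl_kernel ::
    "nat \<Rightarrow> real \<Rightarrow> (nat \<Rightarrow> real) \<Rightarrow> (nat \<Rightarrow> real) \<Rightarrow> real" where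
  "dunkl_kernel n \<kappa> x y = intertwining_exp n \<kappa> y x"

definition humbert_Phi2 ::
    "nat \<Rightarrow> (nat \<Rightarrow> real) \<Rightarrow> real \<Rightarrow> (nat \<Rightarrow> real) \<Rightarrow> real" where
  "humbert_Phi2 N b c z =
     (\<Sum>\<^sub>\<infinity>m\<in>multi_indices N.
        (\<Prod>j=1..N. pochhammer (b j) (m j)) / pochhammer c (\<Sum>j=1..N. m j) *
        (\<Prod>j=1..N. z j ^ m j / fact (m j)))"

text \<open>
  $R^d$ as a measure space is \<open>Pi\<^sub>M {1..d} (\<lambda>_. lborel)\<close>, whose points are the functions
  that are \<open>undefined\<close> outside \<open>{1..d}\<close>.
\<close>

definition open_simplex :: "nat \<Rightarrow> (nat \<Rightarrow> real) set" where
  "open_simplex d = {t \<in> {1..d} \<rightarrow>\<^sub>E UNIV. (\<forall>j\<in>{1..d}. t j > 0) \<and> (\<Sum>j=1..d. t j) < 1}"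

definition simplex_extend :: "nat \<Rightarrow> (nat \<Rightarrow> real) \<Rightarrow> (nat \<Rightarrow> real)" where
  "simplex_extend n t = t(n := 1 - (\<Sum>j=1..n-1. t j))"

definition dunkl_const :: "nat \<Rightarrow> real \<Rightarrow> real" where
  "dunkl_const n \<kappa> = Gamma (real n * \<kappa>) / Gamma \<kappa> ^ n"

end

theory Submission
  imports Defs
begin

text \<open>
  The theorem rests on an explicit formula for the intertwining operator $V$ on powers of one
  coordinate. Let $b_l = \kappa + 1$ and $b_j = \kappa$ for $j \ne l$, and let $P_m(x)$ be the coefficient of
  $T^m$ in $G = \prod_j (1 - x_j T)^{-b_j}$. Up to the factor $1/(1 - x_l T)$ the series $G$ is symmetric
  in \<open>x\<close>, so the difference quotients in the Dunkl operators can be computed in closed form, and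
  $D_i P_{m+1} = 0$ for $i \ne l$ while $D_l P_{m+1} = (n\kappa + 1 + m) P_m$ (lemma \<open>dunkl_op_gen_fps\<close>). A
  homogeneous polynomial of positive degree that is killed by all $D_i$ vanishes
  (\<open>dunkl_joint_kernel_trivial\<close>), and so $V(x_l^m) = m!\, P_m / (n\kappa + 1)_m$ by induction on \<open>m\<close>. Therefore
  the kernel is $\sum_m P_m(x) / (n\kappa + 1)_m$, a Humbert series in all \<open>n\<close> variables.

  Because the $b_j$ add up to $n\kappa + 1$, translating all coordinates by \<open>s\<close> multiplies this series
  by $e^s$ (\<open>graded_coeff_shift\<close>); the translation by $x_n$ sets the last variable to 0 and leaves the
  series in $n - 1$ variables (\<open>intertwining_exp_eq_humbert\<close>). For $\kappa > 0$ the part of degree \<open>m\<close> is,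
  by Dirichlet's integral and the multinomial theorem, a constant times the integral of
  $(\sum_j x_j t_j)^m / m!$ against $t_l \prod_j t_j^{\kappa - 1}$ over the simplex, and summation under the
  integral sign gives the integral formula (\<open>intertwining_exp_eq_integral\<close>).

  The operator $V$ is introduced by a definite description, so its existence and uniqueness are
  part of the proof. Both come from Euler's identity
  $\sum_i x_i D_i f = m f + \frac{\kappa}{2} \sum_{i,j} (f - f \circ (i,j))$ for \<open>f\<close> homogeneous of degree \<open>m\<close> and a maximum
  principle on orbits of the symmetric group, where $\kappa \ge 0$ enters. For existence, $V$ is defined
  recursively in the degree by inverting the right-hand side of Euler's identity on
  $\sum_i x_i V(\partial_i p)$. The differences $h_i = D_i V p - V \partial_i p$ then satisfy $\sum_i x_i h_i = 0$, and,
  since the Dunkl operators commute, $D_i h_j = D_j h_i$; a second use of the maximum principle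
  yields $h = 0$ (\<open>dunkl_closed_radial_zero\<close>).
\<close>

section \<open>Homogeneous polynomials\<close>

text \<open>
  \<open>homog n m f\<close> says that \<open>f\<close> is a homogeneous polynomial of degree \<open>m\<close> in \<open>n\<close> variables.
  The inductive description replaces coefficient families by a rule induction that multiplies
  by one coordinate at a time, which is what the product rule for Dunkl operators needs.
\<close>

inductive homog :: "nat \<Rightarrow> nat \<Rightarrow> ((nat \<Rightarrow> real) \<Rightarrow> real) \<Rightarrow> bool" for n where
  const: "homog n 0 (\<lambda>x. c)"
| zero: "homog n m (\<lambda>x. 0)"
| coord: "\<lbrakk>i \<in> {1..n}; homog n m f\<rbrakk> \<Longrightarrow> homog n (Suc m) (\<lambda>x. x i * f x)"
| add: "\<lbrakk>homog n m f; homog n m g\<rbrakk> \<Longrightarrow> homog n m (\<lambda>x. f x + g x)"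

lemma homog_scale: "homog n m f \<Longrightarrow> homog n m (\<lambda>x. c * f x)"
proof (induction rule: homog.induct)
  case (const d)
  show ?case by (rule homog.const)
next
  case (zero m)
  then show ?case by (simp add: homog.zero)
next
  case (coord i m f)
  have "homog n (Suc m) (\<lambda>x. x i * (c * f x))"
    using coord by (intro homog.coord)
  then show ?case by (simp add: mult.left_commute)
next
  case (add m f g)
  then show ?case by (simp add: distrib_left homog.add)
qed

lemma homog_diff: "homog n m f \<Longrightarrow> homog n m g \<Longrightarrow> homog n m (\<lambda>x. f x - g x)"
  using homog.add[of n m f "\<lambda>x. (-1) * g x"] homog_scale[of n m g "-1"] by simp

lemma homog_sum: "(\<And>a. a \<in> A \<Longrightarrow> homog n m (f a)) \<Longrightarrow> homog n m (\<lambda>x. \<Sum>a\<in>A. f a x)"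
  by (induction A rule: infinite_finite_induct) (auto intro: homog.zero homog.add)

lemma homog_mult:
  assumes "homog n m f" "homog n k g"
  shows "homog n (m + k) (\<lambda>x. f x * g x)"
  using assms
proof (induction rule: homog.induct)
  case (const c)
  then show ?case by (simp add: homog_scale)
next
  case (zero m)
  then show ?case by (simp add: homog.zero)
next
  case (coord i m f)
  then have "homog n (Suc (m + k)) (\<lambda>x. x i * (f x * g x))"
    by (intro homog.coord) auto
  then show ?case by (simp add: mult.assoc)
next
  case (add m f1 f2)
  then show ?case by (simp add: distrib_right homog.add)
qed

lemma homog_power: "i \<in> {1..n} \<Longrightarrow> homog n m (\<lambda>x. x i ^ m)"
  by (induction m) (auto intro: homog.const homog.coord)

lemma homog_permute:
  assumes "homog n m f" "\<pi> permutes {1..n}"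
  shows "homog n m (\<lambda>x. f (x \<circ> \<pi>))"
  using assms
proof (induction rule: homog.induct)
  case (coord i m f)
  have "homog n (Suc m) (\<lambda>x. x (\<pi> i) * f (x \<circ> \<pi>))"
    using coord permutes_in_image[OF coord.prems, of i] by (intro homog.coord) blast+
  then show ?case by (simp add: comp_def)
qed (auto intro: homog.intros)

lemma homog_at_0: "homog n m f \<Longrightarrow> m > 0 \<Longrightarrow> f (\<lambda>_. 0) = 0"
  by (induction rule: homog.induct) auto

lemma homog_prod:
  assumes "finite J" "\<And>j. j \<in> J \<Longrightarrow> homog n (d j) (f j)"
  shows "homog n (\<Sum>j\<in>J. d j) (\<lambda>x. \<Prod>j\<in>J. f j x)"
  using assms by (induction J rule: finite_induct) (auto intro: homog.const homog_mult)

lemma homog_monomial: "homog n (\<Sum>i=1..n. \<alpha> i) (monomial_fun n \<alpha>)"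
  unfolding monomial_fun_def by (intro homog_prod homog_power) auto

lemma monomial_span_add:
  assumes "\<exists>A c. finite A \<and> A \<subseteq> S \<and> p = (\<lambda>x. \<Sum>\<alpha>\<in>A. c \<alpha> * monomial_fun n \<alpha> x)"
    and "\<exists>A c. finite A \<and> A \<subseteq> S \<and> q = (\<lambda>x. \<Sum>\<alpha>\<in>A. c \<alpha> * monomial_fun n \<alpha> x)"
  shows "\<exists>A c. finite A \<and> A \<subseteq> S \<and> (\<lambda>x. p x + q x) = (\<lambda>x. \<Sum>\<alpha>\<in>A. c \<alpha> * monomial_fun n \<alpha> x)"
proof -
  obtain A c B d where A: "finite A" "A \<subseteq> S" "p = (\<lambda>x. \<Sum>\<alpha>\<in>A. c \<alpha> * monomial_fun n \<alpha> x)"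
    and B: "finite B" "B \<subseteq> S" "q = (\<lambda>x. \<Sum>\<alpha>\<in>B. d \<alpha> * monomial_fun n \<alpha> x)"
    using assms by blast
  define e where "e \<alpha> = (if \<alpha> \<in> A then c \<alpha> else 0) + (if \<alpha> \<in> B then d \<alpha> else 0)" for \<alpha>
  have "p x + q x = (\<Sum>\<alpha>\<in>A \<union> B. e \<alpha> * monomial_fun n \<alpha> x)" for x
  proof -
    have "p x = (\<Sum>\<alpha>\<in>A \<union> B. (if \<alpha> \<in> A then c \<alpha> else 0) * monomial_fun n \<alpha> x)"
      unfolding A(3) using A(1) B(1) by (intro sum.mono_neutral_cong_left) auto
    moreover have "q x = (\<Sum>\<alpha>\<in>A \<union> B. (if \<alpha> \<in> B then d \<alpha> else 0) * monomial_fun n \<alpha> x)"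
      unfolding B(3) using A(1) B(1) by (intro sum.mono_neutral_cong_left) auto
    ultimately show ?thesis by (simp add: e_def distrib_right sum.distrib)
  qed
  then show ?thesis using A B by (intro exI[of _ "A \<union> B"] exI[of _ e]) auto
qed

lemma polynomials_add:
  "p \<in> polynomials n \<Longrightarrow> q \<in> polynomials n \<Longrightarrow> (\<lambda>x. p x + q x) \<in> polynomials n"
  unfolding polynomials_def mem_Collect_eq by (rule monomial_span_add)

lemma homogeneous_polynomials_add:
  "p \<in> homogeneous_polynomials n m \<Longrightarrow> q \<in> homogeneous_polynomials n m \<Longrightarrow>
    (\<lambda>x. p x + q x) \<in> homogeneous_polynomials n m"
  unfolding homogeneous_polynomials_def mem_Collect_eq by (rule monomial_span_add)

lemma homogeneous_polynomials_coord:
  assumes "p \<in> homogeneous_polynomials n m" "i \<in> {1..n}"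
  shows "(\<lambda>x. x i * p x) \<in> homogeneous_polynomials n (Suc m)"
proof -
  let ?S = "\<lambda>m. {\<alpha> \<in> multi_indices n. (\<Sum>i=1..n. \<alpha> i) = m}"
  obtain A c where A: "finite A" "A \<subseteq> ?S m"
      "p = (\<lambda>x. \<Sum>\<alpha>\<in>A. c \<alpha> * monomial_fun n \<alpha> x)"
    using assms unfolding homogeneous_polynomials_def by blast
  define u :: "(nat \<Rightarrow> nat) \<Rightarrow> nat \<Rightarrow> nat" where "u \<alpha> = \<alpha>(i := Suc (\<alpha> i))" for \<alpha>
  define v :: "(nat \<Rightarrow> nat) \<Rightarrow> nat \<Rightarrow> nat" where "v \<alpha> = \<alpha>(i := \<alpha> i - 1)" for \<alpha>
  have vu: "v (u \<alpha>) = \<alpha>" for \<alpha> by (simp add: u_def v_def)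
  then have inj: "inj_on u A" by (metis inj_onI)
  have mon: "monomial_fun n (u \<alpha>) x = x i * monomial_fun n \<alpha> x" for \<alpha> x
  proof -
    have "(\<Prod>k\<in>{1..n}-{i}. x k ^ u \<alpha> k) = (\<Prod>k\<in>{1..n}-{i}. x k ^ \<alpha> k)"
      by (intro prod.cong) (auto simp: u_def)
    then show ?thesis unfolding monomial_fun_def
      by (subst (1 2) prod.remove[OF _ assms(2)]) (simp_all add: u_def)
  qed
  have deg: "u \<alpha> \<in> ?S (Suc m)" if "\<alpha> \<in> ?S m" for \<alpha>
  proof -
    have "(\<Sum>k\<in>{1..n}-{i}. u \<alpha> k) = (\<Sum>k\<in>{1..n}-{i}. \<alpha> k)"
      by (intro sum.cong) (auto simp: u_def)
    then have "(\<Sum>k=1..n. u \<alpha> k) = Suc (\<Sum>k=1..n. \<alpha> k)"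
      by (subst (1 2) sum.remove[OF _ assms(2)]) (simp_all add: u_def)
    then show ?thesis using that assms(2) by (auto simp: multi_indices_def u_def)
  qed
  have "(\<lambda>x. x i * p x) = (\<lambda>x. \<Sum>\<beta>\<in>u ` A. c (v \<beta>) * monomial_fun n \<beta> x)"
    by (simp add: sum.reindex[OF inj] vu mon A(3) sum_distrib_left mult.left_commute)
  moreover have "finite (u ` A)" "u ` A \<subseteq> ?S (Suc m)" using A deg by auto
  ultimately show ?thesis unfolding homogeneous_polynomials_def
    by (intro CollectI exI[of _ "u ` A"] exI[of _ "\<lambda>\<beta>. c (v \<beta>)"]) blast
qed

lemma homog_iff: "homog n m f \<longleftrightarrow> f \<in> homogeneous_polynomials n m"
proof
  show "homog n m f \<Longrightarrow> f \<in> homogeneous_polynomials n m"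
  proof (induction rule: homog.induct)
    case (const c)
    let ?a = "\<lambda>i. if i \<in> {1..n} then 0 else undefined"
    show ?case unfolding homogeneous_polynomials_def
      by (intro CollectI exI[of _ "{?a}"] exI[of _ "\<lambda>_. c"])
         (auto simp: multi_indices_def monomial_fun_def PiE_def extensional_def)
  next
    case (zero m)
    show ?case unfolding homogeneous_polynomials_def
      by (intro CollectI exI[of _ "{}"]) auto
  qed (simp_all add: homogeneous_polynomials_coord homogeneous_polynomials_add)
next
  assume "f \<in> homogeneous_polynomials n m"
  then obtain A c where A: "A \<subseteq> {\<alpha> \<in> multi_indices n. (\<Sum>i=1..n. \<alpha> i) = m}"
      "f = (\<lambda>x. \<Sum>\<alpha>\<in>A. c \<alpha> * monomial_fun n \<alpha> x)"
    unfolding homogeneous_polynomials_def by blast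
  have "homog n m (\<lambda>x. c \<alpha> * monomial_fun n \<alpha> x)" if "\<alpha> \<in> A" for \<alpha>
    using homog_monomial[of n \<alpha>] A(1) that by (auto intro: homog_scale)
  then show "homog n m f" unfolding A(2) by (intro homog_sum)
qed

lemma homog_imp_polynomials: "homog n m f \<Longrightarrow> f \<in> polynomials n"
  unfolding homog_iff homogeneous_polynomials_def polynomials_def by blast

lemma polynomials_sum:
  assumes "\<And>a. a \<in> A \<Longrightarrow> f a \<in> polynomials n"
  shows "(\<lambda>x. \<Sum>a\<in>A. f a x) \<in> polynomials n"
  using assms
  by (induction A rule: infinite_finite_induct)
     (auto intro: polynomials_add homog_imp_polynomials[OF homog.zero])

lemma polynomials_decompose:
  assumes "p \<in> polynomials n"
  obtains N F where "\<And>m. homog n m (F m)" "p = (\<lambda>x. \<Sum>m<N. F m x)"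
proof -
  obtain A c where A: "finite A" "p = (\<lambda>x. \<Sum>\<alpha>\<in>A. c \<alpha> * monomial_fun n \<alpha> x)"
    using assms unfolding polynomials_def by blast
  define d :: "(nat \<Rightarrow> nat) \<Rightarrow> nat" where "d \<alpha> = (\<Sum>i=1..n. \<alpha> i)" for \<alpha>
  define F where "F m x = (\<Sum>\<alpha> | \<alpha> \<in> A \<and> d \<alpha> = m. c \<alpha> * monomial_fun n \<alpha> x)" for m x
  define N where "N = Suc (\<Sum>\<alpha>\<in>A. d \<alpha>)"
  have "d ` A \<subseteq> {..<N}"
    unfolding N_def using A(1) by (auto simp: less_Suc_eq_le intro!: member_le_sum)
  then have "p = (\<lambda>x. \<Sum>m<N. F m x)"
    unfolding F_def A(2) using A(1) by (auto simp: sum.group)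
  moreover have "homog n m (F m)" for m
  proof -
    have "homog n m (\<lambda>x. c \<alpha> * monomial_fun n \<alpha> x)" if "\<alpha> \<in> {\<alpha>. \<alpha> \<in> A \<and> d \<alpha> = m}" for \<alpha>
      using homog_monomial[of n \<alpha>] that by (auto simp: d_def intro: homog_scale)
    then show ?thesis
      unfolding F_def[abs_def] by (rule homog_sum)
  qed
  ultimately show ?thesis using that by blast
qed

section \<open>Dunkl operators on polynomials\<close>

text \<open>
  \<open>homog_pred n m g\<close>: \<open>g\<close> is homogeneous of degree \<open>m - 1\<close>, where for \<open>m = 0\<close> only the
  zero function qualifies. This is where derivatives of degree \<open>m\<close> polynomials live.
\<close>

definition homog_pred :: "nat \<Rightarrow> nat \<Rightarrow> ((nat \<Rightarrow> real) \<Rightarrow> real) \<Rightarrow> bool" where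
  "homog_pred n m g = (case m of 0 \<Rightarrow> g = (\<lambda>_. 0) | Suc k \<Rightarrow> homog n k g)"

lemma homog_pred_simps [simp]:
  "homog_pred n 0 g \<longleftrightarrow> g = (\<lambda>_. 0)"
  "homog_pred n (Suc k) g \<longleftrightarrow> homog n k g"
  by (simp_all add: homog_pred_def)

lemma homog_pred_zero: "homog_pred n m (\<lambda>_. 0)"
  by (cases m) (auto intro: homog.zero)

lemma homog_pred_add: "homog_pred n m f \<Longrightarrow> homog_pred n m g \<Longrightarrow> homog_pred n m (\<lambda>x. f x + g x)"
  by (cases m) (auto intro: homog.add)

lemma homog_pred_coord: "i \<in> {1..n} \<Longrightarrow> homog_pred n m f \<Longrightarrow> homog n m (\<lambda>x. x i * f x)"
  by (cases m) (auto intro: homog.intros)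

lemma homog_pred_imp_homog: "homog_pred n m f \<Longrightarrow> \<exists>k. homog n k f"
  by (cases m) (auto intro: homog.intros)

lemma homog_pred_scale: "homog_pred n m f \<Longrightarrow> homog_pred n m (\<lambda>x. c * f x)"
  by (cases m) (auto intro: homog_scale)

lemma homog_pred_sum:
  "(\<And>a. a \<in> A \<Longrightarrow> homog_pred n m (f a)) \<Longrightarrow> homog_pred n m (\<lambda>x. \<Sum>a\<in>A. f a x)"
  by (cases m) (auto intro: homog_sum)

lemma homog_has_partial_deriv:
  assumes "homog n m f"
  shows "\<exists>g. homog_pred n m g \<and> (\<forall>x. ((\<lambda>t. f (x(i := t))) has_real_derivative g x) (at (x i)))"
  using assms
proof (induction rule: homog.induct)
  case (const c)
  show ?case by (intro exI[of _ "\<lambda>_. 0"]) auto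
next
  case (zero m)
  show ?case by (intro exI[of _ "\<lambda>_. 0"]) (auto intro: homog_pred_zero)
next
  case (coord k m f)
  then obtain g where g: "homog_pred n m g"
      "\<And>x. ((\<lambda>t. f (x(i := t))) has_real_derivative g x) (at (x i))" by blast
  let ?g = "\<lambda>x. x k * g x + (if i = k then 1 else 0) * f x"
  have "homog n m ?g"
    using coord.hyps g by (intro homog.add homog_scale homog_pred_coord) auto
  moreover have "((\<lambda>t. (x(i := t)) k * f (x(i := t))) has_real_derivative ?g x) (at (x i))" for x
  proof -
    have "((\<lambda>t. (x(i := t)) k) has_real_derivative (if i = k then 1 else 0)) (at (x i))"
      by (auto intro!: derivative_eq_intros)
    from DERIV_mult'[OF this g(2)[of x]] show ?thesis by simp
  qed
  ultimately show ?case
    by (intro exI[of _ ?g] conjI allI) (simp_all only: homog_pred_simps)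
next
  case (add m f1 f2)
  then obtain g1 g2 where "homog_pred n m g1" "homog_pred n m g2"
      "\<And>x. ((\<lambda>t. f1 (x(i := t))) has_real_derivative g1 x) (at (x i))"
      "\<And>x. ((\<lambda>t. f2 (x(i := t))) has_real_derivative g2 x) (at (x i))" by blast
  then show ?case
    by (intro exI[of _ "\<lambda>x. g1 x + g2 x"] conjI allI homog_pred_add DERIV_add) blast+
qed

lemma homog_partial_deriv:
  assumes "homog n m f"
  shows "homog_pred n m (partial_deriv i f)"
    and "((\<lambda>t. f (x(i := t))) has_real_derivative partial_deriv i f x) (at (x i))"
proof -
  obtain g where g: "homog_pred n m g"
      "\<And>x. ((\<lambda>t. f (x(i := t))) has_real_derivative g x) (at (x i))"
    using homog_has_partial_deriv[OF assms] by blast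
  have eq: "partial_deriv i f = g"
    unfolding partial_deriv_def using g(2) by (auto intro!: ext DERIV_imp_deriv)
  show "homog_pred n m (partial_deriv i f)"
    "((\<lambda>t. f (x(i := t))) has_real_derivative partial_deriv i f x) (at (x i))"
    using g unfolding eq by auto
qed

lemma homog_isCont: "homog n m f \<Longrightarrow> isCont (\<lambda>t. f (x(i := t))) (x i)"
  using homog_partial_deriv(2) DERIV_isCont by blast

lemma swap_coords_eq_comp: "swap_coords i j x = x \<circ> Transposition.transpose i j"
  by (auto simp: swap_coords_def Transposition.transpose_def fun_eq_iff)

lemma homog_swap:
  "homog n m f \<Longrightarrow> i \<in> {1..n} \<Longrightarrow> j \<in> {1..n} \<Longrightarrow> homog n m (\<lambda>x. f (swap_coords i j x))"
  unfolding swap_coords_eq_comp by (intro homog_permute permutes_swap_id) auto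

text \<open>
  The difference quotient of a polynomial is again a polynomial, including on the hyperplane
  \<open>x i = x j\<close>.
\<close>

lemma homog_divides_swap_difference:
  assumes "homog n m f" "i \<in> {1..n}" "j \<in> {1..n}"
  shows "\<exists>q. homog_pred n m q \<and> (\<forall>x. f x - f (swap_coords i j x) = (x i - x j) * q x)"
  using assms
proof (induction rule: homog.induct)
  case (const c)
  show ?case by (intro exI[of _ "\<lambda>_. 0"]) auto
next
  case (zero m)
  show ?case by (intro exI[of _ "\<lambda>_. 0"]) (auto intro: homog_pred_zero)
next
  case (coord k m f)
  then obtain q where q: "homog_pred n m q"
      "\<And>x. f x - f (swap_coords i j x) = (x i - x j) * q x" by blast
  define e :: real where "e = (if k = i then 1 else 0) - (if k = j then 1 else 0)"
  let ?q = "\<lambda>x. x k * q x + e * f (swap_coords i j x)"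
  have "homog n m (\<lambda>x. f (swap_coords i j x))"
    using coord by (intro homog_swap) auto
  then have "homog n m ?q"
    using coord.hyps q by (intro homog.add homog_scale homog_pred_coord) auto
  moreover have "x k * f x - swap_coords i j x k * f (swap_coords i j x) = (x i - x j) * ?q x" for x
  proof -
    have d: "x k - swap_coords i j x k = (x i - x j) * e"
      by (auto simp: swap_coords_def e_def)
    have "x k * f x - swap_coords i j x k * f (swap_coords i j x)
        = x k * (f x - f (swap_coords i j x)) + (x k - swap_coords i j x k) * f (swap_coords i j x)"
      by (simp add: algebra_simps)
    then show ?thesis unfolding q(2) d by (simp add: algebra_simps)
  qed
  ultimately show ?case by (intro exI[of _ ?q]) auto
next
  case (add m f1 f2)
  then obtain g1 g2 where g: "homog_pred n m g1" "homog_pred n m g2"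
      "\<And>x. f1 x - f1 (swap_coords i j x) = (x i - x j) * g1 x"
      "\<And>x. f2 x - f2 (swap_coords i j x) = (x i - x j) * g2 x" by blast
  have "f1 x + f2 x - (f1 (swap_coords i j x) + f2 (swap_coords i j x)) = (x i - x j) * (g1 x + g2 x)" for x
    using g(3,4)[of x] by (simp add: distrib_left)
  then show ?case
    using g(1,2) by (intro exI[of _ "\<lambda>x. g1 x + g2 x"]) (auto intro: homog_pred_add)
qed

text \<open>
  Any factorisation of $f(x) - f(x(i,j))$ by $x_i - x_j$ whose cofactor is continuous along the
  \<open>i\<close>th coordinate computes the quotient everywhere, since the limit on the hyperplane is then
  a value of that cofactor.
\<close>

lemma dunkl_quotient_eqI:
  assumes q: "\<And>x. f x - f (swap_coords i j x) = (x i - x j) * q x"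
    and cont: "isCont (\<lambda>t. q (x(i := t))) (x i)" and "i \<noteq> j"
  shows "dunkl_quotient i j f x = q x"
proof (cases "x i = x j")
  case False
  then show ?thesis by (simp add: dunkl_quotient_def q)
next
  case True
  have "((\<lambda>t. q (x(i := t))) \<longlongrightarrow> q x) (at (x i))"
    using cont by (simp add: isCont_def)
  moreover have "\<forall>\<^sub>F t in at (x i). q (x(i := t)) =
      (f (x(i := t)) - f (swap_coords i j (x(i := t)))) / (t - x j)"
    unfolding eventually_at_filter using q \<open>i \<noteq> j\<close> True by (auto intro!: always_eventually)
  ultimately have "((\<lambda>t. (f (x(i := t)) - f (swap_coords i j (x(i := t)))) / (t - x j)) \<longlongrightarrow> q x) (at (x i))"
    by (rule Lim_transform_eventually)
  then show ?thesis
    using True by (simp add: dunkl_quotient_def tendsto_Lim)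
qed

lemma homog_dunkl_quotient:
  assumes "homog n m f" "i \<in> {1..n}" "j \<in> {1..n}" "i \<noteq> j"
  shows "homog_pred n m (dunkl_quotient i j f)"
    and "f x - f (swap_coords i j x) = (x i - x j) * dunkl_quotient i j f x"
proof -
  obtain q where q: "homog_pred n m q"
      "\<And>x. f x - f (swap_coords i j x) = (x i - x j) * q x"
    using homog_divides_swap_difference[OF assms(1-3)] by blast
  obtain k where k: "homog n k q" using homog_pred_imp_homog[OF q(1)] by blast
  have eq: "dunkl_quotient i j f = q"
    using dunkl_quotient_eqI[OF q(2) homog_isCont[OF k] assms(4)] by blast
  show "homog_pred n m (dunkl_quotient i j f)"
    "f x - f (swap_coords i j x) = (x i - x j) * dunkl_quotient i j f x"
    unfolding eq using q by auto
qed

lemma partial_deriv_add: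
  "homog n m f \<Longrightarrow> homog n k g \<Longrightarrow>
    partial_deriv i (\<lambda>x. f x + g x) x = partial_deriv i f x + partial_deriv i g x"
  unfolding partial_deriv_def[of i "\<lambda>x. f x + g x"]
  by (intro DERIV_imp_deriv DERIV_add homog_partial_deriv)

lemma partial_deriv_coord:
  assumes "homog n m f"
  shows "partial_deriv i (\<lambda>x. x k * f x) x = x k * partial_deriv i f x + (if i = k then f x else 0)"
proof -
  have "((\<lambda>t. (x(i := t)) k) has_real_derivative (if i = k then 1 else 0)) (at (x i))"
    by (auto intro!: derivative_eq_intros)
  from DERIV_mult'[OF this homog_partial_deriv(2)[OF assms, of x i]]
  show ?thesis unfolding partial_deriv_def[of i "\<lambda>x. x k * f x"]
    by (intro DERIV_imp_deriv) (auto simp: algebra_simps)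
qed

lemma dunkl_quotient_const: "dunkl_quotient i j (\<lambda>_. c) x = 0"
  by (simp add: dunkl_quotient_def tendsto_Lim)

lemma dunkl_op_const: "dunkl_op n \<kappa> i (\<lambda>_. c) x = 0"
  by (simp add: dunkl_op_def dunkl_quotient_const partial_deriv_def)

lemma dunkl_quotient_add:
  assumes "homog n m f" "homog n k g" "i \<in> {1..n}" "j \<in> {1..n}" "i \<noteq> j"
  shows "dunkl_quotient i j (\<lambda>x. f x + g x) x = dunkl_quotient i j f x + dunkl_quotient i j g x"
proof (rule dunkl_quotient_eqI)
  show "(f x + g x) - (f (swap_coords i j x) + g (swap_coords i j x)) =
      (x i - x j) * (dunkl_quotient i j f x + dunkl_quotient i j g x)" for x
    using homog_dunkl_quotient(2)[OF assms(1,3-5), of x] homog_dunkl_quotient(2)[OF assms(2-5), of x]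
    by (simp add: distrib_left)
  show "isCont (\<lambda>t. dunkl_quotient i j f (x(i := t)) + dunkl_quotient i j g (x(i := t))) (x i)"
    using homog_pred_imp_homog[OF homog_dunkl_quotient(1)[OF assms(1,3-5)]]
      homog_pred_imp_homog[OF homog_dunkl_quotient(1)[OF assms(2-5)]]
    by (auto intro: isCont_add homog_isCont)
qed fact

lemma dunkl_quotient_coord:
  assumes "homog n m f" "i \<in> {1..n}" "j \<in> {1..n}" "i \<noteq> j"
  shows "dunkl_quotient i j (\<lambda>x. x k * f x) x =
    x k * dunkl_quotient i j f x + (of_bool (k = i) - of_bool (k = j)) * f (swap_coords i j x)"
proof (rule dunkl_quotient_eqI)
  note q = homog_dunkl_quotient(2)[OF assms]
  let ?e = "of_bool (k = i) - of_bool (k = j) :: real"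
  show "x k * f x - swap_coords i j x k * f (swap_coords i j x) =
      (x i - x j) * (x k * dunkl_quotient i j f x + ?e * f (swap_coords i j x))" for x
  proof -
    have d: "x k - swap_coords i j x k = (x i - x j) * ?e"
      using assms(4) by (auto simp: swap_coords_def)
    have "x k * f x - swap_coords i j x k * f (swap_coords i j x)
        = x k * (f x - f (swap_coords i j x)) + (x k - swap_coords i j x k) * f (swap_coords i j x)"
      by (simp add: algebra_simps)
    then show ?thesis unfolding q d by (simp add: algebra_simps)
  qed
  have 1: "isCont (\<lambda>t. dunkl_quotient i j f (x(i := t))) (x i)"
    using homog_pred_imp_homog[OF homog_dunkl_quotient(1)[OF assms]] by (auto intro: homog_isCont)
  have 2: "isCont (\<lambda>t. f (swap_coords i j (x(i := t)))) (x i)"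
    using homog_isCont[OF homog_swap[OF assms(1-3)]] .
  have 3: "isCont (\<lambda>t. (x(i := t)) k) (x i)" by (cases "i = k") auto
  show "isCont (\<lambda>t. (x(i := t)) k * dunkl_quotient i j f (x(i := t))
      + ?e * f (swap_coords i j (x(i := t)))) (x i)"
    by (intro isCont_add isCont_mult 1 2 3 continuous_const)
qed fact

lemma homog_dunkl_op:
  assumes "homog n m f" "i \<in> {1..n}"
  shows "homog_pred n m (dunkl_op n \<kappa> i f)"
  unfolding dunkl_op_def[abs_def] using assms
  by (intro homog_pred_add homog_pred_scale homog_pred_sum homog_partial_deriv(1)
        homog_dunkl_quotient(1)) auto

lemma dunkl_op_add:
  assumes "homog n m f" "homog n k g" "i \<in> {1..n}"
  shows "dunkl_op n \<kappa> i (\<lambda>x. f x + g x) x = dunkl_op n \<kappa> i f x + dunkl_op n \<kappa> i g x"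
proof -
  have "(\<Sum>j\<in>{1..n} - {i}. dunkl_quotient i j (\<lambda>x. f x + g x) x) =
      (\<Sum>j\<in>{1..n} - {i}. dunkl_quotient i j f x + dunkl_quotient i j g x)"
    using assms by (intro sum.cong refl dunkl_quotient_add) auto
  then show ?thesis
    by (simp add: dunkl_op_def partial_deriv_add[OF assms(1,2)] sum.distrib distrib_left)
qed

text \<open>
  The commutator of a Dunkl operator with multiplication by a coordinate. Together with
  equivariance this rule yields the commutativity of the Dunkl operators.
\<close>

lemma dunkl_op_coord:
  assumes "homog n m f" "i \<in> {1..n}" "k \<in> {1..n}"
  shows "dunkl_op n \<kappa> i (\<lambda>x. x k * f x) x = x k * dunkl_op n \<kappa> i f x +
    (if i = k then f x + \<kappa> * (\<Sum>j\<in>{1..n} - {i}. f (swap_coords i j x))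
     else - \<kappa> * f (swap_coords i k x))"
proof -
  have "(\<Sum>j\<in>{1..n} - {i}. dunkl_quotient i j (\<lambda>x. x k * f x) x) =
      (\<Sum>j\<in>{1..n} - {i}. x k * dunkl_quotient i j f x
         + (of_bool (k = i) - of_bool (k = j)) * f (swap_coords i j x))"
    using assms by (intro sum.cong refl dunkl_quotient_coord) auto
  also have "\<dots> = x k * (\<Sum>j\<in>{1..n} - {i}. dunkl_quotient i j f x)
      + (\<Sum>j\<in>{1..n} - {i}. (of_bool (k = i) - of_bool (k = j)) * f (swap_coords i j x))"
    by (simp add: sum.distrib sum_distrib_left)
  also have "(\<Sum>j\<in>{1..n} - {i}. (of_bool (k = i) - of_bool (k = j)) * f (swap_coords i j x)) =
     (if i = k then \<Sum>j\<in>{1..n} - {i}. f (swap_coords i j x) else - f (swap_coords i k x))"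
  proof (cases "i = k")
    case True
    then show ?thesis by (auto intro!: sum.cong)
  next
    case False
    have "(\<Sum>j\<in>{1..n} - {i}. (of_bool (k = i) - of_bool (k = j)) * f (swap_coords i j x)) =
       (\<Sum>j\<in>{1..n} - {i}. if j = k then - f (swap_coords i j x) else 0)"
      using False by (intro sum.cong) auto
    then show ?thesis using False assms by simp
  qed
  finally show ?thesis
    by (simp add: dunkl_op_def partial_deriv_coord[OF assms(1)] distrib_left algebra_simps)
qed

lemma dunkl_quotient_sum:
  assumes f: "\<And>a. a \<in> A \<Longrightarrow> homog n (d a) (f a)" and ij: "i \<in> {1..n}" "j \<in> {1..n}" "i \<noteq> j"
  shows "dunkl_quotient i j (\<lambda>x. \<Sum>a\<in>A. f a x) x = (\<Sum>a\<in>A. dunkl_quotient i j (f a) x)"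
proof (rule dunkl_quotient_eqI)
  show "(\<Sum>a\<in>A. f a x) - (\<Sum>a\<in>A. f a (swap_coords i j x)) =
      (x i - x j) * (\<Sum>a\<in>A. dunkl_quotient i j (f a) x)" for x
    unfolding sum_subtractf[symmetric] sum_distrib_left
    using homog_dunkl_quotient(2)[OF f ij] by (intro sum.cong refl)
  have "isCont (\<lambda>t. dunkl_quotient i j (f a) (x(i := t))) (x i)" if "a \<in> A" for a
    using homog_pred_imp_homog[OF homog_dunkl_quotient(1)[OF f[OF that] ij]]
    by (auto intro: homog_isCont)
  then show "isCont (\<lambda>t. \<Sum>a\<in>A. dunkl_quotient i j (f a) (x(i := t))) (x i)"
    by (intro continuous_sum)
qed fact

lemma dunkl_op_sum:
  assumes "finite A" "\<And>a. a \<in> A \<Longrightarrow> homog n (d a) (f a)" "i \<in> {1..n}"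
  shows "dunkl_op n \<kappa> i (\<lambda>x. \<Sum>a\<in>A. f a x) x = (\<Sum>a\<in>A. dunkl_op n \<kappa> i (f a) x)"
proof -
  have "partial_deriv i (\<lambda>x. \<Sum>a\<in>A. f a x) x = (\<Sum>a\<in>A. partial_deriv i (f a) x)"
    unfolding partial_deriv_def[of i "\<lambda>x. \<Sum>a\<in>A. f a x"]
    by (intro DERIV_imp_deriv DERIV_sum homog_partial_deriv(2)[OF assms(2)])
  moreover have "(\<Sum>j\<in>{1..n} - {i}. dunkl_quotient i j (\<lambda>x. \<Sum>a\<in>A. f a x) x) =
      (\<Sum>j\<in>{1..n} - {i}. \<Sum>a\<in>A. dunkl_quotient i j (f a) x)"
    using assms by (intro sum.cong refl dunkl_quotient_sum) auto
  moreover have "\<dots> = (\<Sum>a\<in>A. \<Sum>j\<in>{1..n} - {i}. dunkl_quotient i j (f a) x)" by (rule sum.swap)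
  ultimately show ?thesis by (simp only: dunkl_op_def sum.distrib sum_distrib_left)
qed

lemma dunkl_op_scale:
  assumes "homog n m f" "i \<in> {1..n}"
  shows "dunkl_op n \<kappa> i (\<lambda>x. c * f x) x = c * dunkl_op n \<kappa> i f x"
proof -
  have "partial_deriv i (\<lambda>x. c * f x) x = c * partial_deriv i f x"
    unfolding partial_deriv_def[of i "\<lambda>x. c * f x"]
    by (intro DERIV_imp_deriv DERIV_cmult homog_partial_deriv[OF assms(1)])
  moreover have "dunkl_quotient i j (\<lambda>x. c * f x) x = c * dunkl_quotient i j f x"
    if "j \<in> {1..n} - {i}" for j
  proof (rule dunkl_quotient_eqI)
    from that have j: "j \<in> {1..n}" "i \<noteq> j" by auto
    show "c * f x - c * f (swap_coords i j x) = (x i - x j) * (c * dunkl_quotient i j f x)" for x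
      using homog_dunkl_quotient(2)[OF assms j, of x]
      by (metis (no_types, opaque_lifting) mult.left_commute right_diff_distrib')
    show "isCont (\<lambda>t. c * dunkl_quotient i j f (x(i := t))) (x i)"
      using homog_pred_imp_homog[OF homog_dunkl_quotient(1)[OF assms j]]
      by (auto intro: isCont_mult homog_isCont)
    show "i \<noteq> j" by fact
  qed
  ultimately show ?thesis
    by (simp add: dunkl_op_def sum_distrib_left distrib_left mult.left_commute)
qed

lemma dunkl_op_diff:
  assumes "homog n m f" "homog n k g" "i \<in> {1..n}"
  shows "dunkl_op n \<kappa> i (\<lambda>x. f x - g x) x = dunkl_op n \<kappa> i f x - dunkl_op n \<kappa> i g x"
  using dunkl_op_add[OF assms(1) homog_scale[OF assms(2)] assms(3), of \<kappa> "-1" x]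
    dunkl_op_scale[OF assms(2,3), of \<kappa> "-1" x] by simp

lemma partial_deriv_eq_dunkl_op: "partial_deriv i f = dunkl_op n 0 i f"
  by (simp add: dunkl_op_def fun_eq_iff)

lemma dunkl_quotient_swap:
  fixes a b :: nat
  assumes "i \<noteq> j"
  defines "\<tau> \<equiv> Transposition.transpose a b"
  shows "dunkl_quotient i j (\<lambda>x. f (swap_coords a b x)) x
    = dunkl_quotient (\<tau> i) (\<tau> j) f (swap_coords a b x)"
proof -
  have c: "swap_coords a b (swap_coords i j y) = swap_coords (\<tau> i) (\<tau> j) (swap_coords a b y)"
    for y :: "nat \<Rightarrow> real"
    using assms by (auto simp: fun_eq_iff swap_coords_def Transposition.transpose_def)
  have u: "swap_coords a b (x(i := t)) = (swap_coords a b x)(\<tau> i := t)" for t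
    by (auto simp: fun_eq_iff swap_coords_def \<tau>_def Transposition.transpose_def)
  have v: "swap_coords a b x (\<tau> k) = x k" for k
    by (auto simp: swap_coords_def \<tau>_def Transposition.transpose_def)
  show ?thesis
    unfolding dunkl_quotient_def c u v by simp
qed

text \<open>
  Equivariance: conjugating by a transposition permutes the Dunkl operators.
\<close>

lemma dunkl_op_swap:
  assumes "a \<in> {1..n}" "b \<in> {1..n}" "i \<in> {1..n}"
  defines "\<tau> \<equiv> Transposition.transpose a b"
  shows "dunkl_op n \<kappa> i (\<lambda>x. f (swap_coords a b x)) x = dunkl_op n \<kappa> (\<tau> i) f (swap_coords a b x)"
proof -
  have u: "swap_coords a b (x(i := t)) = (swap_coords a b x)(\<tau> i := t)" for t
    by (auto simp: fun_eq_iff swap_coords_def \<tau>_def Transposition.transpose_def)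
  have v: "swap_coords a b x (\<tau> i) = x i"
    by (auto simp: swap_coords_def \<tau>_def Transposition.transpose_def)
  have "bij_betw \<tau> ({1..n} - {i}) ({1..n} - {\<tau> i})"
  proof -
    have "bij_betw \<tau> {1..n} {1..n}"
      unfolding \<tau>_def using assms by (intro permutes_imp_bij permutes_swap_id) auto
    then show ?thesis
      by (rule bij_betw_DiffI)
        (use assms in \<open>auto simp: bij_betw_def \<tau>_def Transposition.transpose_def\<close>)
  qed
  then have "(\<Sum>j\<in>{1..n} - {\<tau> i}. dunkl_quotient (\<tau> i) j f (swap_coords a b x))
     = (\<Sum>j\<in>{1..n} - {i}. dunkl_quotient (\<tau> i) (\<tau> j) f (swap_coords a b x))"
    by (rule sum.reindex_bij_betw[symmetric])
  also have "\<dots> = (\<Sum>j\<in>{1..n} - {i}. dunkl_quotient i j (\<lambda>x. f (swap_coords a b x)) x)"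
    by (intro sum.cong refl) (auto simp: dunkl_quotient_swap \<tau>_def)
  finally show ?thesis
    by (simp add: dunkl_op_def partial_deriv_def u v)
qed

section \<open>Commutativity of the Dunkl operators\<close>

lemma dunkl_op_coord_ext:
  assumes "homog n m f" "i \<in> {1..n}" "k \<in> {1..n}"
  shows "dunkl_op n \<kappa> i (\<lambda>x. x k * f x) = (\<lambda>x. x k * dunkl_op n \<kappa> i f x +
    (if i = k then f x + \<kappa> * (\<Sum>j\<in>{1..n} - {i}. f (swap_coords i j x))
     else - \<kappa> * f (swap_coords i k x)))"
  using dunkl_op_coord[OF assms] by blast

lemma swap_coords_commute: "swap_coords i j x = swap_coords j i x"
  by (auto simp: swap_coords_def)

lemma swap_coords_same [simp]: "swap_coords i i x = x"
  by (auto simp: swap_coords_def)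

text \<open>
  The three rules below expand $D_i D_j (x_k f)$ for \<open>k \<notin> {i, j}\<close>, then $D_i D_j (x_i f)$ and
  $D_j D_i (x_i f)$. If $D_i D_j f = D_j D_i f$, the first expression is symmetric in \<open>i\<close> and \<open>j\<close> and the
  other two agree; so commutativity passes from \<open>f\<close> to $x_k f$.
\<close>

lemma dunkl_op_dunkl_op_coord_other:
  assumes f: "homog n m f" and ijk: "i \<in> {1..n}" "j \<in> {1..n}" "k \<in> {1..n}" "k \<noteq> i" "k \<noteq> j" "i \<noteq> j"
  shows "dunkl_op n \<kappa> i (dunkl_op n \<kappa> j (\<lambda>x. x k * f x)) x =
    x k * dunkl_op n \<kappa> i (dunkl_op n \<kappa> j f) x
    - \<kappa> * dunkl_op n \<kappa> j f (swap_coords i k x) - \<kappa> * dunkl_op n \<kappa> i f (swap_coords j k x)"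
proof -
  obtain d where d: "homog n d (dunkl_op n \<kappa> j f)"
    using homog_pred_imp_homog[OF homog_dunkl_op[OF f ijk(2)]] by blast
  have s: "homog n m (\<lambda>x. f (swap_coords j k x))"
    by (rule homog_swap[OF f ijk(2,3)])
  have "dunkl_op n \<kappa> j (\<lambda>x. x k * f x) = (\<lambda>x. x k * dunkl_op n \<kappa> j f x + - \<kappa> * f (swap_coords j k x))"
    using dunkl_op_coord_ext[OF f ijk(2,3), of \<kappa>] ijk by simp
  then have "dunkl_op n \<kappa> i (dunkl_op n \<kappa> j (\<lambda>x. x k * f x)) x =
      dunkl_op n \<kappa> i (\<lambda>x. x k * dunkl_op n \<kappa> j f x) x + - \<kappa> * dunkl_op n \<kappa> i (\<lambda>x. f (swap_coords j k x)) x"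
    using dunkl_op_add[OF homog.coord[OF ijk(3) d] homog_scale[OF s] ijk(1), of \<kappa> "-\<kappa>" x]
      dunkl_op_scale[OF s ijk(1), of \<kappa> "-\<kappa>" x] by (simp only:)
  then show ?thesis
    using dunkl_op_coord[OF d ijk(1,3), of \<kappa> x] dunkl_op_swap[OF ijk(2,3,1), of \<kappa> f x] ijk
    by (simp add: Transposition.transpose_def)
qed

lemma dunkl_op_dunkl_op_coord_outer:
  assumes f: "homog n m f" and ij: "i \<in> {1..n}" "j \<in> {1..n}" "i \<noteq> j"
  shows "dunkl_op n \<kappa> i (dunkl_op n \<kappa> j (\<lambda>x. x i * f x)) x =
    x i * dunkl_op n \<kappa> i (dunkl_op n \<kappa> j f) x + dunkl_op n \<kappa> j f x
    + \<kappa> * (\<Sum>k\<in>{1..n} - {i,j}. dunkl_op n \<kappa> j f (swap_coords i k x))"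
proof -
  obtain d where d: "homog n d (dunkl_op n \<kappa> j f)"
    using homog_pred_imp_homog[OF homog_dunkl_op[OF f ij(2)]] by blast
  have s: "homog n m (\<lambda>x. f (swap_coords j i x))"
    by (rule homog_swap[OF f ij(2,1)])
  have "dunkl_op n \<kappa> j (\<lambda>x. x i * f x) = (\<lambda>x. x i * dunkl_op n \<kappa> j f x + - \<kappa> * f (swap_coords j i x))"
    using dunkl_op_coord_ext[OF f ij(2,1), of \<kappa>] ij by simp
  then have "dunkl_op n \<kappa> i (dunkl_op n \<kappa> j (\<lambda>x. x i * f x)) x =
      dunkl_op n \<kappa> i (\<lambda>x. x i * dunkl_op n \<kappa> j f x) x + - \<kappa> * dunkl_op n \<kappa> i (\<lambda>x. f (swap_coords j i x)) x"
    using dunkl_op_add[OF homog.coord[OF ij(1) d] homog_scale[OF s] ij(1), of \<kappa> "-\<kappa>" x]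
      dunkl_op_scale[OF s ij(1), of \<kappa> "-\<kappa>" x] by (simp only:)
  moreover have "(\<Sum>k\<in>{1..n} - {i}. dunkl_op n \<kappa> j f (swap_coords i k x)) =
      dunkl_op n \<kappa> j f (swap_coords i j x) + (\<Sum>k\<in>{1..n} - {i,j}. dunkl_op n \<kappa> j f (swap_coords i k x))"
    using ij by (subst sum.remove[of _ j]) (auto simp: Diff_insert2[symmetric] insert_commute)
  ultimately show ?thesis
    using dunkl_op_coord[OF d ij(1,1), of \<kappa> x] dunkl_op_swap[OF ij(2,1,1), of \<kappa> f x] ij
    by (simp add: Transposition.transpose_def swap_coords_commute[of j i] distrib_left)
qed

lemma dunkl_op_dunkl_op_coord_inner:
  assumes f: "homog n m f" and ij: "i \<in> {1..n}" "j \<in> {1..n}" "i \<noteq> j"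
  shows "dunkl_op n \<kappa> j (dunkl_op n \<kappa> i (\<lambda>x. x i * f x)) x =
    x i * dunkl_op n \<kappa> j (dunkl_op n \<kappa> i f) x + dunkl_op n \<kappa> j f x
    + \<kappa> * (\<Sum>k\<in>{1..n} - {i,j}. dunkl_op n \<kappa> j f (swap_coords i k x))"
proof -
  obtain d where d: "homog n d (dunkl_op n \<kappa> i f)"
    using homog_pred_imp_homog[OF homog_dunkl_op[OF f ij(1)]] by blast
  let ?S = "\<lambda>x. \<Sum>k\<in>{1..n} - {i}. f (swap_coords i k x)"
  have s: "homog n m (\<lambda>x. f (swap_coords i k x))" if "k \<in> {1..n} - {i}" for k
    using that by (intro homog_swap[OF f ij(1)]) auto
  have S: "homog n m ?S" by (intro homog_sum s)
  have "dunkl_op n \<kappa> i (\<lambda>x. x i * f x) = (\<lambda>x. x i * dunkl_op n \<kappa> i f x + (f x + \<kappa> * ?S x))"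
    using dunkl_op_coord_ext[OF f ij(1,1), of \<kappa>] by simp
  then have "dunkl_op n \<kappa> j (dunkl_op n \<kappa> i (\<lambda>x. x i * f x)) x =
      dunkl_op n \<kappa> j (\<lambda>x. x i * dunkl_op n \<kappa> i f x) x + (dunkl_op n \<kappa> j f x + \<kappa> * dunkl_op n \<kappa> j ?S x)"
    using dunkl_op_add[OF homog.coord[OF ij(1) d] homog.add[OF f homog_scale[OF S]] ij(2), of \<kappa> \<kappa> x]
      dunkl_op_add[OF f homog_scale[OF S] ij(2), of \<kappa> \<kappa> x]
      dunkl_op_scale[OF S ij(2), of \<kappa> \<kappa> x] by (simp only:)
  moreover have "dunkl_op n \<kappa> j ?S x =
      dunkl_op n \<kappa> i f (swap_coords i j x) + (\<Sum>k\<in>{1..n} - {i,j}. dunkl_op n \<kappa> j f (swap_coords i k x))"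
  proof -
    have "dunkl_op n \<kappa> j ?S x = (\<Sum>k\<in>{1..n} - {i}. dunkl_op n \<kappa> j (\<lambda>x. f (swap_coords i k x)) x)"
      using s ij(2) by (intro dunkl_op_sum[of _ n "\<lambda>_. m"]) auto
    also have "\<dots> = (\<Sum>k\<in>{1..n} - {i}. dunkl_op n \<kappa> (Transposition.transpose i k j) f (swap_coords i k x))"
      using ij by (intro sum.cong refl dunkl_op_swap) auto
    also have "\<dots> = dunkl_op n \<kappa> (Transposition.transpose i j j) f (swap_coords i j x) +
        (\<Sum>k\<in>{1..n} - {i,j}. dunkl_op n \<kappa> (Transposition.transpose i k j) f (swap_coords i k x))"
      using ij by (subst sum.remove[of _ j]) (auto simp: Diff_insert2[symmetric] insert_commute)
    also have "(\<Sum>k\<in>{1..n} - {i,j}. dunkl_op n \<kappa> (Transposition.transpose i k j) f (swap_coords i k x)) =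
        (\<Sum>k\<in>{1..n} - {i,j}. dunkl_op n \<kappa> j f (swap_coords i k x))"
      using ij by (intro sum.cong refl) (auto simp: Transposition.transpose_def)
    finally show ?thesis by simp
  qed
  ultimately show ?thesis
    using dunkl_op_coord[OF d ij(2,1), of \<kappa> x] ij
    by (simp add: swap_coords_commute[of j i] distrib_left)
qed

lemma dunkl_op_commute:
  assumes "homog n m f" "i \<in> {1..n}" "j \<in> {1..n}"
  shows "dunkl_op n \<kappa> i (dunkl_op n \<kappa> j f) x = dunkl_op n \<kappa> j (dunkl_op n \<kappa> i f) x"
  using assms(1)
proof (induction arbitrary: x rule: homog.induct)
  case (const c)
  have "dunkl_op n \<kappa> i (\<lambda>x. c) = (\<lambda>_. 0)" for i by (rule ext, rule dunkl_op_const)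
  then show ?case by (simp add: dunkl_op_const)
next
  case (zero m)
  have "dunkl_op n \<kappa> i (\<lambda>x. 0) = (\<lambda>_. 0)" for i by (rule ext, rule dunkl_op_const)
  then show ?case by (simp add: dunkl_op_const)
next
  case (coord k m f)
  note IH = coord.IH and f = coord.hyps(2) and k = coord.hyps(1)
  consider "i = j" | "i \<noteq> j" "k = i" | "i \<noteq> j" "k = j" | "i \<noteq> j" "k \<noteq> i" "k \<noteq> j" by blast
  then show ?case
  proof cases
    case 1
    then show ?thesis by simp
  next
    case 2
    then show ?thesis
      using dunkl_op_dunkl_op_coord_outer[OF f assms(2,3), of \<kappa> x]
        dunkl_op_dunkl_op_coord_inner[OF f assms(2,3), of \<kappa> x] by (simp add: IH)
  next
    case 3
    then show ?thesis
      using dunkl_op_dunkl_op_coord_outer[OF f assms(3,2), of \<kappa> x]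
        dunkl_op_dunkl_op_coord_inner[OF f assms(3,2), of \<kappa> x] by (simp add: IH)
  next
    case 4
    then show ?thesis
      using dunkl_op_dunkl_op_coord_other[OF f assms(2,3) k, of \<kappa> x]
        dunkl_op_dunkl_op_coord_other[OF f assms(3,2) k, of \<kappa> x] by (simp add: IH)
  qed
next
  case (add m f g)
  have "dunkl_op n \<kappa> a (dunkl_op n \<kappa> b (\<lambda>x. f x + g x)) x =
      dunkl_op n \<kappa> a (dunkl_op n \<kappa> b f) x + dunkl_op n \<kappa> a (dunkl_op n \<kappa> b g) x"
    if ab: "a \<in> {1..n}" "b \<in> {1..n}" for a b
  proof -
    obtain d e where d: "homog n d (dunkl_op n \<kappa> b f)" and e: "homog n e (dunkl_op n \<kappa> b g)"
      using homog_pred_imp_homog[OF homog_dunkl_op[OF add.hyps(1) ab(2)]]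
        homog_pred_imp_homog[OF homog_dunkl_op[OF add.hyps(2) ab(2)]] by blast
    have "dunkl_op n \<kappa> b (\<lambda>x. f x + g x) = (\<lambda>x. dunkl_op n \<kappa> b f x + dunkl_op n \<kappa> b g x)"
      using dunkl_op_add[OF add.hyps ab(2)] by blast
    then show ?thesis using dunkl_op_add[OF d e ab(1)] by simp
  qed
  then show ?case using assms(2,3) add.IH by simp
qed

section \<open>Euler's identity and the maximum principle\<close>

lemma euler_partial_deriv:
  assumes "homog n m f"
  shows "(\<Sum>i=1..n. x i * partial_deriv i f x) = real m * f x"
  using assms
proof (induction rule: homog.induct)
  case (const c)
  then show ?case by (simp add: partial_deriv_def)
next
  case (zero m)
  then show ?case by (simp add: partial_deriv_def)
next
  case (coord k m f)
  have "(\<Sum>i=1..n. x i * partial_deriv i (\<lambda>x. x k * f x) x) =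
      (\<Sum>i=1..n. x k * (x i * partial_deriv i f x) + (if i = k then x i * f x else 0))"
    by (intro sum.cong refl) (simp add: partial_deriv_coord[OF coord.hyps(2)] algebra_simps)
  also have "\<dots> = x k * (real m * f x) + x k * f x"
    using coord by (simp add: sum.distrib sum_distrib_left[symmetric])
  finally show ?case by (simp add: algebra_simps)
next
  case (add m f g)
  then show ?case by (simp add: partial_deriv_add[OF add.hyps] distrib_left sum.distrib)
qed

lemma dunkl_quotient_antisym:
  assumes "homog n m f" "i \<in> {1..n}" "j \<in> {1..n}" "i \<noteq> j"
  shows "dunkl_quotient j i f x = - dunkl_quotient i j f x"
proof (rule dunkl_quotient_eqI)
  show "f x - f (swap_coords j i x) = (x j - x i) * - dunkl_quotient i j f x" for x
    using homog_dunkl_quotient(2)[OF assms, of x] by (simp add: swap_coords_commute[of j i] algebra_simps)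
  show "isCont (\<lambda>t. - dunkl_quotient i j f (x(j := t))) (x j)"
    by (rule continuous_minus, rule exE[OF homog_pred_imp_homog[OF homog_dunkl_quotient(1)[OF assms]]], rule homog_isCont)
qed (use assms in auto)

text \<open>
  Euler's identity for Dunkl operators. The double sum runs over all ordered pairs, so that
  every transposition is counted twice and the diagonal contributes nothing.
\<close>

lemma euler_dunkl_op:
  assumes "homog n m f"
  shows "(\<Sum>i=1..n. x i * dunkl_op n \<kappa> i f x) =
    real m * f x + \<kappa> / 2 * (\<Sum>i=1..n. \<Sum>j=1..n. f x - f (swap_coords i j x))"
proof -
  define q where "q i j = (if i = j then 0 else dunkl_quotient i j f x)" for i j
  have q: "f x - f (swap_coords i j x) = (x i - x j) * q i j" "q j i = - q i j"
    if "i \<in> {1..n}" "j \<in> {1..n}" for i j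
    using homog_dunkl_quotient(2)[OF assms that, of x] dunkl_quotient_antisym[OF assms that, of x]
    by (auto simp: q_def)
  have S: "(\<Sum>j\<in>{1..n} - {i}. dunkl_quotient i j f x) = (\<Sum>j=1..n. q i j)" if "i \<in> {1..n}" for i
    using that by (intro sum.mono_neutral_cong_left) (auto simp: q_def)
  let ?T = "\<Sum>i=1..n. \<Sum>j=1..n. x i * q i j"
  have "?T = (\<Sum>i=1..n. \<Sum>j=1..n. x j * q j i)" by (rule sum.swap)
  also have "\<dots> = (\<Sum>i=1..n. \<Sum>j=1..n. - x j * q i j)"
  proof (intro sum.cong refl)
    fix i j assume "i \<in> {1..n}" "j \<in> {1..n}"
    from q(2)[OF this] show "x j * q j i = - x j * q i j" by simp
  qed
  finally have "2 * ?T = (\<Sum>i=1..n. \<Sum>j=1..n. x i * q i j + - x j * q i j)"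
    by (simp only: sum.distrib mult_2)
  also have "\<dots> = (\<Sum>i=1..n. \<Sum>j=1..n. f x - f (swap_coords i j x))"
    by (intro sum.cong refl) (simp add: q(1) algebra_simps)
  finally have T: "?T = 1 / 2 * (\<Sum>i=1..n. \<Sum>j=1..n. f x - f (swap_coords i j x))" by simp
  have "(\<Sum>i=1..n. x i * dunkl_op n \<kappa> i f x) =
      (\<Sum>i=1..n. x i * partial_deriv i f x + \<kappa> * (\<Sum>j=1..n. x i * q i j))"
    by (intro sum.cong refl) (simp only: dunkl_op_def S sum_distrib_left[symmetric] distrib_left mult.left_commute)
  also have "\<dots> = real m * f x + \<kappa> * ?T"
    by (simp only: sum.distrib euler_partial_deriv[OF assms] sum_distrib_left)
  finally show ?thesis unfolding T by simp
qed

text \<open>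
  The maximum principle on a finite set, applied below to the orbit of a point under the
  symmetric group: at a maximum all differences under transpositions have a sign, and \<open>\<kappa> \<ge> 0\<close>
  preserves it.
\<close>

lemma nonpos_if_nonpos_at_maximum:
  fixes u :: "'a \<Rightarrow> real"
  assumes "finite S" "\<And>s. s \<in> S \<Longrightarrow> (\<And>t. t \<in> S \<Longrightarrow> u t \<le> u s) \<Longrightarrow> u s \<le> 0" "s \<in> S"
  shows "u s \<le> 0"
proof -
  have "Max (u ` S) \<in> u ` S" using assms by (intro Max_in) auto
  then obtain r where r: "r \<in> S" "u r = Max (u ` S)" by auto
  then have max: "u t \<le> u r" if "t \<in> S" for t using assms(1) that by simp
  then have "u r \<le> 0" using assms(2) r(1) by blast
  then show ?thesis using max[OF assms(3)] by simp
qed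

text \<open>The orbit of a point under permutations of its first \<open>n\<close> coordinates.\<close>

definition orbit :: "nat \<Rightarrow> (nat \<Rightarrow> real) \<Rightarrow> (nat \<Rightarrow> real) set" where
  "orbit n x = {x \<circ> \<pi> |\<pi>. \<pi> permutes {1..n}}"

lemma finite_orbit: "finite (orbit n x)"
  unfolding orbit_def using finite_permutations[of "{1..n}"] by simp

lemma self_in_orbit: "x \<in> orbit n x"
  unfolding orbit_def by (intro CollectI exI[of _ id]) (simp add: permutes_id)

lemma swap_in_orbit:
  assumes "y \<in> orbit n x" "i \<in> {1..n}" "j \<in> {1..n}"
  shows "swap_coords i j y \<in> orbit n x"
proof -
  obtain \<pi> where "\<pi> permutes {1..n}" "y = x \<circ> \<pi>" using assms(1) by (auto simp: orbit_def)
  then show ?thesis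
    using permutes_compose[OF permutes_swap_id[OF assms(2,3)]]
    unfolding orbit_def swap_coords_eq_comp by (auto simp: comp_assoc)
qed

text \<open>
  For \<open>\<kappa> \<ge> 0\<close> the common kernel of the Dunkl operators contains no nonzero homogeneous polynomial
  of positive degree. This gives uniqueness of the intertwining operator.
\<close>

lemma dunkl_joint_kernel_trivial:
  assumes f: "homog n m f" and "m > 0" "\<kappa> \<ge> 0"
    and D: "\<And>i x. i \<in> {1..n} \<Longrightarrow> dunkl_op n \<kappa> i f x = 0"
  shows "f x = 0"
proof -
  have nonpos: "g x \<le> 0" if g: "homog n m g" "\<And>i x. i \<in> {1..n} \<Longrightarrow> dunkl_op n \<kappa> i g x = 0" for g
  proof (rule nonpos_if_nonpos_at_maximum[where u = g, OF finite_orbit _ self_in_orbit])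
    fix y assume y: "y \<in> orbit n x" and max: "\<And>z. z \<in> orbit n x \<Longrightarrow> g z \<le> g y"
    have "0 \<le> (\<Sum>i=1..n. \<Sum>j=1..n. g y - g (swap_coords i j y))"
      using max swap_in_orbit[OF y] by (intro sum_nonneg) auto
    then have "0 \<le> \<kappa> / 2 * (\<Sum>i=1..n. \<Sum>j=1..n. g y - g (swap_coords i j y))"
      using \<open>\<kappa> \<ge> 0\<close> by (intro mult_nonneg_nonneg) auto
    moreover have "real m * g y + \<kappa> / 2 * (\<Sum>i=1..n. \<Sum>j=1..n. g y - g (swap_coords i j y)) = 0"
      unfolding euler_dunkl_op[OF g(1), symmetric] using g(2) by simp
    ultimately have "real m * g y \<le> 0" by linarith
    then show "g y \<le> 0" using \<open>m > 0\<close> by (simp add: mult_le_0_iff)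
  qed
  have "dunkl_op n \<kappa> i (\<lambda>x. -1 * f x) x = 0" if "i \<in> {1..n}" for i x
    by (simp only: dunkl_op_scale[OF f that] D[OF that])
  then show ?thesis
    using nonpos[OF f D] nonpos[OF homog_scale[OF f, of "-1"]] by force
qed

text \<open>
  A family \<open>h\<close> of polynomials that is closed, in the sense $D_i h_j = D_j h_i$, and whose radial
  part vanishes is zero. Applying $D_j$ to the radial equation gives a linear system that
  couples the values $h_j(y)$ and $h_k(y(j,k))$; the maximum principle applies to it on pairs
  consisting of an index and a point of the orbit. This gives existence of the intertwining
  operator.
\<close>

lemma dunkl_closed_radial_zero:
  assumes h: "\<And>j. j \<in> {1..n} \<Longrightarrow> homog n m (h j)" and "\<kappa> \<ge> 0"
    and closed: "\<And>i j x. i \<in> {1..n} \<Longrightarrow> j \<in> {1..n} \<Longrightarrow> dunkl_op n \<kappa> i (h j) x = dunkl_op n \<kappa> j (h i) x"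
    and radial: "\<And>x. (\<Sum>i=1..n. x i * h i x) = 0"
    and j: "j \<in> {1..n}"
  shows "h j x = 0"
proof -
  have eq: "real (Suc m) * h j y + \<kappa> / 2 * (\<Sum>i=1..n. \<Sum>k=1..n. h j y - h j (swap_coords i k y))
      + \<kappa> * (\<Sum>k\<in>{1..n} - {j}. h j (swap_coords j k y) - h k (swap_coords j k y)) = 0"
    if j: "j \<in> {1..n}" for j y
  proof -
    have "(\<lambda>x. \<Sum>i=1..n. x i * h i x) = (\<lambda>_. 0)" using radial by blast
    then have "0 = dunkl_op n \<kappa> j (\<lambda>x. \<Sum>i=1..n. x i * h i x) y" by (simp add: dunkl_op_const)
    also have "\<dots> = (\<Sum>i=1..n. dunkl_op n \<kappa> j (\<lambda>x. x i * h i x) y)"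
      using h j by (intro dunkl_op_sum[of _ n "\<lambda>_. Suc m"]) (auto intro!: homog.coord)
    also have "\<dots> = (\<Sum>i=1..n. y i * dunkl_op n \<kappa> i (h j) y +
        (if i = j then h j y + \<kappa> * (\<Sum>k\<in>{1..n} - {j}. h j (swap_coords j k y))
         else - \<kappa> * h i (swap_coords j i y)))"
      using h j closed by (intro sum.cong refl) (auto simp: dunkl_op_coord[of n m])
    also have "\<dots> = (\<Sum>i=1..n. y i * dunkl_op n \<kappa> i (h j) y) +
        (h j y + \<kappa> * (\<Sum>k\<in>{1..n} - {j}. h j (swap_coords j k y)) +
         (\<Sum>i\<in>{1..n} - {j}. - \<kappa> * h i (swap_coords j i y)))"
    proof -
      have "(\<Sum>i=1..n. if i = j then h j y + \<kappa> * (\<Sum>k\<in>{1..n} - {j}. h j (swap_coords j k y))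
         else - \<kappa> * h i (swap_coords j i y)) =
        h j y + \<kappa> * (\<Sum>k\<in>{1..n} - {j}. h j (swap_coords j k y)) +
         (\<Sum>i\<in>{1..n} - {j}. - \<kappa> * h i (swap_coords j i y))"
        by (subst sum.remove[OF _ j]) (auto intro!: sum.cong)
      then show ?thesis by (simp only: sum.distrib)
    qed
    finally show ?thesis
      unfolding euler_dunkl_op[OF h[OF j]]
      by (simp add: sum_subtractf sum_negf distrib_left distrib_right right_diff_distrib flip: sum_distrib_left)
  qed
  \<comment> \<open>The system is linear, so the maximum principle also applies to the negated family.\<close>
  have nonpos: "c * h j x \<le> 0" if c: "c = 1 \<or> c = -1" for c
  proof -
    define u where "u = (\<lambda>(j, y). c * h j y)"
    have "u (j, x) \<le> 0"
    proof (rule nonpos_if_nonpos_at_maximum[of "{1..n} \<times> orbit n x"])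
      show "finite ({1..n} \<times> orbit n x)" using finite_orbit by blast
      show "(j, x) \<in> {1..n} \<times> orbit n x" using j self_in_orbit by blast
    next
      fix s assume s: "s \<in> {1..n} \<times> orbit n x" and max: "\<And>t. t \<in> {1..n} \<times> orbit n x \<Longrightarrow> u t \<le> u s"
      obtain a y where ay: "s = (a, y)" "a \<in> {1..n}" "y \<in> orbit n x" using s by auto
      have mx: "c * h b z \<le> c * h a y" if "b \<in> {1..n}" "z \<in> orbit n x" for b z
        using max[of "(b, z)"] that by (auto simp: u_def ay)
      define g where "g i k = c * h a y - c * h a (swap_coords i k y)" for i k
      have g: "g i k \<ge> 0" if "i \<in> {1..n}" "k \<in> {1..n}" for i k
        using mx swap_in_orbit[OF ay(3) that] ay(2) by (auto simp: g_def)
      \<comment> \<open>The pairs that contain \<open>a\<close> occur twice in the double sum, as \<open>(a, k)\<close> and as \<open>(k, a)\<close>;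
        added to the last sum of \<open>eq\<close> they replace \<open>h a (swap_coords a k y)\<close> by \<open>h a y\<close>.\<close>
      have gg: "2 * (\<Sum>k\<in>{1..n} - {a}. g a k) \<le> (\<Sum>i=1..n. \<Sum>k=1..n. g i k)"
      proof -
        have "(\<Sum>k\<in>{1..n} - {a}. g a k) \<le> (\<Sum>k=1..n. g a k)"
          using g ay(2) by (intro sum_mono2) auto
        moreover have "(\<Sum>i\<in>{1..n} - {a}. g a i) \<le> (\<Sum>i\<in>{1..n} - {a}. \<Sum>k=1..n. g i k)"
        proof (rule sum_mono)
          fix i assume i: "i \<in> {1..n} - {a}"
          have "g i a \<le> (\<Sum>k=1..n. g i k)"
            using g ay(2) i by (intro member_le_sum) auto
          then show "g a i \<le> (\<Sum>k=1..n. g i k)"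
            by (simp add: g_def swap_coords_commute[of i a])
        qed
        moreover have "(\<Sum>i=1..n. \<Sum>k=1..n. g i k) =
            (\<Sum>k=1..n. g a k) + (\<Sum>i\<in>{1..n} - {a}. \<Sum>k=1..n. g i k)"
          by (rule sum.remove) (use ay(2) in auto)
        ultimately show ?thesis by linarith
      qed
      have "c * (real (Suc m) * h a y + \<kappa> / 2 * (\<Sum>i=1..n. \<Sum>k=1..n. h a y - h a (swap_coords i k y))
        + \<kappa> * (\<Sum>k\<in>{1..n} - {a}. h a (swap_coords a k y) - h k (swap_coords a k y))) = 0"
        using eq[OF ay(2), of y] by simp
      then have "real (Suc m) * (c * h a y) + \<kappa> / 2 * (\<Sum>i=1..n. \<Sum>k=1..n. g i k)
        + \<kappa> * (\<Sum>k\<in>{1..n} - {a}. c * h a (swap_coords a k y) - c * h k (swap_coords a k y)) = 0"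
        unfolding g_def by (simp only: right_diff_distrib[symmetric] sum_distrib_left[symmetric])
          (simp only: distrib_left mult.left_commute)
      moreover have "\<kappa> / 2 * (2 * (\<Sum>k\<in>{1..n} - {a}. g a k)) \<le> \<kappa> / 2 * (\<Sum>i=1..n. \<Sum>k=1..n. g i k)"
        using gg \<open>\<kappa> \<ge> 0\<close> by (intro mult_left_mono) auto
      ultimately have "real (Suc m) * (c * h a y) + \<kappa> * ((\<Sum>k\<in>{1..n} - {a}. g a k)
        + (\<Sum>k\<in>{1..n} - {a}. c * h a (swap_coords a k y) - c * h k (swap_coords a k y))) \<le> 0"
        by (simp add: algebra_simps)
      moreover have "0 \<le> \<kappa> * ((\<Sum>k\<in>{1..n} - {a}. g a k)
        + (\<Sum>k\<in>{1..n} - {a}. c * h a (swap_coords a k y) - c * h k (swap_coords a k y)))"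
        unfolding sum.distrib[symmetric] using \<open>\<kappa> \<ge> 0\<close> mx swap_in_orbit[OF ay(3) ay(2)]
        by (intro mult_nonneg_nonneg sum_nonneg) (auto simp: g_def)
      ultimately have "real (Suc m) * (c * h a y) \<le> 0" by linarith
      then show "u s \<le> 0" by (simp add: u_def ay mult_le_0_iff del: of_nat_Suc)
    qed
    then show ?thesis by (simp add: u_def)
  qed
  show ?thesis using nonpos[of 1] nonpos[of "-1"] by simp
qed

section \<open>Existence and uniqueness of the intertwining operator\<close>

text \<open>
  The operator of Euler's identity, $f \mapsto m f + \frac{\kappa}{2} \sum_{i,j} (f - f \circ (i,j))$, is
  inverted inside the group algebra of the symmetric group. It equals the constant
  \<open>resolvent_const\<close> times the identity, minus $\frac{\kappa}{2}$ times the sum of \<open>(i,j)\<close> over all $n^2$ ordered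
  pairs. For \<open>m > 0\<close> and \<open>\<kappa> \<ge> 0\<close> the constant exceeds the norm $\frac{\kappa}{2} n^2$ of that sum, so that the Neumann
  series converges. The coefficients of its limit are \<open>resolvent_coeff\<close>, and \<open>resolvent\<close> is the
  resulting inverse, a finite combination of permutations of the variables; in particular it
  preserves homogeneous polynomials.
\<close>

definition resolvent_const :: "nat \<Rightarrow> real \<Rightarrow> nat \<Rightarrow> real" where
  "resolvent_const n \<kappa> m = real m + \<kappa> * (real n)\<^sup>2 / 2"

primrec resolvent_term :: "nat \<Rightarrow> real \<Rightarrow> nat \<Rightarrow> nat \<Rightarrow> (nat \<Rightarrow> nat) \<Rightarrow> real" where
  "resolvent_term n \<kappa> m 0 \<pi> = of_bool (\<pi> = id) / resolvent_const n \<kappa> m"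
| "resolvent_term n \<kappa> m (Suc k) \<pi> = \<kappa> / (2 * resolvent_const n \<kappa> m) *
     (\<Sum>i=1..n. \<Sum>j=1..n. resolvent_term n \<kappa> m k (Transposition.transpose i j \<circ> \<pi>))"

definition resolvent_coeff :: "nat \<Rightarrow> real \<Rightarrow> nat \<Rightarrow> (nat \<Rightarrow> nat) \<Rightarrow> real" where
  "resolvent_coeff n \<kappa> m \<pi> = (\<Sum>k. resolvent_term n \<kappa> m k \<pi>)"

definition resolvent ::
    "nat \<Rightarrow> real \<Rightarrow> nat \<Rightarrow> ((nat \<Rightarrow> real) \<Rightarrow> real) \<Rightarrow> (nat \<Rightarrow> real) \<Rightarrow> real" where
  "resolvent n \<kappa> m f x = (\<Sum>\<pi> | \<pi> permutes {1..n}. resolvent_coeff n \<kappa> m \<pi> * f (x \<circ> \<pi>))"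

lemma resolvent_term_bound:
  fixes n m :: nat and \<kappa> :: real
  assumes "m > 0" "\<kappa> \<ge> 0"
  defines "C \<equiv> resolvent_const n \<kappa> m"
  shows "\<bar>resolvent_term n \<kappa> m k \<pi>\<bar> \<le> (\<kappa> * (real n)\<^sup>2 / (2 * C)) ^ k / C"
proof (induction k arbitrary: \<pi>)
  have C: "C > 0" unfolding C_def resolvent_const_def using assms by (intro add_pos_nonneg) auto
  {
    case 0
    then show ?case using C by (simp add: C_def)
  next
    case (Suc k)
    let ?b = "(\<kappa> * (real n)\<^sup>2 / (2 * C)) ^ k / C"
    have "\<bar>\<Sum>i=1..n. \<Sum>j=1..n. resolvent_term n \<kappa> m k (Transposition.transpose i j \<circ> \<pi>)\<bar>
        \<le> (\<Sum>i=1..n. \<Sum>j=1..n. ?b)"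
      by (intro order_trans[OF sum_abs] sum_mono Suc.IH)
    also have "\<dots> = (real n)\<^sup>2 * ?b" by (simp add: power2_eq_square)
    finally have "\<kappa> / (2 * C) * \<bar>\<Sum>i=1..n. \<Sum>j=1..n. resolvent_term n \<kappa> m k (Transposition.transpose i j \<circ> \<pi>)\<bar>
        \<le> \<kappa> / (2 * C) * ((real n)\<^sup>2 * ?b)"
      using C \<open>\<kappa> \<ge> 0\<close> by (intro mult_left_mono) auto
    also have "\<dots> = (\<kappa> * (real n)\<^sup>2 / (2 * C)) ^ Suc k / C" by simp
    finally show ?case using C \<open>\<kappa> \<ge> 0\<close> by (simp add: C_def[symmetric] abs_mult)
  }
qed

lemma summable_resolvent_term:
  assumes "m > 0" "\<kappa> \<ge> 0"
  shows "summable (\<lambda>k. resolvent_term n \<kappa> m k \<pi>)"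
proof -
  define C where "C = resolvent_const n \<kappa> m"
  have C: "C > 0" "\<kappa> * (real n)\<^sup>2 < 2 * C"
    unfolding C_def resolvent_const_def using assms by (auto intro: add_pos_nonneg)
  have "summable (\<lambda>k. (\<kappa> * (real n)\<^sup>2 / (2 * C)) ^ k / C)"
    using C \<open>\<kappa> \<ge> 0\<close> by (intro summable_divide summable_geometric) (simp add: divide_simps)
  then show ?thesis
    by (rule summable_comparison_test[rotated])
       (use resolvent_term_bound[OF assms, of n] in \<open>simp add: C_def\<close>)
qed

lemma resolvent_coeff_equation:
  assumes "m > 0" "\<kappa> \<ge> 0"
  shows "resolvent_const n \<kappa> m * resolvent_coeff n \<kappa> m \<pi> = of_bool (\<pi> = id) +
    \<kappa> / 2 * (\<Sum>i=1..n. \<Sum>j=1..n. resolvent_coeff n \<kappa> m (Transposition.transpose i j \<circ> \<pi>))"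
proof -
  have C: "resolvent_const n \<kappa> m > 0"
    unfolding resolvent_const_def using assms by (intro add_pos_nonneg) auto
  note S = summable_resolvent_term[OF assms]
  have "resolvent_coeff n \<kappa> m \<pi> = resolvent_term n \<kappa> m 0 \<pi> + (\<Sum>k. resolvent_term n \<kappa> m (Suc k) \<pi>)"
    unfolding resolvent_coeff_def using suminf_split_head[OF S, of n \<pi>] by simp
  also have "(\<Sum>k. resolvent_term n \<kappa> m (Suc k) \<pi>) = \<kappa> / (2 * resolvent_const n \<kappa> m) *
     (\<Sum>k. \<Sum>i=1..n. \<Sum>j=1..n. resolvent_term n \<kappa> m k (Transposition.transpose i j \<circ> \<pi>))"
    unfolding resolvent_term.simps by (intro suminf_mult summable_sum S)
  also have "(\<Sum>k. \<Sum>i=1..n. \<Sum>j=1..n. resolvent_term n \<kappa> m k (Transposition.transpose i j \<circ> \<pi>)) =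
     (\<Sum>i=1..n. \<Sum>j=1..n. resolvent_coeff n \<kappa> m (Transposition.transpose i j \<circ> \<pi>))"
    by (simp only: suminf_sum summable_sum S resolvent_coeff_def)
  finally show ?thesis using C by (simp add: field_simps)
qed

lemma resolvent_equation:
  fixes n m :: nat and \<kappa> :: real and f :: "(nat \<Rightarrow> real) \<Rightarrow> real"
  assumes "m > 0" "\<kappa> \<ge> 0"
  defines "g \<equiv> resolvent n \<kappa> m f"
  shows "real m * g x + \<kappa> / 2 * (\<Sum>i=1..n. \<Sum>j=1..n. g x - g (swap_coords i j x)) = f x"
proof -
  let ?P = "{\<pi>. \<pi> permutes {1..n}}" and ?a = "resolvent_coeff n \<kappa> m"
  have swap: "g (swap_coords i j x) = (\<Sum>\<pi>\<in>?P. ?a (Transposition.transpose i j \<circ> \<pi>) * f (x \<circ> \<pi>))"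
    if "i \<in> {1..n}" "j \<in> {1..n}" for i j
    unfolding g_def resolvent_def swap_coords_eq_comp
    using permutes_compose[OF _ permutes_swap_id[OF that]]
    by (intro sum.reindex_bij_witness[of _ "\<lambda>\<pi>. Transposition.transpose i j \<circ> \<pi>"
          "\<lambda>\<pi>. Transposition.transpose i j \<circ> \<pi>"]) (auto simp: comp_assoc[symmetric])
  have "(\<Sum>i=1..n. \<Sum>j=1..n. g (swap_coords i j x)) =
      (\<Sum>i=1..n. \<Sum>j=1..n. \<Sum>\<pi>\<in>?P. ?a (Transposition.transpose i j \<circ> \<pi>) * f (x \<circ> \<pi>))"
    using swap by (intro sum.cong refl)
  also have "\<dots> = (\<Sum>i=1..n. \<Sum>\<pi>\<in>?P. \<Sum>j=1..n. ?a (Transposition.transpose i j \<circ> \<pi>) * f (x \<circ> \<pi>))"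
    by (intro sum.cong refl sum.swap)
  also have "\<dots> = (\<Sum>\<pi>\<in>?P. \<Sum>i=1..n. \<Sum>j=1..n. ?a (Transposition.transpose i j \<circ> \<pi>) * f (x \<circ> \<pi>))"
    by (rule sum.swap)
  also have "\<dots> = (\<Sum>\<pi>\<in>?P. (\<Sum>i=1..n. \<Sum>j=1..n. ?a (Transposition.transpose i j \<circ> \<pi>)) * f (x \<circ> \<pi>))"
    by (simp only: sum_distrib_right)
  finally have S: "(\<Sum>i=1..n. \<Sum>j=1..n. g (swap_coords i j x)) = \<dots>" .
  have "real m * g x + \<kappa> / 2 * (\<Sum>i=1..n. \<Sum>j=1..n. g x - g (swap_coords i j x)) =
      resolvent_const n \<kappa> m * g x - \<kappa> / 2 * (\<Sum>i=1..n. \<Sum>j=1..n. g (swap_coords i j x))"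
    by (simp add: sum_subtractf resolvent_const_def power2_eq_square algebra_simps)
  also have "\<dots> = (\<Sum>\<pi>\<in>?P. (resolvent_const n \<kappa> m * ?a \<pi>
      - \<kappa> / 2 * (\<Sum>i=1..n. \<Sum>j=1..n. ?a (Transposition.transpose i j \<circ> \<pi>))) * f (x \<circ> \<pi>))"
  proof -
    define T where "T \<pi> = (\<Sum>i=1..n. \<Sum>j=1..n. ?a (Transposition.transpose i j \<circ> \<pi>))" for \<pi>
    show ?thesis unfolding S unfolding T_def[symmetric] g_def resolvent_def
      by (simp add: sum_distrib_left left_diff_distrib sum_subtractf mult.assoc)
  qed
  also have "\<dots> = (\<Sum>\<pi>\<in>?P. of_bool (\<pi> = id) * f (x \<circ> \<pi>))"
    by (simp only: resolvent_coeff_equation[OF assms(1,2)]) simp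
  also have "\<dots> = (\<Sum>\<pi>\<in>{id}. of_bool (\<pi> = id) * f (x \<circ> \<pi>))"
    by (intro sum.mono_neutral_right) (auto simp: finite_permutations permutes_id)
  finally show ?thesis by simp
qed

lemma homog_resolvent: "homog n d f \<Longrightarrow> homog n d (resolvent n \<kappa> m f)"
  unfolding resolvent_def[abs_def] by (intro homog_sum homog_scale homog_permute) auto

lemma resolvent_add: "resolvent n \<kappa> m (\<lambda>x. f x + g x) = (\<lambda>x. resolvent n \<kappa> m f x + resolvent n \<kappa> m g x)"
  by (simp add: resolvent_def fun_eq_iff distrib_left sum.distrib)

lemma resolvent_scale: "resolvent n \<kappa> m (\<lambda>x. c * f x) = (\<lambda>x. c * resolvent n \<kappa> m f x)"
  by (simp add: resolvent_def fun_eq_iff sum_distrib_left mult.left_commute)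

lemma resolvent_zero: "resolvent n \<kappa> m (\<lambda>x. 0) = (\<lambda>x. 0)"
  by (simp add: resolvent_def fun_eq_iff)

text \<open>
  The intertwining operator, degree by degree. \<open>intertwiner_part n \<kappa> m p\<close> is the image of the
  homogeneous component of degree \<open>m\<close> of \<open>p\<close>: solving $\sum_i x_i D_i (V p) = \sum_i x_i V (\partial_i p)$
  for $V p$ by the resolvent lowers the degree by one, and the evaluation at the origin in degree 0
  removes the other components, so that they need not be split off beforehand.
\<close>

primrec intertwiner_part ::
    "nat \<Rightarrow> real \<Rightarrow> nat \<Rightarrow> ((nat \<Rightarrow> real) \<Rightarrow> real) \<Rightarrow> (nat \<Rightarrow> real) \<Rightarrow> real" where
  "intertwiner_part n \<kappa> 0 p = (\<lambda>x. p (\<lambda>_. 0))"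
| "intertwiner_part n \<kappa> (Suc m) p = resolvent n \<kappa> (Suc m)
     (\<lambda>x. \<Sum>i=1..n. x i * intertwiner_part n \<kappa> m (partial_deriv i p) x)"

lemma polynomials_scale:
  assumes "p \<in> polynomials n"
  shows "(\<lambda>x. c * p x) \<in> polynomials n"
proof (rule polynomials_decompose[OF assms])
  fix N F assume F: "\<And>m. homog n m (F m)" and p: "p = (\<lambda>x. \<Sum>m<N. F m x)"
  show ?thesis
    unfolding p sum_distrib_left by (rule polynomials_sum, rule homog_imp_polynomials, rule homog_scale[OF F])
qed

lemma polynomials_has_derivative:
  assumes "p \<in> polynomials n"
  shows "((\<lambda>t. p (x(i := t))) has_real_derivative partial_deriv i p x) (at (x i))"
proof (rule polynomials_decompose[OF assms])
  fix N F assume F: "\<And>m. homog n m (F m)" and p: "p = (\<lambda>x. \<Sum>m<N. F m x)"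
  have "((\<lambda>t. p (x(i := t))) has_real_derivative (\<Sum>m<N. partial_deriv i (F m) x)) (at (x i))"
    unfolding p by (intro DERIV_sum homog_partial_deriv[OF F])
  then show ?thesis unfolding partial_deriv_def by (simp add: DERIV_imp_deriv)
qed

lemma partial_deriv_add_poly:
  assumes "p \<in> polynomials n" "q \<in> polynomials n"
  shows "partial_deriv i (\<lambda>x. p x + q x) = (\<lambda>x. partial_deriv i p x + partial_deriv i q x)"
  unfolding partial_deriv_def[of i "\<lambda>x. p x + q x"]
  by (intro ext DERIV_imp_deriv DERIV_add polynomials_has_derivative[OF assms(1)]
        polynomials_has_derivative[OF assms(2)])

lemma partial_deriv_scale_poly:
  assumes "p \<in> polynomials n"
  shows "partial_deriv i (\<lambda>x. c * p x) = (\<lambda>x. c * partial_deriv i p x)"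
  unfolding partial_deriv_def[of i "\<lambda>x. c * p x"]
  by (intro ext DERIV_imp_deriv DERIV_cmult polynomials_has_derivative[OF assms])

lemma homog_pred_imp_polynomials: "homog_pred n m f \<Longrightarrow> f \<in> polynomials n"
  using homog_pred_imp_homog homog_imp_polynomials by blast

lemma polynomials_partial_deriv:
  assumes "p \<in> polynomials n"
  shows "partial_deriv i p \<in> polynomials n"
proof (rule polynomials_decompose[OF assms])
  fix N F assume F: "\<And>m. homog n m (F m)" and p: "p = (\<lambda>x. \<Sum>m<N. F m x)"
  have "((\<lambda>t. p (x(i := t))) has_real_derivative (\<Sum>m<N. partial_deriv i (F m) x)) (at (x i))" for x
    unfolding p by (intro DERIV_sum homog_partial_deriv[OF F])
  then have "partial_deriv i p = (\<lambda>x. \<Sum>m<N. partial_deriv i (F m) x)"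
    unfolding partial_deriv_def[of i p] by (intro ext DERIV_imp_deriv)
  then show ?thesis
    using polynomials_sum[of "{..<N}", OF homog_pred_imp_polynomials[OF homog_partial_deriv(1)[OF F]]]
    by simp
qed

lemma homog_intertwiner_part: "homog n m (intertwiner_part n \<kappa> m p)"
proof (induction m arbitrary: p)
  case 0
  show ?case by (simp add: homog.const)
next
  case (Suc m)
  then show ?case by (auto intro!: homog_resolvent homog_sum homog.coord)
qed

lemma intertwiner_part_add:
  assumes "p \<in> polynomials n" "q \<in> polynomials n"
  shows "intertwiner_part n \<kappa> m (\<lambda>x. p x + q x) = (\<lambda>x. intertwiner_part n \<kappa> m p x + intertwiner_part n \<kappa> m q x)"
  using assms
proof (induction m arbitrary: p q)
  case (Suc m)
  then show ?case
    by (simp add: partial_deriv_add_poly polynomials_partial_deriv distrib_left sum.distrib resolvent_add)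
qed simp

lemma intertwiner_part_scale:
  assumes "p \<in> polynomials n"
  shows "intertwiner_part n \<kappa> m (\<lambda>x. c * p x) = (\<lambda>x. c * intertwiner_part n \<kappa> m p x)"
  using assms
proof (induction m arbitrary: p)
  case (Suc m)
  then show ?case
    by (simp add: partial_deriv_scale_poly polynomials_partial_deriv mult.left_commute
        sum_distrib_left[symmetric] resolvent_scale)
qed simp

lemma intertwiner_part_other_degree:
  assumes "homog n k p" "k \<noteq> m"
  shows "intertwiner_part n \<kappa> m p = (\<lambda>_. 0)"
  using assms
proof (induction m arbitrary: k p)
  case 0
  then show ?case by (simp add: homog_at_0)
next
  case (Suc m)
  have "intertwiner_part n \<kappa> m (partial_deriv i p) = (\<lambda>_. 0)" for i
  proof (cases k)
    case 0
    \<comment> \<open>The zero function is homogeneous of every degree, here of one other than \<open>m\<close>.\<close>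
    then have "homog n (Suc m) (partial_deriv i p)"
      using homog_partial_deriv(1)[OF Suc.prems(1), of i] by (simp add: homog.zero)
    then show ?thesis by (rule Suc.IH) simp
  next
    case (Suc k')
    then have "homog n k' (partial_deriv i p)" "k' \<noteq> m"
      using homog_partial_deriv(1)[OF Suc.prems(1), of i] Suc.prems(2) by simp_all
    then show ?thesis by (rule Suc.IH)
  qed
  then show ?case by (simp add: resolvent_zero)
qed

lemma partial_deriv_commute:
  assumes "p \<in> polynomials n" "i \<in> {1..n}" "j \<in> {1..n}"
  shows "partial_deriv i (partial_deriv j p) = partial_deriv j (partial_deriv i p)"
proof (rule polynomials_decompose[OF assms(1)])
  fix N F assume F: "\<And>m. homog n m (F m)" and p: "p = (\<lambda>x. \<Sum>m<N. F m x)"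
  have sum: "partial_deriv i (\<lambda>x. \<Sum>m<N. G m x) = (\<lambda>x. \<Sum>m<N. partial_deriv i (G m) x)"
    if G: "\<And>m. G m \<in> polynomials n" for G i and N :: nat
    unfolding partial_deriv_def[of i "\<lambda>x. \<Sum>m<N. G m x"]
    by (intro ext DERIV_imp_deriv DERIV_sum polynomials_has_derivative[OF G])
  have P: "F m \<in> polynomials n" for m by (rule homog_imp_polynomials[OF F])
  have "partial_deriv i (partial_deriv j (F m)) x = partial_deriv j (partial_deriv i (F m)) x" for m x
    using dunkl_op_commute[OF F assms(2,3), of 0] by (simp only: partial_deriv_eq_dunkl_op[where n = n])
  then show ?thesis
    unfolding p by (simp only: sum P polynomials_partial_deriv)
qed

text \<open>
  By construction the required identity holds in the radial direction. Both sides are closed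
  families, the left one by commutativity of the Dunkl operators and the right one by the
  induction hypothesis, so that they agree.
\<close>

lemma dunkl_op_intertwiner_part:
  assumes "\<kappa> \<ge> 0" "p \<in> polynomials n" "j \<in> {1..n}"
  shows "dunkl_op n \<kappa> j (intertwiner_part n \<kappa> (Suc m) p) x = intertwiner_part n \<kappa> m (partial_deriv j p) x"
  using assms(2,3)
proof (induction m arbitrary: p j x)
  \<comment> \<open>The step is separated from the induction: the closedness \<open>comm\<close> of the right-hand family is
    trivial for \<open>m = 0\<close> and otherwise an instance of the induction hypothesis.\<close>
  have main: "dunkl_op n \<kappa> j (intertwiner_part n \<kappa> (Suc m) p) x = intertwiner_part n \<kappa> m (partial_deriv j p) x"
    if p: "p \<in> polynomials n" and j: "j \<in> {1..n}"
      and comm: "\<And>i j x. i \<in> {1..n} \<Longrightarrow> j \<in> {1..n} \<Longrightarrow>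
        dunkl_op n \<kappa> i (intertwiner_part n \<kappa> m (partial_deriv j p)) x =
        dunkl_op n \<kappa> j (intertwiner_part n \<kappa> m (partial_deriv i p)) x"
    for m p j x
  proof -
    define F where "F = intertwiner_part n \<kappa> (Suc m) p"
    define g where "g i = intertwiner_part n \<kappa> m (partial_deriv i p)" for i
    have F: "homog n (Suc m) F" unfolding F_def by (rule homog_intertwiner_part)
    have g: "homog n m (g i)" for i unfolding g_def by (rule homog_intertwiner_part)
    have DF: "homog n m (dunkl_op n \<kappa> i F)" if "i \<in> {1..n}" for i
      using homog_dunkl_op[OF F that] by simp
    have radial: "(\<Sum>i=1..n. x i * dunkl_op n \<kappa> i F x) = (\<Sum>i=1..n. x i * g i x)" for x
      unfolding euler_dunkl_op[OF F] unfolding F_def intertwiner_part.simps g_def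
      by (rule resolvent_equation) (use \<open>\<kappa> \<ge> 0\<close> in auto)
    have "dunkl_op n \<kappa> j F x - g j x = 0"
    proof (rule dunkl_closed_radial_zero[where h = "\<lambda>j x. dunkl_op n \<kappa> j F x - g j x", OF _ \<open>\<kappa> \<ge> 0\<close> _ _ j])
      fix i assume i: "i \<in> {1..n}"
      show "homog n m (\<lambda>x. dunkl_op n \<kappa> i F x - g i x)" by (intro homog_diff DF i g)
      fix k x assume k: "k \<in> {1..n}"
      show "dunkl_op n \<kappa> i (\<lambda>x. dunkl_op n \<kappa> k F x - g k x) x =
          dunkl_op n \<kappa> k (\<lambda>x. dunkl_op n \<kappa> i F x - g i x) x"
        using dunkl_op_commute[OF F i k] comm[OF i k]
        unfolding dunkl_op_diff[OF DF[OF k] g i] dunkl_op_diff[OF DF[OF i] g k]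
        unfolding g_def by simp
    next
      show "(\<Sum>i=1..n. x i * (dunkl_op n \<kappa> i F x - g i x)) = 0" for x
        using radial[of x] by (simp add: right_diff_distrib sum_subtractf)
    qed
    then show ?thesis by (simp add: F_def g_def)
  qed
  {
    case 0
    show ?case by (rule main[OF 0]) (simp add: dunkl_op_const)
  next
    case (Suc m)
    show ?case
    proof (rule main[OF Suc.prems])
      fix i k x assume "i \<in> {1..n}" "k \<in> {1..n}"
      then show "dunkl_op n \<kappa> i (intertwiner_part n \<kappa> (Suc m) (partial_deriv k p)) x =
          dunkl_op n \<kappa> k (intertwiner_part n \<kappa> (Suc m) (partial_deriv i p)) x"
        using Suc.IH[OF polynomials_partial_deriv[OF Suc.prems(1)]] partial_deriv_commute[OF Suc.prems(1)]
        by (simp only:)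
    qed
  }
qed

text \<open>
  The sum over all degrees has only finitely many nonzero terms on a polynomial; it is restricted
  to polynomials to be extensional.
\<close>

definition intertwiner :: "nat \<Rightarrow> real \<Rightarrow> ((nat \<Rightarrow> real) \<Rightarrow> real) \<Rightarrow> (nat \<Rightarrow> real) \<Rightarrow> real" where
  "intertwiner n \<kappa> = restrict (\<lambda>p x. \<Sum>m. intertwiner_part n \<kappa> m p x) (polynomials n)"

lemma intertwiner_part_eventually_zero:
  assumes "p \<in> polynomials n"
  obtains N where "\<And>m. m \<ge> N \<Longrightarrow> intertwiner_part n \<kappa> m p = (\<lambda>_. 0)"
proof (rule polynomials_decompose[OF assms])
  fix N F assume F: "\<And>m. homog n m (F m)" and p: "p = (\<lambda>x. \<Sum>m<N. F m x)"
  have "intertwiner_part n \<kappa> m (\<lambda>x. \<Sum>k<M. F k x) = (\<lambda>_. 0)" if "m \<ge> M" for m M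
    using that
  proof (induction M)
    case 0
    then show ?case using intertwiner_part_other_degree[OF homog.zero[of n "Suc m"]] by simp
  next
    case (Suc M)
    then show ?case
      using intertwiner_part_other_degree[OF F[of M], of m]
      by (simp add: intertwiner_part_add homog_imp_polynomials[OF F] polynomials_sum)
  qed
  then show ?thesis using that[of N] unfolding p by blast
qed

lemma summable_intertwiner_part:
  assumes "p \<in> polynomials n"
  shows "summable (\<lambda>m. intertwiner_part n \<kappa> m p x)"
proof (rule intertwiner_part_eventually_zero[OF assms])
  fix N assume "\<And>m. m \<ge> N \<Longrightarrow> intertwiner_part n \<kappa> m p = (\<lambda>_. 0)"
  then show ?thesis by (intro summable_finite[of "{..<N}"]) (auto simp: not_less)
qed

lemma intertwiner_add:
  assumes "p \<in> polynomials n" "q \<in> polynomials n"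
  shows "intertwiner n \<kappa> (\<lambda>x. p x + q x) = (\<lambda>x. intertwiner n \<kappa> p x + intertwiner n \<kappa> q x)"
  by (simp add: intertwiner_def assms polynomials_add intertwiner_part_add suminf_add summable_intertwiner_part)

lemma intertwiner_scale:
  assumes "p \<in> polynomials n"
  shows "intertwiner n \<kappa> (\<lambda>x. c * p x) = (\<lambda>x. c * intertwiner n \<kappa> p x)"
  by (simp add: intertwiner_def assms polynomials_scale intertwiner_part_scale suminf_mult summable_intertwiner_part)

lemma intertwiner_homog:
  assumes "homog n m p"
  shows "intertwiner n \<kappa> p = intertwiner_part n \<kappa> m p"
proof -
  have "(\<Sum>k. intertwiner_part n \<kappa> k p x) = (\<Sum>k\<in>{m}. intertwiner_part n \<kappa> k p x)" for x
    by (intro suminf_finite) (auto simp: intertwiner_part_other_degree[OF assms])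
  then show ?thesis by (simp add: intertwiner_def homog_imp_polynomials[OF assms] fun_eq_iff)
qed

lemma intertwiner_intertwines_homog:
  assumes "\<kappa> \<ge> 0" "homog n m p" "i \<in> {1..n}"
  shows "dunkl_op n \<kappa> i (intertwiner n \<kappa> p) = intertwiner n \<kappa> (partial_deriv i p)"
proof (cases m)
  case 0
  then have "partial_deriv i p = (\<lambda>_. 0)" using homog_partial_deriv(1)[OF assms(2), of i] by simp
  moreover have "intertwiner n \<kappa> (\<lambda>_. 0) = (\<lambda>_. 0)"
    using intertwiner_scale[OF homog_imp_polynomials[OF homog.zero[of n 0]], of \<kappa> 0] by simp
  ultimately show ?thesis
    using 0 by (intro ext) (simp add: intertwiner_homog[OF assms(2)] dunkl_op_const)
next
  case (Suc k)
  then have "homog n k (partial_deriv i p)" using homog_partial_deriv(1)[OF assms(2), of i] by simp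
  then show ?thesis
    using dunkl_op_intertwiner_part[OF assms(1) homog_imp_polynomials[OF assms(2)] assms(3), of k] Suc
    by (simp only: intertwiner_homog[OF assms(2)] intertwiner_homog) blast
qed

lemma is_intertwiningD:
  assumes "is_intertwining n \<kappa> V"
  shows "p \<in> polynomials n \<Longrightarrow> q \<in> polynomials n \<Longrightarrow> V (\<lambda>x. p x + q x) = (\<lambda>x. V p x + V q x)"
    and "p \<in> polynomials n \<Longrightarrow> V (\<lambda>x. a * p x) = (\<lambda>x. a * V p x)"
    and "homog n m p \<Longrightarrow> homog n m (V p)"
    and "V (\<lambda>x. 1) = (\<lambda>x. 1)"
    and "p \<in> polynomials n \<Longrightarrow> i \<in> {1..n} \<Longrightarrow> dunkl_op n \<kappa> i (V p) = V (partial_deriv i p)"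
  using assms by (simp_all add: is_intertwining_def homog_iff image_subset_iff)

lemma linear_on_polynomials_sum:
  assumes add: "\<And>p q. p \<in> polynomials n \<Longrightarrow> q \<in> polynomials n \<Longrightarrow>
      V (\<lambda>x. p x + q x) = (\<lambda>x. V p x + V q x :: real)"
    and scale: "\<And>a p. p \<in> polynomials n \<Longrightarrow> V (\<lambda>x. a * p x) = (\<lambda>x. a * V p x)"
    and F: "\<And>m. F m \<in> polynomials n"
  shows "V (\<lambda>x. \<Sum>m<(N::nat). F m x) = (\<lambda>x. \<Sum>m<N. V (F m) x)"
proof (induction N)
  case 0
  show ?case using scale[OF F, of 0] by simp
next
  case (Suc N)
  then show ?case using add[OF polynomials_sum[of "{..<N}" F] F] F by simp
qed

lemma is_intertwining_sum:
  assumes V: "is_intertwining n \<kappa> V" and F: "\<And>m. F m \<in> polynomials n"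
  shows "V (\<lambda>x. \<Sum>m<(N::nat). F m x) = (\<lambda>x. \<Sum>m<N. V (F m) x)"
  by (rule linear_on_polynomials_sum[of n V F, OF is_intertwiningD(1)[OF V] is_intertwiningD(2)[OF V] F])

text \<open>For a linear map it suffices to check the intertwining relation on homogeneous polynomials.\<close>

lemma is_intertwiningI:
  assumes add: "\<And>p q. p \<in> polynomials n \<Longrightarrow> q \<in> polynomials n \<Longrightarrow>
      V (\<lambda>x. p x + q x) = (\<lambda>x. V p x + V q x)"
    and scale: "\<And>a p. p \<in> polynomials n \<Longrightarrow> V (\<lambda>x. a * p x) = (\<lambda>x. a * V p x)"
    and homog: "\<And>m p. homog n m p \<Longrightarrow> homog n m (V p)"
    and one: "V (\<lambda>x. 1) = (\<lambda>x. 1)"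
    and intertw: "\<And>m p i. homog n m p \<Longrightarrow> i \<in> {1..n} \<Longrightarrow> dunkl_op n \<kappa> i (V p) = V (partial_deriv i p)"
  shows "is_intertwining n \<kappa> V"
proof -
  have "dunkl_op n \<kappa> i (V p) = V (partial_deriv i p)" if p: "p \<in> polynomials n" and i: "i \<in> {1..n}" for i p
  proof (rule polynomials_decompose[OF p])
    fix N F assume F: "\<And>m. homog n m (F m)" and pF: "p = (\<lambda>x. \<Sum>m<N. F m x)"
    have sum: "V (\<lambda>x. \<Sum>m<N. G m x) = (\<lambda>x. \<Sum>m<N. V (G m) x)"
      if G: "\<And>m. G m \<in> polynomials n" for G and N :: nat
      by (rule linear_on_polynomials_sum[of n V G, OF add scale G])
    have P: "F m \<in> polynomials n" for m by (rule homog_imp_polynomials[OF F])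
    have d: "partial_deriv i p = (\<lambda>x. \<Sum>m<N. partial_deriv i (F m) x)"
      unfolding pF partial_deriv_def[of i "\<lambda>x. \<Sum>m<N. F m x"]
      by (intro ext DERIV_imp_deriv DERIV_sum homog_partial_deriv(2)[OF F])
    have "dunkl_op n \<kappa> i (V p) x = (\<Sum>m<N. dunkl_op n \<kappa> i (V (F m)) x)" for x
      unfolding pF sum[OF P] using F i by (intro dunkl_op_sum[where d = "\<lambda>m. m"] homog) auto
    also have "(\<Sum>m<N. dunkl_op n \<kappa> i (V (F m)) x) = V (partial_deriv i p) x" for x
      unfolding d sum[OF polynomials_partial_deriv[OF P]] by (simp only: intertw[OF F i])
    finally show ?thesis by blast
  qed
  then show ?thesis
    unfolding is_intertwining_def
    using add scale one homog by (auto simp: homog_iff[symmetric] image_subset_iff)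
qed

lemma is_intertwining_intertwiner:
  assumes "\<kappa> \<ge> 0"
  shows "is_intertwining n \<kappa> (intertwiner n \<kappa>)"
proof (rule is_intertwiningI)
  show "intertwiner n \<kappa> (\<lambda>x. 1) = (\<lambda>x. 1)"
    by (simp add: intertwiner_homog[OF homog.const])
  show "homog n m p \<Longrightarrow> homog n m (intertwiner n \<kappa> p)" for m p
    by (simp add: intertwiner_homog homog_intertwiner_part)
qed (auto simp: intertwiner_add intertwiner_scale intertwiner_intertwines_homog[OF assms])

lemma homog_0_constant: "homog n m q \<Longrightarrow> m = 0 \<Longrightarrow> q x = q (\<lambda>_. 0)"
proof (induction arbitrary: x rule: homog.induct)
  case (add m f g)
  from add.IH(1)[OF add.prems, of x] add.IH(2)[OF add.prems, of x] show ?case by simp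
qed auto

lemma is_intertwining_unique:
  assumes V: "is_intertwining n \<kappa> V" and W: "is_intertwining n \<kappa> W" and "\<kappa> \<ge> 0"
    and p: "p \<in> polynomials n"
  shows "V p = W p"
proof -
  have hom: "V q x = W q x" if "homog n m q" for m q x
    using that
  proof (induction m arbitrary: q x)
    case 0
    have "q = (\<lambda>x. q (\<lambda>_. 0) * 1)" using homog_0_constant[OF 0] by auto
    moreover have "V (\<lambda>x. c * 1) = W (\<lambda>x. c * 1)" for c
    proof -
      have "(\<lambda>x. 1) \<in> polynomials n" by (rule homog_imp_polynomials[OF homog.const])
      then have "V (\<lambda>x. c * 1) = (\<lambda>x. c * V (\<lambda>x. 1) x)" "W (\<lambda>x. c * 1) = (\<lambda>x. c * W (\<lambda>x. 1) x)"
        by (rule is_intertwiningD(2)[OF V], rule is_intertwiningD(2)[OF W])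
      then show ?thesis by (simp only: is_intertwiningD(4)[OF V] is_intertwiningD(4)[OF W])
    qed
    ultimately show ?case by metis
  next
    case (Suc m)
    have homV: "homog n (Suc m) (V q)" and homW: "homog n (Suc m) (W q)"
      by (rule is_intertwiningD(3)[OF V Suc.prems], rule is_intertwiningD(3)[OF W Suc.prems])
    have qp: "q \<in> polynomials n" by (rule homog_imp_polynomials[OF Suc.prems])
    have "V q x - W q x = 0"
    proof (rule dunkl_joint_kernel_trivial[where f = "\<lambda>x. V q x - W q x", OF homog_diff[OF homV homW] _ \<open>\<kappa> \<ge> 0\<close>])
      fix i x assume i: "i \<in> {1..n}"
      have "homog n m (partial_deriv i q)" using homog_partial_deriv(1)[OF Suc.prems, of i] by simp
      then have "V (partial_deriv i q) x = W (partial_deriv i q) x" by (rule Suc.IH)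
      moreover have "dunkl_op n \<kappa> i (V q) = V (partial_deriv i q)" "dunkl_op n \<kappa> i (W q) = W (partial_deriv i q)"
        by (rule is_intertwiningD(5)[OF V qp i], rule is_intertwiningD(5)[OF W qp i])
      ultimately show "dunkl_op n \<kappa> i (\<lambda>x. V q x - W q x) x = 0"
        by (simp add: dunkl_op_diff[OF homV homW i])
    qed simp
    then show ?case by simp
  qed
  show ?thesis
  proof (rule polynomials_decompose[OF p])
    fix N F assume F: "\<And>m. homog n m (F m)" and pF: "p = (\<lambda>x. \<Sum>m<N. F m x)"
    show ?thesis
      unfolding pF is_intertwining_sum[OF V homog_imp_polynomials[OF F]]
        is_intertwining_sum[OF W homog_imp_polynomials[OF F]] by (simp only: hom[OF F])
  qed
qed

lemma is_intertwining_intertwining_op: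
  assumes "\<kappa> \<ge> 0"
  shows "is_intertwining n \<kappa> (intertwining_op n \<kappa>)"
proof -
  have "intertwining_op n \<kappa> \<in> extensional (polynomials n) \<and> is_intertwining n \<kappa> (intertwining_op n \<kappa>)"
    unfolding intertwining_op_def
  proof (rule theI[where P = "\<lambda>V. V \<in> extensional (polynomials n) \<and> is_intertwining n \<kappa> V"])
    show "intertwiner n \<kappa> \<in> extensional (polynomials n) \<and> is_intertwining n \<kappa> (intertwiner n \<kappa>)"
      using is_intertwining_intertwiner[OF assms] by (simp add: intertwiner_def)
  next
    fix V assume V: "V \<in> extensional (polynomials n) \<and> is_intertwining n \<kappa> V"
    show "V = intertwiner n \<kappa>"
    proof (rule extensionalityI[of _ "polynomials n"])
      show "intertwiner n \<kappa> \<in> extensional (polynomials n)" by (simp add: intertwiner_def)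
    qed (use V is_intertwining_unique[OF _ is_intertwining_intertwiner[OF assms] assms] in auto)
  qed
  then show ?thesis by blast
qed

text \<open>
  The images of the powers of one coordinate are characterised by homogeneity and the action of
  the Dunkl operators.
\<close>

lemma intertwining_op_power:
  assumes "\<kappa> \<ge> 0" "l \<in> {1..n}"
    and F: "\<And>m. homog n m (F m)" "F 0 = (\<lambda>_. 1)"
    and D: "\<And>m i x. i \<in> {1..n} \<Longrightarrow> dunkl_op n \<kappa> i (F (Suc m)) x = (if i = l then real (Suc m) * F m x else 0)"
  shows "intertwining_op n \<kappa> (\<lambda>x. x l ^ m) x = F m x"
proof (induction m arbitrary: x)
  let ?V = "intertwining_op n \<kappa>"
  have V: "is_intertwining n \<kappa> ?V" by (rule is_intertwining_intertwining_op[OF assms(1)])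
  {
    case 0
    then show ?case using is_intertwiningD(4)[OF V] F(2) by simp
  next
    case (Suc m)
    have pow: "homog n k (\<lambda>x. x l ^ k)" for k by (rule homog_power[OF assms(2)])
    then have hom: "homog n k (?V (\<lambda>x. x l ^ k))" for k
      by (rule is_intertwiningD(3)[OF V])
    have "?V (\<lambda>x. x l ^ Suc m) x - F (Suc m) x = 0"
    proof (rule dunkl_joint_kernel_trivial[where f = "\<lambda>x. ?V (\<lambda>x. x l ^ Suc m) x - F (Suc m) x",
            OF homog_diff[OF hom F(1)] _ \<open>\<kappa> \<ge> 0\<close>])
      fix i x assume i: "i \<in> {1..n}"
      have "partial_deriv i (\<lambda>x. x l ^ Suc m) = (\<lambda>x. (if i = l then real (Suc m) else 0) * x l ^ m)"
      proof
        fix x :: "nat \<Rightarrow> real"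
        have "((\<lambda>t. t ^ Suc m) has_real_derivative real (Suc m) * x l ^ m) (at (x l))"
          using DERIV_pow[of "Suc m" "x l"] by simp
        then show "partial_deriv i (\<lambda>x. x l ^ Suc m) x = (if i = l then real (Suc m) else 0) * x l ^ m"
          by (cases "i = l") (simp_all add: partial_deriv_def DERIV_imp_deriv del: power_Suc of_nat_Suc)
      qed
      then have "dunkl_op n \<kappa> i (?V (\<lambda>x. x l ^ Suc m)) =
          ?V (\<lambda>x. (if i = l then real (Suc m) else 0) * x l ^ m)"
        by (simp only: is_intertwiningD(5)[OF V homog_imp_polynomials[OF pow] i])
      also have "\<dots> = (\<lambda>x. (if i = l then real (Suc m) else 0) * ?V (\<lambda>x. x l ^ m) x)"
        by (rule is_intertwiningD(2)[OF V homog_imp_polynomials[OF pow]])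
      finally show "dunkl_op n \<kappa> i (\<lambda>x. ?V (\<lambda>x. x l ^ Suc m) x - F (Suc m) x) x = 0"
        by (simp add: dunkl_op_diff[OF hom[of "Suc m", simplified] F(1) i] D[OF i] Suc.IH)
    qed simp
    then show ?case by simp
  }
qed

section \<open>The generating function of the images of powers\<close>

text \<open>The formal power series $(1 - x T)^{-b}$ in $T$.\<close>

definition binomial_fps :: "real \<Rightarrow> real \<Rightarrow> real fps" where
  "binomial_fps b x = Abs_fps (\<lambda>k. pochhammer b k / fact k * x ^ k)"

lemma binomial_fps_nth: "fps_nth (binomial_fps b x) k = pochhammer b k / fact k * x ^ k"
  by (simp add: binomial_fps_def)

abbreviation geometric_fps :: "real \<Rightarrow> real fps" where
  "geometric_fps \<equiv> binomial_fps 1"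

lemma binomial_fps_zero_arg: "binomial_fps b 0 = 1"
  by (rule fps_ext) (simp add: binomial_fps_nth)

lemma binomial_fps_contiguous:
  "(1 - fps_const x * fps_X) * binomial_fps (b + 1) x = binomial_fps b x"
proof (rule fps_ext)
  fix k
  show "fps_nth ((1 - fps_const x * fps_X) * binomial_fps (b + 1) x) k = fps_nth (binomial_fps b x) k"
  proof (cases k)
    case 0
    then show ?thesis by (simp add: binomial_fps_nth)
  next
    case (Suc j)
    let ?p = "pochhammer (b + 1) j"
    have "pochhammer (b + 1) (Suc j) / fact (Suc j) - ?p / fact j = pochhammer b (Suc j) / fact (Suc j)"
    proof -
      have "pochhammer (b + 1) (Suc j) = (b + 1 + real j) * ?p" "pochhammer b (Suc j) = b * ?p"
        by (rule pochhammer_rec', rule pochhammer_rec)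
      moreover have "?p / fact j = (real j + 1) * ?p / fact (Suc j)"
      proof -
        have f: "fact (Suc j) = (real j + 1) * fact j" by (simp add: add.commute)
        have nz: "real j + 1 \<noteq> 0" using of_nat_0_le_iff[of j] by linarith
        show ?thesis by (simp only: f mult_divide_mult_cancel_left[OF nz])
      qed
      ultimately show ?thesis by (simp only: diff_divide_distrib[symmetric]) (simp add: algebra_simps)
    qed
    moreover have "fps_nth ((1 - fps_const x * fps_X) * binomial_fps (b + 1) x) (Suc j) =
        (pochhammer (b + 1) (Suc j) / fact (Suc j) - ?p / fact j) * x ^ Suc j"
    proof -
      have "fps_nth ((1 - fps_const x * fps_X) * F) (Suc j) = fps_nth F (Suc j) - x * fps_nth F j" for F
        by (simp add: left_diff_distrib mult.assoc)
      then show ?thesis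
        unfolding binomial_fps_nth by (simp only:) (simp only: binomial_fps_nth right_diff_distrib power_Suc mult_ac)
    qed
    ultimately show ?thesis by (simp only: Suc binomial_fps_nth)
  qed
qed

lemma binomial_fps_0: "binomial_fps 0 x = 1"
  by (rule fps_ext) (simp add: binomial_fps_nth pochhammer_0_left)

lemma geometric_fps: "(1 - fps_const x * fps_X) * geometric_fps x = 1"
  using binomial_fps_contiguous[of x 0] by (simp add: binomial_fps_0)

lemma binomial_fps_plus_1: "binomial_fps (b + 1) x = geometric_fps x * binomial_fps b x"
proof -
  have "geometric_fps x * binomial_fps b x =
      ((1 - fps_const x * fps_X) * geometric_fps x) * binomial_fps (b + 1) x"
    unfolding binomial_fps_contiguous[of x b, symmetric] by (simp only: mult_ac)
  then show ?thesis by (simp add: geometric_fps)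
qed

lemma geometric_fps_diff:
  "geometric_fps x - geometric_fps y =
    fps_const (x - y) * (fps_X * (geometric_fps x * geometric_fps y))"
proof -
  have "geometric_fps x - geometric_fps y =
      ((1 - fps_const y * fps_X) * geometric_fps y) * geometric_fps x
      - ((1 - fps_const x * fps_X) * geometric_fps x) * geometric_fps y"
    by (simp add: geometric_fps)
  also have "\<dots> = (fps_const x - fps_const y) * (fps_X * (geometric_fps x * geometric_fps y))"
    by (simp add: algebra_simps del: fps_const_sub)
  finally show ?thesis by (simp only: fps_const_sub)
qed

lemma fps_deriv_binomial_fps:
  "fps_deriv (binomial_fps b x) = fps_const (b * x) * geometric_fps x * binomial_fps b x"
proof -
  have "fps_deriv (binomial_fps b x) = fps_const (b * x) * binomial_fps (b + 1) x"
    by (rule fps_ext) (simp add: binomial_fps_nth pochhammer_rec field_simps del: of_nat_Suc)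
  then show ?thesis by (simp add: binomial_fps_plus_1 mult.assoc)
qed

lemma Suc_div_fact: "real (Suc j) / fact (Suc j) = 1 / fact j"
  by (simp del: of_nat_Suc)

text \<open>
  Coefficientwise derivative at \<open>s\<close> of a power series that depends on a real parameter.
\<close>

definition has_coeff_deriv :: "(real \<Rightarrow> real fps) \<Rightarrow> real fps \<Rightarrow> real \<Rightarrow> bool" where
  "has_coeff_deriv F F' s \<longleftrightarrow> (\<forall>k. ((\<lambda>t. fps_nth (F t) k) has_real_derivative fps_nth F' k) (at s))"

lemma has_coeff_deriv_const: "has_coeff_deriv (\<lambda>_. F) 0 s"
  by (simp add: has_coeff_deriv_def)

lemma has_coeff_deriv_mult:
  assumes "has_coeff_deriv F F' s" "has_coeff_deriv G G' s"
  shows "has_coeff_deriv (\<lambda>t. F t * G t) (F' * G s + F s * G') s"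
proof -
  have "((\<lambda>t. \<Sum>i=0..k. fps_nth (F t) i * fps_nth (G t) (k - i)) has_real_derivative
      (\<Sum>i=0..k. fps_nth (F s) i * fps_nth G' (k - i) + fps_nth F' i * fps_nth (G s) (k - i))) (at s)" for k
    using assms unfolding has_coeff_deriv_def by (intro DERIV_sum DERIV_mult') auto
  then show ?thesis
    unfolding has_coeff_deriv_def fps_add_nth fps_mult_nth by (simp add: sum.distrib add.commute)
qed

text \<open>
  The product rule for factors given with their logarithmic derivatives, which add up.
\<close>

lemma has_coeff_deriv_prod:
  assumes "finite J" "\<And>j. j \<in> J \<Longrightarrow> has_coeff_deriv (F j) (g j * F j s) s"
  shows "has_coeff_deriv (\<lambda>t. \<Prod>j\<in>J. F j t) ((\<Sum>j\<in>J. g j) * (\<Prod>j\<in>J. F j s)) s"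
  using assms
proof (induction J rule: finite_induct)
  case empty
  then show ?case using has_coeff_deriv_const[of 1 s] by simp
next
  case (insert j J)
  have "has_coeff_deriv (F j) (g j * F j s) s"
    and "has_coeff_deriv (\<lambda>t. \<Prod>j\<in>J. F j t) ((\<Sum>j\<in>J. g j) * (\<Prod>j\<in>J. F j s)) s"
    using insert by auto
  from has_coeff_deriv_mult[OF this] show ?case
    using insert.hyps by (simp add: algebra_simps)
qed

lemma has_coeff_deriv_binomial_fps:
  "has_coeff_deriv (\<lambda>t. binomial_fps b (t + y)) (fps_const b * fps_X * geometric_fps (s + y) * binomial_fps b (s + y)) s"
proof -
  have "((\<lambda>t. fps_nth (binomial_fps b (t + y)) k) has_real_derivative
      fps_nth (fps_const b * (fps_X * binomial_fps (b + 1) (s + y))) k) (at s)" for k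
  proof (cases k)
    case 0
    then show ?thesis by (simp add: binomial_fps_nth)
  next
    case (Suc j)
    have "((\<lambda>t. (t + y) ^ Suc j) has_real_derivative real (Suc j) * (1 * (s + y) ^ (Suc j - Suc 0))) (at s)"
      by (rule DERIV_power) (auto intro!: derivative_eq_intros)
    then have "((\<lambda>t. pochhammer b (Suc j) / fact (Suc j) * (t + y) ^ Suc j) has_real_derivative
        pochhammer b (Suc j) / fact (Suc j) * (real (Suc j) * (s + y) ^ j)) (at s)"
      by (intro DERIV_cmult) simp
    moreover have "pochhammer b (Suc j) / fact (Suc j) * (real (Suc j) * (s + y) ^ j) =
        b * (pochhammer (b + 1) j / fact j * (s + y) ^ j)"
    proof -
      have "pochhammer b (Suc j) / fact (Suc j) * (real (Suc j) * (s + y) ^ j) =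
          pochhammer b (Suc j) * (s + y) ^ j * (real (Suc j) / fact (Suc j))" by simp
      then show ?thesis unfolding Suc_div_fact by (simp add: pochhammer_rec)
    qed
    ultimately show ?thesis unfolding Suc binomial_fps_nth by (simp add: binomial_fps_nth del: fact_Suc)
  qed
  then show ?thesis unfolding has_coeff_deriv_def binomial_fps_plus_1 by (simp add: mult.assoc)
qed

text \<open>The generating function $\prod_{j \in J} (1 - x_j T)^{-b_j}$.\<close>

definition gen_fps :: "nat set \<Rightarrow> (nat \<Rightarrow> real) \<Rightarrow> (nat \<Rightarrow> real) \<Rightarrow> real fps" where
  "gen_fps J b x = (\<Prod>j\<in>J. binomial_fps (b j) (x j))"

lemma gen_fps_nth_0: "fps_nth (gen_fps J b x) 0 = 1"
  unfolding gen_fps_def by (induction J rule: infinite_finite_induct) (simp_all add: binomial_fps_nth)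

text \<open>
  Writing $G$ for the generating function, this is the coefficient form of
  $\sum_j b_j G / (1 - x_j T) = (\sum_j b_j) G + T G'$,
  which holds because $1/(1 - x_j T) = 1 + x_j T/(1 - x_j T)$.
\<close>

lemma gen_fps_radial:
  assumes "finite J"
  shows "(\<Sum>j\<in>J. b j * fps_nth (geometric_fps (x j) * gen_fps J b x) k) =
    ((\<Sum>j\<in>J. b j) + real k) * fps_nth (gen_fps J b x) k"
proof -
  let ?G = "gen_fps J b x"
  have "fps_deriv ?G = (\<Sum>j\<in>J. fps_const (b j * x j) * geometric_fps (x j)) * ?G"
    unfolding gen_fps_def using assms
    by (induction J rule: finite_induct) (simp_all add: fps_deriv_binomial_fps algebra_simps)
  then have "fps_X * fps_deriv ?G = (\<Sum>j\<in>J. fps_const (b j) * (fps_const (x j) * fps_X * geometric_fps (x j) * ?G))"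
    by (simp add: sum_distrib_left sum_distrib_right mult_ac flip: fps_const_mult)
  also have "\<dots> = (\<Sum>j\<in>J. fps_const (b j) * ((geometric_fps (x j) - 1) * ?G))"
  proof -
    have "fps_const (x j) * fps_X * geometric_fps (x j) = geometric_fps (x j) - 1" for j
      using geometric_fps[of "x j"] by (simp add: algebra_simps)
    then show ?thesis by simp
  qed
  finally have "fps_nth (fps_X * fps_deriv ?G) k =
      (\<Sum>j\<in>J. b j * (fps_nth (geometric_fps (x j) * ?G) k - fps_nth ?G k))"
    by (simp add: fps_sum_nth left_diff_distrib)
  moreover have "fps_nth (fps_X * fps_deriv ?G) k = real k * fps_nth ?G k"
    by (cases k) auto
  ultimately show ?thesis
    by (simp add: right_diff_distrib sum_subtractf sum_distrib_right distrib_right)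
qed

lemma partial_deriv_gen_fps:
  assumes "finite J" "i \<in> J"
  shows "partial_deriv i (\<lambda>x. fps_nth (gen_fps J b x) m) x =
    b i * fps_nth (fps_X * (geometric_fps (x i) * gen_fps J b x)) m"
proof -
  let ?g = "\<lambda>j. if j = i then fps_const (b i) * fps_X * geometric_fps (x i) else 0"
  have "has_coeff_deriv (\<lambda>t. \<Prod>j\<in>J. binomial_fps (b j) ((x(i := t)) j))
      ((\<Sum>j\<in>J. ?g j) * (\<Prod>j\<in>J. binomial_fps (b j) ((x(i := x i)) j))) (x i)"
    using has_coeff_deriv_binomial_fps[of "b i" 0 "x i"]
    by (intro has_coeff_deriv_prod assms) (auto simp: has_coeff_deriv_const)
  then have "has_coeff_deriv (\<lambda>t. gen_fps J b (x(i := t)))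
      (fps_const (b i) * (fps_X * (geometric_fps (x i) * gen_fps J b x))) (x i)"
    using assms by (simp add: gen_fps_def mult.assoc)
  then show ?thesis
    unfolding has_coeff_deriv_def partial_deriv_def by (auto dest!: spec[of _ m] intro: DERIV_imp_deriv)
qed

text \<open>
  Power series with polynomial coefficients, graded so that the coefficient of $T^m$ is
  homogeneous of degree \<open>m\<close>.
\<close>

definition homog_fps :: "nat \<Rightarrow> ((nat \<Rightarrow> real) \<Rightarrow> real fps) \<Rightarrow> bool" where
  "homog_fps n F \<longleftrightarrow> (\<forall>m. homog n m (\<lambda>x. fps_nth (F x) m))"

lemma homog_fps_mult:
  assumes "homog_fps n F" "homog_fps n G"
  shows "homog_fps n (\<lambda>x. F x * G x)"
  unfolding homog_fps_def fps_mult_nth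
proof (intro allI homog_sum)
  fix m i :: nat assume i: "i \<in> {0..m}"
  have "homog n (i + (m - i)) (\<lambda>x. fps_nth (F x) i * fps_nth (G x) (m - i))"
    using assms by (intro homog_mult) (auto simp: homog_fps_def)
  then show "homog n m (\<lambda>x. fps_nth (F x) i * fps_nth (G x) (m - i))" using i by simp
qed

lemma homog_fps_1: "homog_fps n (\<lambda>_. 1)"
  unfolding homog_fps_def by (simp add: homog.const homog.zero)

lemma homog_fps_binomial: "j \<in> {1..n} \<Longrightarrow> homog_fps n (\<lambda>x. binomial_fps b (x j))"
  unfolding homog_fps_def binomial_fps_nth by (intro allI homog_scale homog_power)

lemma homog_fps_gen: "J \<subseteq> {1..n} \<Longrightarrow> homog_fps n (gen_fps J b)"
proof (induction J rule: infinite_finite_induct)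
  case (insert j J)
  then have "homog_fps n (\<lambda>x. binomial_fps (b j) (x j) * gen_fps J b x)"
    by (intro homog_fps_mult homog_fps_binomial) auto
  then show ?case using insert.hyps by (simp add: gen_fps_def[abs_def])
qed (simp_all add: gen_fps_def[abs_def] homog_fps_1)

text \<open>The exponents of the generating function: \<open>\<kappa> + 1\<close> at the distinguished index \<open>l\<close>, else \<open>\<kappa>\<close>.\<close>

definition weight :: "nat \<Rightarrow> real \<Rightarrow> nat \<Rightarrow> real" where
  "weight l \<kappa> j = (if j = l then \<kappa> + 1 else \<kappa>)"

context
  fixes n l :: nat and \<kappa> :: real
  assumes l: "l \<in> {1..n}"
begin

lemma sum_weight: "(\<Sum>j=1..n. weight l \<kappa> j) = real n * \<kappa> + 1"
proof -
  have "(\<Sum>j=1..n. weight l \<kappa> j) = (\<Sum>j=1..n. \<kappa> + (if j = l then 1 else 0))"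
    by (intro sum.cong) (auto simp: weight_def)
  then show ?thesis using l by (simp add: sum.distrib)
qed

lemma gen_fps_weight:
  "gen_fps {1..n} (weight l \<kappa>) x = geometric_fps (x l) * gen_fps {1..n} (\<lambda>_. \<kappa>) x"
proof -
  have "(\<Prod>j\<in>{1..n} - {l}. binomial_fps (weight l \<kappa> j) (x j)) = (\<Prod>j\<in>{1..n} - {l}. binomial_fps \<kappa> (x j))"
    by (intro prod.cong) (auto simp: weight_def)
  then show ?thesis
    unfolding gen_fps_def
    by (subst (1 2) prod.remove[OF _ l]) (simp_all add: weight_def binomial_fps_plus_1 mult.assoc)
qed

lemma gen_fps_symmetric:
  assumes "i \<in> {1..n}" "j \<in> {1..n}"
  shows "gen_fps {1..n} (\<lambda>_. \<kappa>) (swap_coords i j x) = gen_fps {1..n} (\<lambda>_. \<kappa>) x"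
  unfolding gen_fps_def swap_coords_eq_comp
  using prod.permute[OF permutes_swap_id[OF assms], of "\<lambda>j. binomial_fps \<kappa> (x j)"] by (simp add: o_def)

text \<open>
  Apart from the factor $1/(1 - x_l T)$ the generating function is symmetric, so that only
  transpositions moving \<open>l\<close> contribute.
\<close>

lemma dunkl_quotient_gen_fps:
  assumes "i \<in> {1..n}" "j \<in> {1..n}" "i \<noteq> j"
  shows "dunkl_quotient i j (\<lambda>x. fps_nth (gen_fps {1..n} (weight l \<kappa>) x) m) x =
    (of_bool (i = l) - of_bool (j = l)) *
      fps_nth (fps_X * (geometric_fps (x i) * geometric_fps (x j) * gen_fps {1..n} (\<lambda>_. \<kappa>) x)) m"
proof (rule dunkl_quotient_eqI)
  let ?Q = "gen_fps {1..n} (\<lambda>_. \<kappa>)"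
  let ?H = "\<lambda>x. geometric_fps (x i) * geometric_fps (x j) * ?Q x"
  let ?e = "of_bool (i = l) - of_bool (j = l) :: real"
  show "fps_nth (gen_fps {1..n} (weight l \<kappa>) x) m - fps_nth (gen_fps {1..n} (weight l \<kappa>) (swap_coords i j x)) m =
      (x i - x j) * (?e * fps_nth (fps_X * ?H x) m)" for x
  proof -
    have "gen_fps {1..n} (weight l \<kappa>) x - gen_fps {1..n} (weight l \<kappa>) (swap_coords i j x) =
        (geometric_fps (x l) - geometric_fps (swap_coords i j x l)) * ?Q x"
      unfolding gen_fps_weight gen_fps_symmetric[OF assms(1,2)] by (simp add: left_diff_distrib)
    also have "geometric_fps (x l) - geometric_fps (swap_coords i j x l) =
        fps_const ((x i - x j) * ?e) * (fps_X * (geometric_fps (x i) * geometric_fps (x j)))"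
    proof -
      consider "i = l" | "j = l" | "i \<noteq> l" "j \<noteq> l" by blast
      then show ?thesis
      proof cases
        case 1
        then show ?thesis using assms(3) by (simp add: swap_coords_def geometric_fps_diff)
      next
        case 2
        then show ?thesis
          using assms(3) by (simp add: swap_coords_def geometric_fps_diff mult.commute[of "geometric_fps (x i)"])
      qed (simp add: swap_coords_def)
    qed
    finally have "gen_fps {1..n} (weight l \<kappa>) x - gen_fps {1..n} (weight l \<kappa>) (swap_coords i j x) =
        fps_const ((x i - x j) * ?e) * (fps_X * ?H x)" by (simp only: mult.assoc)
    then show ?thesis by (simp only: fps_sub_nth[symmetric] fps_mult_left_const_nth mult.assoc)
  qed
  have "homog_fps n ?H"
    using assms by (intro homog_fps_mult homog_fps_binomial homog_fps_gen) auto
  then have "homog n (m - 1) (\<lambda>x. fps_nth (?H x) (m - 1))" by (simp add: homog_fps_def)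
  from homog_isCont[OF homog_scale[OF this, of "if m = 0 then 0 else ?e"], of x i]
  show "isCont (\<lambda>t. ?e * fps_nth (fps_X * ?H (x(i := t))) m) (x i)"
    by (cases m) auto
qed fact

text \<open>
  For \<open>i \<noteq> l\<close> the derivative cancels against the single nonzero difference quotient; for \<open>i = l\<close> all
  the terms add up to the left-hand side of \<open>gen_fps_radial\<close>.
\<close>

lemma dunkl_op_gen_fps:
  assumes i: "i \<in> {1..n}"
  shows "dunkl_op n \<kappa> i (\<lambda>x. fps_nth (gen_fps {1..n} (weight l \<kappa>) x) (Suc k)) x =
    (if i = l then (real n * \<kappa> + 1 + real k) * fps_nth (gen_fps {1..n} (weight l \<kappa>) x) k else 0)"
proof -
  let ?G = "gen_fps {1..n} (weight l \<kappa>) x" and ?Q = "gen_fps {1..n} (\<lambda>_. \<kappa>) x"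
  let ?e = "\<lambda>j. of_bool (i = l) - of_bool (j = l) :: real"
  have "dunkl_op n \<kappa> i (\<lambda>x. fps_nth (gen_fps {1..n} (weight l \<kappa>) x) (Suc k)) x =
      weight l \<kappa> i * fps_nth (geometric_fps (x i) * ?G) k
      + \<kappa> * (\<Sum>j\<in>{1..n} - {i}. ?e j * fps_nth (geometric_fps (x i) * geometric_fps (x j) * ?Q) k)"
  proof -
    have "(\<Sum>j\<in>{1..n} - {i}. dunkl_quotient i j (\<lambda>x. fps_nth (gen_fps {1..n} (weight l \<kappa>) x) (Suc k)) x) =
        (\<Sum>j\<in>{1..n} - {i}. ?e j * fps_nth (geometric_fps (x i) * geometric_fps (x j) * ?Q) k)"
    proof (intro sum.cong refl)
      fix j assume "j \<in> {1..n} - {i}"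
      then show "dunkl_quotient i j (\<lambda>x. fps_nth (gen_fps {1..n} (weight l \<kappa>) x) (Suc k)) x =
          ?e j * fps_nth (geometric_fps (x i) * geometric_fps (x j) * ?Q) k"
        using dunkl_quotient_gen_fps[OF i, of j "Suc k" x] by simp
    qed
    then show ?thesis
      using i by (simp add: dunkl_op_def partial_deriv_gen_fps)
  qed
  also have "\<dots> = (if i = l then (real n * \<kappa> + 1 + real k) * fps_nth ?G k else 0)"
  proof (cases "i = l")
    case True
    have "(\<Sum>j\<in>{1..n} - {i}. ?e j * fps_nth (geometric_fps (x i) * geometric_fps (x j) * ?Q) k) =
        (\<Sum>j\<in>{1..n} - {i}. fps_nth (geometric_fps (x j) * ?G) k)"
      unfolding gen_fps_weight using True by (intro sum.cong refl) (auto simp: mult_ac)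
    then have "\<kappa> * (\<Sum>j\<in>{1..n} - {i}. ?e j * fps_nth (geometric_fps (x i) * geometric_fps (x j) * ?Q) k) =
        (\<Sum>j\<in>{1..n} - {i}. weight l \<kappa> j * fps_nth (geometric_fps (x j) * ?G) k)"
      using True by (simp add: sum_distrib_left weight_def)
    then have "weight l \<kappa> i * fps_nth (geometric_fps (x i) * ?G) k
      + \<kappa> * (\<Sum>j\<in>{1..n} - {i}. ?e j * fps_nth (geometric_fps (x i) * geometric_fps (x j) * ?Q) k) =
      (\<Sum>j=1..n. weight l \<kappa> j * fps_nth (geometric_fps (x j) * ?G) k)"
      using sum.remove[OF _ i, of "\<lambda>j. weight l \<kappa> j * fps_nth (geometric_fps (x j) * ?G) k"] by simp
    also have "\<dots> = (real n * \<kappa> + 1 + real k) * fps_nth ?G k"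
      by (simp only: gen_fps_radial[OF finite_atLeastAtMost] sum_weight)
    finally show ?thesis using True by simp
  next
    case False
    have "(\<Sum>j\<in>{1..n} - {i}. ?e j * fps_nth (geometric_fps (x i) * geometric_fps (x j) * ?Q) k) =
        (\<Sum>j\<in>{1..n} - {i}. if j = l then - fps_nth (geometric_fps (x i) * ?G) k else 0)"
      unfolding gen_fps_weight using False by (intro sum.cong refl) (auto simp: mult_ac)
    then show ?thesis using False l by (simp add: weight_def)
  qed
  finally show ?thesis .
qed

lemma intertwining_op_power_eq:
  assumes "\<kappa> \<ge> 0"
  shows "intertwining_op n \<kappa> (\<lambda>z. z l ^ m) x =
    fact m / pochhammer (real n * \<kappa> + 1) m * fps_nth (gen_fps {1..n} (weight l \<kappa>) x) m"
proof (rule intertwining_op_power[OF assms l])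
  let ?c = "real n * \<kappa> + 1"
  let ?F = "\<lambda>m x. fact m / pochhammer ?c m * fps_nth (gen_fps {1..n} (weight l \<kappa>) x) m"
  have hom: "homog n m (\<lambda>x. fps_nth (gen_fps {1..n} (weight l \<kappa>) x) m)" for m
    using homog_fps_gen[of "{1..n}" n "weight l \<kappa>"] by (simp add: homog_fps_def)
  then show "homog n m (?F m)" for m by (rule homog_scale)
  show "?F 0 = (\<lambda>_. 1)"
    by (simp add: gen_fps_nth_0)
  fix m i x assume i: "i \<in> {1..n}"
  have "?c + real m > 0" using assms by (intro add_nonneg_pos add_pos_nonneg) auto
  then show "dunkl_op n \<kappa> i (?F (Suc m)) x = (if i = l then real (Suc m) * ?F m x else 0)"
    unfolding dunkl_op_scale[OF hom i] dunkl_op_gen_fps[OF i]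
    by (simp add: pochhammer_rec' del: of_nat_Suc)
qed

end

section \<open>Expansion of the Dunkl kernel in Humbert's series\<close>

lemma pochhammer_mono: "0 \<le> a \<Longrightarrow> a \<le> b \<Longrightarrow> pochhammer a m \<le> pochhammer (b::real) m"
  unfolding pochhammer_prod by (intro prod_mono) auto

lemma pochhammer_nonneg_real: "0 \<le> a \<Longrightarrow> 0 \<le> pochhammer (a::real) m"
  unfolding pochhammer_prod by (intro prod_nonneg) auto

lemma pochhammer_mult_le:
  assumes "0 \<le> a" "0 \<le> (b::real)"
  shows "pochhammer a m * pochhammer b k \<le> pochhammer (a + b) (m + k)"
  unfolding pochhammer_product' using assms
  by (intro mult_mono pochhammer_mono pochhammer_nonneg_real) auto

lemma prod_pochhammer_le:
  assumes "finite J" "\<And>j. j \<in> J \<Longrightarrow> 0 \<le> b j"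
  shows "(\<Prod>j\<in>J. pochhammer (b j) (\<alpha> j)) \<le> pochhammer (\<Sum>j\<in>J. b j :: real) (\<Sum>j\<in>J. \<alpha> j)"
  using assms
proof (induction J rule: finite_induct)
  case (insert j J)
  then have "pochhammer (b j) (\<alpha> j) * (\<Prod>j\<in>J. pochhammer (b j) (\<alpha> j)) \<le>
      pochhammer (b j) (\<alpha> j) * pochhammer (\<Sum>j\<in>J. b j) (\<Sum>j\<in>J. \<alpha> j)"
    by (intro mult_left_mono pochhammer_nonneg_real) auto
  also have "\<dots> \<le> pochhammer (b j + (\<Sum>j\<in>J. b j)) (\<alpha> j + (\<Sum>j\<in>J. \<alpha> j))"
    using insert.prems by (intro pochhammer_mult_le sum_nonneg) auto
  finally show ?case using insert.hyps by simp
qed simp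

text \<open>Multi-indices over \<open>J\<close> of total degree \<open>m\<close>.\<close>

definition graded_indices :: "'a set \<Rightarrow> nat \<Rightarrow> ('a \<Rightarrow> nat) set" where
  "graded_indices J m = {\<alpha> \<in> J \<rightarrow>\<^sub>E UNIV. (\<Sum>j\<in>J. \<alpha> j) = m}"

lemma finite_graded_indices:
  assumes "finite J"
  shows "finite (graded_indices J m)"
proof (rule finite_subset)
  show "graded_indices J m \<subseteq> J \<rightarrow>\<^sub>E {..m}"
    unfolding graded_indices_def using assms by (auto simp: PiE_def Pi_def intro: member_le_sum)
  show "finite (J \<rightarrow>\<^sub>E {..m})" using assms by (intro finite_PiE) auto
qed

lemma fps_nth_prod:
  assumes "finite J"
  shows "fps_nth (\<Prod>j\<in>J. F j) m = (\<Sum>\<alpha>\<in>graded_indices J m. \<Prod>j\<in>J. fps_nth (F j) (\<alpha> j))"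
  using assms
proof (induction J arbitrary: m rule: finite_induct)
  case empty
  have "graded_indices ({} :: 'a set) m = (if m = 0 then {\<lambda>_. undefined} else {})"
    by (auto simp: graded_indices_def)
  then show ?case by simp
next
  case (insert i J)
  have upd: "(\<Sum>j\<in>J. (\<alpha>(i := k)) j) = (\<Sum>j\<in>J. \<alpha> j)"
    "(\<Prod>j\<in>J. fps_nth (F j) ((\<alpha>(i := k)) j)) = (\<Prod>j\<in>J. fps_nth (F j) (\<alpha> j))" for \<alpha> k
    using insert.hyps by (auto intro!: sum.cong prod.cong)
  have "fps_nth (\<Prod>j\<in>insert i J. F j) m =
      (\<Sum>k=0..m. \<Sum>\<alpha>\<in>graded_indices J (m - k). fps_nth (F i) k * (\<Prod>j\<in>J. fps_nth (F j) (\<alpha> j)))"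
    using insert by (simp add: fps_mult_nth sum_distrib_left)
  also have "\<dots> = (\<Sum>(k, \<alpha>)\<in>Sigma {0..m} (\<lambda>k. graded_indices J (m - k)).
      fps_nth (F i) k * (\<Prod>j\<in>J. fps_nth (F j) (\<alpha> j)))"
    using finite_graded_indices[OF insert.hyps(1)] by (intro sum.Sigma) auto
  also have "\<dots> = (\<Sum>\<alpha>\<in>graded_indices (insert i J) m. \<Prod>j\<in>insert i J. fps_nth (F j) (\<alpha> j))"
  proof (rule sum.reindex_bij_witness[of _ "\<lambda>\<alpha>. (\<alpha> i, \<alpha>(i := undefined))" "\<lambda>(k, \<alpha>). \<alpha>(i := k)"])
    fix a assume "a \<in> Sigma {0..m} (\<lambda>k. graded_indices J (m - k))"
    then obtain k \<alpha> where a: "a = (k, \<alpha>)" "k \<le> m" "\<alpha> \<in> J \<rightarrow>\<^sub>E UNIV" "(\<Sum>j\<in>J. \<alpha> j) = m - k"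
      by (auto simp: graded_indices_def)
    have "\<alpha> i = undefined" using a(3) insert.hyps(2) by (auto simp: PiE_def extensional_def)
    show "((case a of (k, \<alpha>) \<Rightarrow> \<alpha>(i := k)) i, (case a of (k, \<alpha>) \<Rightarrow> \<alpha>(i := k))(i := undefined)) = a"
      using a \<open>\<alpha> i = undefined\<close> by auto
    show "(case a of (k, \<alpha>) \<Rightarrow> \<alpha>(i := k)) \<in> graded_indices (insert i J) m"
      using a insert.hyps upd(1)[of \<alpha> k] by (auto simp: graded_indices_def PiE_def extensional_def)
    show "(\<Prod>j\<in>insert i J. fps_nth (F j) ((case a of (k, \<alpha>) \<Rightarrow> \<alpha>(i := k)) j)) =
        (case a of (k, \<alpha>) \<Rightarrow> fps_nth (F i) k * (\<Prod>j\<in>J. fps_nth (F j) (\<alpha> j)))"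
      using a insert.hyps upd(2)[of \<alpha> k] by simp
  next
    fix \<alpha> assume "\<alpha> \<in> graded_indices (insert i J) m"
    then show "(case (\<alpha> i, \<alpha>(i := undefined)) of (k, \<alpha>) \<Rightarrow> \<alpha>(i := k)) = \<alpha>"
      "(\<alpha> i, \<alpha>(i := undefined)) \<in> Sigma {0..m} (\<lambda>k. graded_indices J (m - k))"
      using insert.hyps upd(1)[of \<alpha> undefined] by (auto simp: graded_indices_def PiE_def extensional_def)
  qed
  finally show ?case .
qed

lemma summable_on_prod_exp:
  fixes z :: "'a \<Rightarrow> real"
  assumes J: "finite J" and z: "\<And>j. j \<in> J \<Longrightarrow> 0 \<le> z j"
  shows "(\<lambda>\<alpha>. \<Prod>j\<in>J. z j ^ \<alpha> j / fact (\<alpha> j)) summable_on (J \<rightarrow>\<^sub>E UNIV)"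
proof (rule nonneg_bdd_above_summable_on)
  show "0 \<le> (\<Prod>j\<in>J. z j ^ \<alpha> j / fact (\<alpha> j))" for \<alpha>
    using z by (intro prod_nonneg) auto
  show "bdd_above (sum (\<lambda>\<alpha>. \<Prod>j\<in>J. z j ^ \<alpha> j / fact (\<alpha> j)) ` {F. F \<subseteq> J \<rightarrow>\<^sub>E UNIV \<and> finite F})"
  proof (rule bdd_aboveI2)
    fix A :: "('a \<Rightarrow> nat) set" assume A: "A \<in> {F. F \<subseteq> J \<rightarrow>\<^sub>E UNIV \<and> finite F}"
    define M where "M = (\<Sum>\<alpha>\<in>A. \<Sum>j\<in>J. \<alpha> j)"
    have "\<alpha> j \<le> M" if "\<alpha> \<in> A" "j \<in> J" for \<alpha> j
    proof -
      have "\<alpha> j \<le> (\<Sum>j\<in>J. \<alpha> j)" using that J by (intro member_le_sum) auto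
      also have "\<dots> \<le> M" unfolding M_def using that A by (intro member_le_sum) auto
      finally show ?thesis .
    qed
    then have "A \<subseteq> J \<rightarrow>\<^sub>E {..M}" using A by (auto simp: PiE_def Pi_def)
    then have "(\<Sum>\<alpha>\<in>A. \<Prod>j\<in>J. z j ^ \<alpha> j / fact (\<alpha> j)) \<le>
        (\<Sum>\<alpha>\<in>J \<rightarrow>\<^sub>E {..M}. \<Prod>j\<in>J. z j ^ \<alpha> j / fact (\<alpha> j))"
      using J z by (intro sum_mono2 finite_PiE prod_nonneg) auto
    also have "\<dots> = (\<Prod>j\<in>J. \<Sum>k\<le>M. z j ^ k / fact k)"
      using J by (simp add: prod_sum_PiE)
    also have "\<dots> \<le> (\<Prod>j\<in>J. exp (z j))"
    proof (intro prod_mono conjI sum_nonneg)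
      fix j assume j: "j \<in> J"
      show "(\<Sum>k\<le>M. z j ^ k / fact k) \<le> exp (z j)"
        using sum_le_suminf[OF summable_exp, of "{..M}" "z j"] z[OF j]
        by (simp add: exp_def scaleR_conv_of_real divide_inverse mult.commute)
    qed (use z in auto)
    finally show "(\<Sum>\<alpha>\<in>A. \<Prod>j\<in>J. z j ^ \<alpha> j / fact (\<alpha> j)) \<le> (\<Prod>j\<in>J. exp (z j))" .
  qed
qed

text \<open>
  The part of degree \<open>m\<close> in \<open>z\<close> of the Humbert series with variables indexed by \<open>J\<close>.
\<close>

definition graded_coeff :: "nat set \<Rightarrow> (nat \<Rightarrow> real) \<Rightarrow> real \<Rightarrow> (nat \<Rightarrow> real) \<Rightarrow> nat \<Rightarrow> real" where
  "graded_coeff J b c x m = fps_nth (gen_fps J b x) m / pochhammer c m"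

text \<open>
  Summing the Humbert series degree by degree. For nonnegative $b_j$ with sum at
  most \<open>c\<close> it converges absolutely: $\prod_j (b_j)_{m_j} \le (c)_{m_1 + \dots + m_N}$ bounds it by a product
  of exponential series.
\<close>

lemma has_sum_humbert:
  fixes b z :: "nat \<Rightarrow> real" and c :: real
  assumes J: "finite J" and b: "\<And>j. j \<in> J \<Longrightarrow> 0 \<le> b j" and c: "(\<Sum>j\<in>J. b j) \<le> c" "0 < c"
  defines "u \<equiv> (\<lambda>\<alpha>. (\<Prod>j\<in>J. pochhammer (b j) (\<alpha> j)) / pochhammer c (\<Sum>j\<in>J. \<alpha> j) *
        (\<Prod>j\<in>J. z j ^ \<alpha> j / fact (\<alpha> j)))"
  shows "(graded_coeff J b c z has_sum infsum u (J \<rightarrow>\<^sub>E UNIV)) UNIV"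
proof -
  have pc: "pochhammer c m > 0" for m using c by (intro pochhammer_pos) auto
  have bound: "norm (u \<alpha>) \<le> (\<Prod>j\<in>J. \<bar>z j\<bar> ^ \<alpha> j / fact (\<alpha> j))" for \<alpha>
  proof -
    let ?p = "(\<Prod>j\<in>J. pochhammer (b j) (\<alpha> j)) / pochhammer c (\<Sum>j\<in>J. \<alpha> j)"
    have "(\<Prod>j\<in>J. pochhammer (b j) (\<alpha> j)) \<le> pochhammer (\<Sum>j\<in>J. b j) (\<Sum>j\<in>J. \<alpha> j)"
      using J b by (rule prod_pochhammer_le)
    also have "\<dots> \<le> pochhammer c (\<Sum>j\<in>J. \<alpha> j)"
      using b c by (intro pochhammer_mono sum_nonneg) auto
    finally have "?p \<le> 1" using pc by (simp add: divide_simps)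
    moreover have "0 \<le> ?p"
      using b pc by (intro divide_nonneg_pos prod_nonneg pochhammer_nonneg_real) auto
    ultimately have "\<bar>?p\<bar> * \<bar>\<Prod>j\<in>J. z j ^ \<alpha> j / fact (\<alpha> j)\<bar> \<le> 1 * \<bar>\<Prod>j\<in>J. z j ^ \<alpha> j / fact (\<alpha> j)\<bar>"
      by (intro mult_right_mono) auto
    then show ?thesis by (simp add: u_def abs_mult abs_prod power_abs)
  qed
  have "(\<lambda>\<alpha>. norm (u \<alpha>)) summable_on (J \<rightarrow>\<^sub>E UNIV)"
    by (rule Infinite_Sum.abs_summable_on_comparison_test'[OF summable_on_prod_exp[OF J, of "\<lambda>j. \<bar>z j\<bar>", OF abs_ge_zero] bound])
  then have "u summable_on (J \<rightarrow>\<^sub>E UNIV)" by (rule iffD2[OF summable_on_iff_abs_summable_on_real])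
  then have "(u has_sum infsum u (J \<rightarrow>\<^sub>E UNIV)) (J \<rightarrow>\<^sub>E UNIV)" by (rule has_sum_infsum)
  then have "((\<lambda>(m, \<alpha>). u \<alpha>) has_sum infsum u (J \<rightarrow>\<^sub>E UNIV)) (Sigma UNIV (graded_indices J))"
    by (subst has_sum_reindex_bij_witness[where T = "J \<rightarrow>\<^sub>E UNIV" and h = u
          and i = "\<lambda>\<alpha>. (\<Sum>j\<in>J. \<alpha> j, \<alpha>)" and j = snd]) (auto simp: graded_indices_def)
  then show ?thesis
  proof (rule has_sum_SigmaD)
    fix m
    have "(u has_sum (\<Sum>\<alpha>\<in>graded_indices J m. u \<alpha>)) (graded_indices J m)"
      by (intro has_sum_finite finite_graded_indices J)
    also have "(\<Sum>\<alpha>\<in>graded_indices J m. u \<alpha>) =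
        (\<Sum>\<alpha>\<in>graded_indices J m. (\<Prod>j\<in>J. fps_nth (binomial_fps (b j) (z j)) (\<alpha> j)) / pochhammer c m)"
      by (intro sum.cong refl)
         (simp add: u_def graded_indices_def binomial_fps_nth prod.distrib prod_dividef)
    also have "\<dots> = graded_coeff J b c z m"
      unfolding graded_coeff_def gen_fps_def fps_nth_prod[OF J] by (simp add: sum_divide_distrib)
    finally show "((\<lambda>\<alpha>. case (m, \<alpha>) of (m, \<alpha>) \<Rightarrow> u \<alpha>) has_sum graded_coeff J b c z m) (graded_indices J m)"
      by simp
  qed
qed

text \<open>
  When \<open>c\<close> is the sum of the parameters, translating all variables by \<open>s\<close> multiplies the series by
  $e^s$: the derivative in \<open>s\<close> of the part of degree \<open>m\<close> is the part of degree \<open>m - 1\<close>.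
\<close>

lemma graded_coeff_shift:
  assumes J: "finite J" and c: "(\<Sum>j\<in>J. b j) = c" "0 < c"
  shows "graded_coeff J b c (\<lambda>j. s + x j) m = (\<Sum>k\<le>m. s ^ k / fact k * graded_coeff J b c x (m - k))"
proof -
  define a where "a s = Abs_fps (graded_coeff J b c (\<lambda>j. s + x j))" for s
  have pc: "pochhammer c m > 0" for m using c by (intro pochhammer_pos) auto
  have gen: "has_coeff_deriv (\<lambda>s. gen_fps J b (\<lambda>j. s + x j))
      ((\<Sum>j\<in>J. fps_const (b j) * fps_X * geometric_fps (s + x j)) * gen_fps J b (\<lambda>j. s + x j)) s" for s
    unfolding gen_fps_def by (intro has_coeff_deriv_prod J has_coeff_deriv_binomial_fps)
  have a: "has_coeff_deriv a (fps_X * a s) s" for s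
    unfolding has_coeff_deriv_def
  proof
    fix k
    let ?G = "gen_fps J b (\<lambda>j. s + x j)"
    let ?D = "(\<Sum>j\<in>J. fps_const (b j) * fps_X * geometric_fps (s + x j)) * ?G"
    have "((\<lambda>s. fps_nth (gen_fps J b (\<lambda>j. s + x j)) k / pochhammer c k) has_real_derivative
        fps_nth ?D k / pochhammer c k) (at s)"
      using gen[of s] unfolding has_coeff_deriv_def by (intro DERIV_cdivide) auto
    moreover have "fps_nth ?D k / pochhammer c k = fps_nth (fps_X * a s) k"
    proof (cases k)
      case (Suc j)
      have "?D = fps_X * (\<Sum>i\<in>J. fps_const (b i) * (geometric_fps (s + x i) * ?G))"
        by (simp add: sum_distrib_left sum_distrib_right mult_ac)
      then have "fps_nth ?D k = (\<Sum>i\<in>J. b i * fps_nth (geometric_fps (s + x i) * ?G) j)"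
        by (simp add: Suc fps_sum_nth)
      also have "\<dots> = (c + real j) * fps_nth ?G j"
        using gen_fps_radial[OF J, of b "\<lambda>j. s + x j" j] c by simp
      finally show ?thesis
        using c(2) by (simp add: Suc a_def graded_coeff_def pochhammer_rec')
    qed (simp add: fps_sum_nth)
    ultimately show "((\<lambda>t. fps_nth (a t) k) has_real_derivative fps_nth (fps_X * a s) k) (at s)"
      by (simp add: a_def graded_coeff_def)
  qed
  have e: "has_coeff_deriv fps_exp (fps_X * fps_exp s) s" for s :: real
    unfolding has_coeff_deriv_def
  proof
    fix k
    show "((\<lambda>t. fps_nth (fps_exp t) k) has_real_derivative fps_nth (fps_X * fps_exp s) k) (at s)"
    proof (cases k)
      case (Suc j)
      have "((\<lambda>t. t ^ Suc j / fact (Suc j)) has_real_derivative (real (Suc j) * s ^ j) / fact (Suc j)) (at s)"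
        using DERIV_pow[of "Suc j" s] by (intro DERIV_cdivide) simp
      moreover have "real (Suc j) * s ^ j / fact (Suc j) = s ^ j / fact j"
        using arg_cong[OF Suc_div_fact[of j], of "\<lambda>c. c * s ^ j"] by simp
      ultimately show ?thesis unfolding Suc by (simp del: fact_Suc)
    qed simp
  qed
  \<comment> \<open>Both sides solve \<open>F' = T F\<close> with the same value at \<open>s = 0\<close>.\<close>
  have "fps_nth (a s) m = fps_nth (fps_exp s * a 0) m" for s
  proof (induction m arbitrary: s)
    case 0
    show ?case
      by (simp add: a_def graded_coeff_def gen_fps_nth_0)
  next
    case (Suc m)
    have "((\<lambda>t. fps_nth (a t) (Suc m) - fps_nth (fps_exp t * a 0) (Suc m)) has_real_derivative 0) (at t)" for t
    proof -
      have 1: "((\<lambda>t. fps_nth (a t) (Suc m)) has_real_derivative fps_nth (a t) m) (at t)"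
        using a[of t] unfolding has_coeff_deriv_def by (auto dest: spec[of _ "Suc m"])
      have "has_coeff_deriv (\<lambda>t. fps_exp t * a 0) (fps_X * (fps_exp t * a 0)) t"
        using has_coeff_deriv_mult[OF e[of t] has_coeff_deriv_const[of "a 0"]] by (simp add: mult.assoc)
      then have 2: "((\<lambda>t. fps_nth (fps_exp t * a 0) (Suc m)) has_real_derivative fps_nth (fps_exp t * a 0) m) (at t)"
        unfolding has_coeff_deriv_def by (auto dest: spec[of _ "Suc m"])
      from DERIV_diff[OF 1 2] show ?thesis by (simp add: Suc.IH)
    qed
    from DERIV_isconst_all[OF allI[OF this], of s 0]
    show ?case by simp
  qed
  then show ?thesis
    by (simp add: a_def fps_mult_nth atLeast0AtMost)
qed

lemma intertwining_exp_eq_suminf: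
  assumes "l \<in> {1..n}" "\<kappa> \<ge> 0"
  shows "intertwining_exp n \<kappa> (std_basis l) x =
    (\<Sum>m. graded_coeff {1..n} (weight l \<kappa>) (real n * \<kappa> + 1) x m)"
proof -
  have "inner_n n z (std_basis l) = z l" for z
    using assms(1) by (simp add: inner_n_def std_basis_def if_distrib[of "(*) _"] cong: if_cong)
  then show ?thesis
    by (simp add: intertwining_exp_def intertwining_op_power_eq[OF assms] graded_coeff_def)
qed

lemma gen_fps_drop_zero:
  assumes "n \<ge> 1" "z n = 0"
  shows "gen_fps {1..n} b z = gen_fps {1..n-1} b z"
proof -
  have "{1..n} = insert n {1..n-1}" using assms(1) by auto
  moreover have "n \<notin> {1..n-1}" using assms(1) by auto
  ultimately show ?thesis by (simp add: gen_fps_def assms(2) binomial_fps_zero_arg del: atLeastAtMost_iff)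
qed

text \<open>The translation by $x_n$ removes the last variable, at which the series is evaluated at 0.\<close>

lemma intertwining_exp_eq_humbert:
  assumes n: "n \<ge> 1" and l: "l \<in> {1..n}" and "\<kappa> \<ge> 0"
  shows "intertwining_exp n \<kappa> (std_basis l) x =
      exp (x n) * humbert_Phi2 (n - 1) (weight l \<kappa>) (real n * \<kappa> + 1) (\<lambda>j. x j - x n)"
proof -
  let ?c = "real n * \<kappa> + 1" and ?z = "\<lambda>j. x j - x n"
  let ?g = "graded_coeff {1..n} (weight l \<kappa>) ?c ?z"
  have c: "?c > 0" using \<open>\<kappa> \<ge> 0\<close> by (intro add_nonneg_pos) auto
  have w: "weight l \<kappa> j \<ge> 0" for j using \<open>\<kappa> \<ge> 0\<close> by (simp add: weight_def)
  have sw: "(\<Sum>j\<in>{1..n}. weight l \<kappa> j) = ?c" by (rule sum_weight[OF l])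
  have "(\<Sum>j\<in>{1..n-1}. weight l \<kappa> j) \<le> (\<Sum>j\<in>{1..n}. weight l \<kappa> j)"
    using w by (intro sum_mono2) auto
  then have le: "(\<Sum>j\<in>{1..n-1}. weight l \<kappa> j) \<le> ?c" by (simp only: sw)
  have geq: "?g = graded_coeff {1..n-1} (weight l \<kappa>) ?c ?z"
    unfolding graded_coeff_def gen_fps_drop_zero[where z = ?z, OF n diff_self] ..
  have hs: "(?g has_sum humbert_Phi2 (n - 1) (weight l \<kappa>) ?c ?z) UNIV"
    unfolding geq humbert_Phi2_def multi_indices_def by (rule has_sum_humbert) (use w c le in auto)
  then have "summable (\<lambda>m. norm (?g m))"
    by (intro summable_on_imp_summable iffD1[OF summable_on_iff_abs_summable_on_real])
       (auto simp: summable_on_def)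
  moreover have "summable (\<lambda>k. norm (x n ^ k / fact k))"
    using summable_norm_exp[of "x n"] by (simp add: divide_inverse mult.commute)
  ultimately have "(\<lambda>m. \<Sum>k\<le>m. x n ^ k / fact k * ?g (m - k)) sums ((\<Sum>k. x n ^ k / fact k) * (\<Sum>m. ?g m))"
    by (intro Cauchy_product_sums)
  moreover have "(\<Sum>k. x n ^ k / fact k) = exp (x n)"
    by (simp add: exp_def divide_inverse mult.commute)
  moreover have "(\<Sum>m. ?g m) = humbert_Phi2 (n - 1) (weight l \<kappa>) ?c ?z"
    using has_sum_imp_sums[OF hs] by (rule sums_unique[symmetric])
  moreover have "(\<Sum>k\<le>m. x n ^ k / fact k * ?g (m - k)) = graded_coeff {1..n} (weight l \<kappa>) ?c x m" for m
    using graded_coeff_shift[OF finite_atLeastAtMost sw c, of "x n" ?z m] by simp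
  ultimately show ?thesis
    unfolding intertwining_exp_eq_suminf[OF l \<open>\<kappa> \<ge> 0\<close>] by (simp add: sums_iff)
qed

section \<open>The Dirichlet integral over the simplex\<close>

text \<open>
  The density $t_+^{a-1}$, which is zero for \<open>t \<le> 0\<close>; products of such factors carry the indicator
  of the simplex with them.
\<close>

definition pos_powr :: "real \<Rightarrow> real \<Rightarrow> real" where
  "pos_powr a t = (if 0 < t then t powr (a - 1) else 0)"

lemma pos_powr_nonneg [simp]: "0 \<le> pos_powr a t"
  by (simp add: pos_powr_def)

lemma measurable_pos_powr [measurable]: "pos_powr a \<in> borel_measurable borel"
  unfolding pos_powr_def[abs_def] by measurable

lemma pos_powr_plus_nat: "pos_powr (a + real m) t = t ^ m * pos_powr a t"
proof (cases "t > 0")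
  case True
  have "t powr (a + real m - 1) = t powr (real m) * t powr (a - 1)"
    by (simp add: powr_add[symmetric] algebra_simps)
  then show ?thesis using True by (simp add: pos_powr_def powr_realpow)
qed (simp add: pos_powr_def)

lemma Gamma_real_nonzero: "z > 0 \<Longrightarrow> Gamma (z::real) \<noteq> 0"
  using Gamma_real_pos less_irrefl by metis

lemma nn_integral_pos_powr_convolution:
  assumes "p > 0" "q > 0"
  shows "(\<integral>\<^sup>+y. ennreal (pos_powr p y * pos_powr q (s - y)) \<partial>lborel) = ennreal (pos_powr (p + q) s * Beta p q)"
proof (cases "s > 0")
  case False
  then have z: "pos_powr p y * pos_powr q (s - y) = 0" for y by (auto simp: pos_powr_def)
  show ?thesis unfolding z using False by (simp add: pos_powr_def)
next
  case True
  have B: "Beta p q > 0" using assms by (simp add: Beta_def Gamma_real_pos)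
  have "(\<integral>\<^sup>+y. ennreal (pos_powr p y * pos_powr q (s - y)) \<partial>lborel) =
      ennreal s * (\<integral>\<^sup>+y. ennreal (pos_powr p (s * y) * pos_powr q (s - s * y)) \<partial>lborel)"
    using True nn_integral_real_affine[of "\<lambda>y. ennreal (pos_powr p y * pos_powr q (s - y))" s 0] by simp
  also have "(\<lambda>y. pos_powr p (s * y) * pos_powr q (s - s * y)) =
      (\<lambda>y. s powr (p - 1) * s powr (q - 1) * (indicator {0<..<1} y * (y powr (p - 1) * (1 - y) powr (q - 1))))"
  proof
    fix y
    have "s - s * y = s * (1 - y)" by (simp add: algebra_simps)
    then show "pos_powr p (s * y) * pos_powr q (s - s * y) =
      s powr (p - 1) * s powr (q - 1) * (indicator {0<..<1} y * (y powr (p - 1) * (1 - y) powr (q - 1)))"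
      using True by (auto simp: pos_powr_def zero_less_mult_iff powr_mult indicator_def)
  qed
  also have "(\<integral>\<^sup>+y. ennreal (s powr (p - 1) * s powr (q - 1) *
        (indicator {0<..<1} y * (y powr (p - 1) * (1 - y) powr (q - 1)))) \<partial>lborel) =
      ennreal (s powr (p - 1) * s powr (q - 1)) *
        (\<integral>\<^sup>+y. ennreal (indicator {0<..<1} y * (y powr (p - 1) * (1 - y) powr (q - 1))) \<partial>lborel)"
    by (simp add: ennreal_mult' nn_integral_cmult)
  also have "(\<integral>\<^sup>+y. ennreal (indicator {0<..<1} y * (y powr (p - 1) * (1 - y) powr (q - 1))) \<partial>lborel) =
      ennreal (Beta p q)"
    by (rule nn_integral_has_integral_lebesgue)
       (use has_integral_Beta_real[OF assms] in \<open>auto simp: has_integral_Icc_iff_Ioo\<close>)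
  also have "ennreal s * (ennreal (s powr (p - 1) * s powr (q - 1)) * ennreal (Beta p q)) =
      ennreal (s * (s powr (p - 1) * s powr (q - 1)) * Beta p q)"
    using True B by (simp add: ennreal_mult' mult.assoc)
  also have "s * (s powr (p - 1) * s powr (q - 1)) = pos_powr (p + q) s"
  proof -
    have "s * (s powr (p - 1) * s powr (q - 1)) = s powr 1 * s powr (p - 1) * s powr (q - 1)"
      using True by simp
    also have "\<dots> = s powr (1 + (p - 1) + (q - 1))" by (simp only: powr_add)
    also have "1 + (p - 1) + (q - 1) = p + q - 1" by simp
    finally show ?thesis using True by (simp add: pos_powr_def)
  qed
  finally show ?thesis .
qed

lemma product_sigma_finite_lborel: "product_sigma_finite (\<lambda>_. lborel :: real measure)"
  by standard

text \<open>
  Dirichlet's integral over the simplex $\sum_j t_j < s$. Keeping \<open>s\<close> arbitrary makes the induction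
  on the number of variables a convolution with one more factor.
\<close>

lemma nn_integral_dirichlet:
  assumes "finite I" "\<And>j. j \<in> I \<Longrightarrow> a j > 0" "e > 0"
  shows "(\<integral>\<^sup>+t. ennreal ((\<Prod>j\<in>I. pos_powr (a j) (t j)) * pos_powr e (s - (\<Sum>j\<in>I. t j))) \<partial>Pi\<^sub>M I (\<lambda>_. lborel)) =
    ennreal (pos_powr ((\<Sum>j\<in>I. a j) + e) s * ((\<Prod>j\<in>I. Gamma (a j)) * Gamma e / Gamma ((\<Sum>j\<in>I. a j) + e)))"
  using assms(1,2)
proof (induction I arbitrary: s rule: finite_induct)
  case empty
  have "Gamma e \<noteq> 0" using \<open>e > 0\<close> by (rule Gamma_real_nonzero)
  then show ?case by (simp add: PiM_empty)
next
  case (insert i I)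
  interpret product_sigma_finite "\<lambda>_. lborel :: real measure" by (rule product_sigma_finite_lborel)
  let ?A = "\<Sum>j\<in>I. a j"
  let ?C = "(\<Prod>j\<in>I. Gamma (a j)) * Gamma e / Gamma (?A + e)"
  have "?A \<ge> 0" using insert.prems by (intro sum_nonneg) (auto simp: less_imp_le)
  moreover have "a i > 0" using insert.prems by simp
  ultimately have pos: "a i > 0" "?A + e > 0" "a i + (?A + e) > 0"
    using \<open>e > 0\<close> by linarith+
  have C: "?C \<ge> 0"
    using insert.prems \<open>e > 0\<close> pos
    by (intro divide_nonneg_pos mult_nonneg_nonneg prod_nonneg) (auto simp: Gamma_real_pos less_imp_le)
  have "(\<integral>\<^sup>+t. ennreal ((\<Prod>j\<in>insert i I. pos_powr (a j) (t j)) * pos_powr e (s - (\<Sum>j\<in>insert i I. t j)))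
        \<partial>Pi\<^sub>M (insert i I) (\<lambda>_. lborel)) =
      (\<integral>\<^sup>+y. (\<integral>\<^sup>+t. ennreal ((\<Prod>j\<in>insert i I. pos_powr (a j) ((t(i := y)) j)) *
        pos_powr e (s - (\<Sum>j\<in>insert i I. (t(i := y)) j))) \<partial>Pi\<^sub>M I (\<lambda>_. lborel)) \<partial>lborel)"
    using insert.hyps by (intro product_nn_integral_insert_rev) measurable
  also have "\<dots> = (\<integral>\<^sup>+y. ennreal (pos_powr (a i) y) * (\<integral>\<^sup>+t. ennreal ((\<Prod>j\<in>I. pos_powr (a j) (t j)) *
        pos_powr e ((s - y) - (\<Sum>j\<in>I. t j))) \<partial>Pi\<^sub>M I (\<lambda>_. lborel)) \<partial>lborel)"
  proof (rule nn_integral_cong)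
    fix y :: real
    have "(\<Prod>j\<in>insert i I. pos_powr (a j) ((t(i := y)) j)) * pos_powr e (s - (\<Sum>j\<in>insert i I. (t(i := y)) j)) =
        pos_powr (a i) y * ((\<Prod>j\<in>I. pos_powr (a j) (t j)) * pos_powr e ((s - y) - (\<Sum>j\<in>I. t j)))" for t
    proof -
      have "(\<Prod>j\<in>I. pos_powr (a j) ((t(i := y)) j)) = (\<Prod>j\<in>I. pos_powr (a j) (t j))"
        "(\<Sum>j\<in>I. (t(i := y)) j) = (\<Sum>j\<in>I. t j)"
        using insert.hyps by (auto intro!: prod.cong sum.cong)
      then show ?thesis using insert.hyps by (simp add: mult.assoc diff_diff_eq)
    qed
    then show "(\<integral>\<^sup>+t. ennreal ((\<Prod>j\<in>insert i I. pos_powr (a j) ((t(i := y)) j)) *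
        pos_powr e (s - (\<Sum>j\<in>insert i I. (t(i := y)) j))) \<partial>Pi\<^sub>M I (\<lambda>_. lborel)) =
      ennreal (pos_powr (a i) y) * (\<integral>\<^sup>+t. ennreal ((\<Prod>j\<in>I. pos_powr (a j) (t j)) *
        pos_powr e ((s - y) - (\<Sum>j\<in>I. t j))) \<partial>Pi\<^sub>M I (\<lambda>_. lborel))"
      using insert.hyps by (simp only: ennreal_mult' pos_powr_nonneg) (intro nn_integral_cmult, measurable)
  qed
  also have "\<dots> = (\<integral>\<^sup>+y. ennreal ?C * ennreal (pos_powr (a i) y * pos_powr (?A + e) (s - y)) \<partial>lborel)"
  proof (rule nn_integral_cong)
    fix y :: real
    have "(\<integral>\<^sup>+t. ennreal ((\<Prod>j\<in>I. pos_powr (a j) (t j)) * pos_powr e ((s - y) - (\<Sum>j\<in>I. t j)))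
        \<partial>Pi\<^sub>M I (\<lambda>_. lborel)) = ennreal (pos_powr (?A + e) (s - y) * ?C)"
      using insert.prems by (intro insert.IH) auto
    then show "ennreal (pos_powr (a i) y) * (\<integral>\<^sup>+t. ennreal ((\<Prod>j\<in>I. pos_powr (a j) (t j)) *
        pos_powr e ((s - y) - (\<Sum>j\<in>I. t j))) \<partial>Pi\<^sub>M I (\<lambda>_. lborel)) =
      ennreal ?C * ennreal (pos_powr (a i) y * pos_powr (?A + e) (s - y))"
      by (simp only: ennreal_mult'[OF pos_powr_nonneg] mult_ac)
  qed
  also have "\<dots> = ennreal ?C * (\<integral>\<^sup>+y. ennreal (pos_powr (a i) y * pos_powr (?A + e) (s - y)) \<partial>lborel)"
    by (intro nn_integral_cmult) measurable
  also have "\<dots> = ennreal ?C * ennreal (pos_powr (a i + (?A + e)) s * Beta (a i) (?A + e))"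
    by (simp only: nn_integral_pos_powr_convolution[OF pos(1,2)])
  also have "\<dots> = ennreal (?C * (pos_powr (a i + (?A + e)) s * Beta (a i) (?A + e)))"
    using C by (simp only: ennreal_mult')
  also have "?C * (pos_powr (a i + (?A + e)) s * Beta (a i) (?A + e)) =
      pos_powr (a i + (?A + e)) s * ((Gamma (a i) * (\<Prod>j\<in>I. Gamma (a j))) * Gamma e / Gamma (a i + (?A + e)))"
    using Gamma_real_nonzero[OF pos(2)] by (simp add: Beta_def field_simps)
  finally show ?case using insert.hyps by (simp add: add.assoc)
qed

lemma atLeastAtMost_insert_last: "1 \<le> (n::nat) \<Longrightarrow> {1..n} = insert n {1..n-1}"
  by auto

lemma prod_simplex_extend:
  assumes "n \<ge> 1"
  shows "(\<Prod>j=1..n. g j (simplex_extend n t j)) =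
    (\<Prod>j=1..n-1. g j (t j)) * (g n (1 - (\<Sum>j=1..n-1. t j)) :: real)"
proof -
  have "n \<notin> {1..n-1}" using assms by auto
  then have "(\<Prod>j\<in>insert n {1..n-1}. g j (simplex_extend n t j)) =
      g n (simplex_extend n t n) * (\<Prod>j\<in>{1..n-1}. g j (simplex_extend n t j))" by simp
  moreover have "(\<Prod>j\<in>{1..n-1}. g j (simplex_extend n t j)) = (\<Prod>j\<in>{1..n-1}. g j (t j))"
    using assms by (intro prod.cong) (auto simp: simplex_extend_def)
  ultimately show ?thesis unfolding atLeastAtMost_insert_last[OF assms] by (simp add: simplex_extend_def)
qed

lemma measurable_simplex_extend [measurable]:
  assumes "j \<in> {1..n}"
  shows "(\<lambda>t. simplex_extend n t j) \<in> borel_measurable (Pi\<^sub>M {1..n-1} (\<lambda>_. lborel))"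
proof (cases "j = n")
  case True
  then show ?thesis unfolding simplex_extend_def by simp
next
  case False
  then have "j \<in> {1..n-1}" using assms by auto
  then have "(\<lambda>t. t j) \<in> borel_measurable (Pi\<^sub>M {1..n-1} (\<lambda>_. lborel :: real measure))"
    by measurable
  then show ?thesis using False by (simp add: simplex_extend_def)
qed

lemma has_bochner_integral_dirichlet:
  assumes "n \<ge> 1" "\<And>j. j \<in> {1..n} \<Longrightarrow> a j > 0"
  shows "has_bochner_integral (Pi\<^sub>M {1..n-1} (\<lambda>_. lborel))
    (\<lambda>t. \<Prod>j=1..n. pos_powr (a j) (simplex_extend n t j)) ((\<Prod>j=1..n. Gamma (a j)) / Gamma (\<Sum>j=1..n. a j))"
proof (rule has_bochner_integral_nn_integral)
  show "(\<lambda>t. \<Prod>j=1..n. pos_powr (a j) (simplex_extend n t j)) \<in> borel_measurable (Pi\<^sub>M {1..n-1} (\<lambda>_. lborel))"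
    by (intro borel_measurable_prod measurable_compose[OF measurable_simplex_extend measurable_pos_powr])
  show "AE t in Pi\<^sub>M {1..n-1} (\<lambda>_. lborel). 0 \<le> (\<Prod>j=1..n. pos_powr (a j) (simplex_extend n t j))"
    by (intro AE_I2 prod_nonneg) auto
  have "(\<Sum>j=1..n. a j) > 0" using assms by (intro sum_pos) auto
  then show "0 \<le> (\<Prod>j=1..n. Gamma (a j)) / Gamma (\<Sum>j=1..n. a j)"
    using assms by (intro divide_nonneg_pos prod_nonneg) (auto simp: Gamma_real_pos less_imp_le)
  have n: "n \<notin> {1..n-1}" using assms(1) by auto
  have "(\<integral>\<^sup>+t. ennreal (\<Prod>j=1..n. pos_powr (a j) (simplex_extend n t j)) \<partial>Pi\<^sub>M {1..n-1} (\<lambda>_. lborel)) =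
      (\<integral>\<^sup>+t. ennreal ((\<Prod>j\<in>{1..n-1}. pos_powr (a j) (t j)) * pos_powr (a n) (1 - (\<Sum>j\<in>{1..n-1}. t j)))
        \<partial>Pi\<^sub>M {1..n-1} (\<lambda>_. lborel))"
    by (simp only: prod_simplex_extend[OF assms(1), where g = "\<lambda>j. pos_powr (a j)"])
  also have "\<dots> = ennreal (pos_powr ((\<Sum>j\<in>{1..n-1}. a j) + a n) 1 *
      ((\<Prod>j\<in>{1..n-1}. Gamma (a j)) * Gamma (a n) / Gamma ((\<Sum>j\<in>{1..n-1}. a j) + a n)))"
    using assms by (intro nn_integral_dirichlet) auto
  also have "\<dots> = ennreal ((\<Prod>j=1..n. Gamma (a j)) / Gamma (\<Sum>j=1..n. a j))"
    unfolding atLeastAtMost_insert_last[OF assms(1)] using n by (simp add: pos_powr_def mult.commute add.commute)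
  finally show "(\<integral>\<^sup>+t. ennreal (\<Prod>j=1..n. pos_powr (a j) (simplex_extend n t j)) \<partial>Pi\<^sub>M {1..n-1} (\<lambda>_. lborel)) =
      ennreal ((\<Prod>j=1..n. Gamma (a j)) / Gamma (\<Sum>j=1..n. a j))" .
qed

text \<open>The multinomial theorem, as the coefficient form of multiplicativity of the exponential.\<close>

lemma power_sum_eq_graded_sum:
  fixes z :: "'a \<Rightarrow> real"
  assumes "finite J"
  shows "(\<Sum>j\<in>J. z j) ^ m / fact m = (\<Sum>\<alpha>\<in>graded_indices J m. \<Prod>j\<in>J. z j ^ \<alpha> j / fact (\<alpha> j))"
proof -
  have "fps_exp (\<Sum>j\<in>J. z j) = (\<Prod>j\<in>J. fps_exp (z j))"
    using assms by (induction J rule: finite_induct) (simp_all add: fps_exp_add_mult)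
  from arg_cong[OF this, of "\<lambda>F. fps_nth F m"] show ?thesis
    by (simp only: fps_nth_prod[OF assms] fps_exp_nth of_nat_fact)
qed

lemma has_bochner_integral_dirichlet_moment:
  fixes x a :: "nat \<Rightarrow> real"
  assumes n: "n \<ge> 1" and a: "\<And>j. j \<in> {1..n} \<Longrightarrow> a j > 0"
  shows "has_bochner_integral (Pi\<^sub>M {1..n-1} (\<lambda>_. lborel))
    (\<lambda>t. (\<Sum>j=1..n. x j * simplex_extend n t j) ^ m / fact m * (\<Prod>j=1..n. pos_powr (a j) (simplex_extend n t j)))
    ((\<Prod>j=1..n. Gamma (a j)) / Gamma (\<Sum>j=1..n. a j) * graded_coeff {1..n} a (\<Sum>j=1..n. a j) x m)"
proof -
  let ?M = "Pi\<^sub>M {1..n-1} (\<lambda>_. lborel :: real measure)" and ?c = "\<Sum>j=1..n. a j"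
  let ?b = "\<lambda>\<alpha> j. a j + real (\<alpha> j)"
  have c: "?c > 0" using n a by (intro sum_pos) auto
  have "has_bochner_integral ?M
     (\<lambda>t. \<Sum>\<alpha>\<in>graded_indices {1..n} m. (\<Prod>j=1..n. x j ^ \<alpha> j / fact (\<alpha> j)) *
        (\<Prod>j=1..n. pos_powr (?b \<alpha> j) (simplex_extend n t j)))
     (\<Sum>\<alpha>\<in>graded_indices {1..n} m. (\<Prod>j=1..n. x j ^ \<alpha> j / fact (\<alpha> j)) *
        ((\<Prod>j=1..n. Gamma (?b \<alpha> j)) / Gamma (\<Sum>j=1..n. ?b \<alpha> j)))"
    using a by (intro has_bochner_integral_sum has_bochner_integral_mult_right has_bochner_integral_dirichlet n)
      (auto intro: add_pos_nonneg)
  moreover have "(\<Sum>\<alpha>\<in>graded_indices {1..n} m. (\<Prod>j=1..n. x j ^ \<alpha> j / fact (\<alpha> j)) *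
        (\<Prod>j=1..n. pos_powr (?b \<alpha> j) (simplex_extend n t j))) =
      (\<Sum>j=1..n. x j * simplex_extend n t j) ^ m / fact m * (\<Prod>j=1..n. pos_powr (a j) (simplex_extend n t j))" for t
    unfolding power_sum_eq_graded_sum[OF finite_atLeastAtMost] sum_distrib_right prod.distrib[symmetric]
    by (intro sum.cong prod.cong refl) (simp add: pos_powr_plus_nat power_mult_distrib)
  moreover have "(\<Sum>\<alpha>\<in>graded_indices {1..n} m. (\<Prod>j=1..n. x j ^ \<alpha> j / fact (\<alpha> j)) *
        ((\<Prod>j=1..n. Gamma (?b \<alpha> j)) / Gamma (\<Sum>j=1..n. ?b \<alpha> j))) =
      (\<Prod>j=1..n. Gamma (a j)) / Gamma ?c * graded_coeff {1..n} a ?c x m"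
  proof -
    have G: "Gamma (z + real k) = Gamma z * pochhammer z k" if "z > 0" for z :: real and k
    proof -
      have "z \<notin> \<int>\<^sub>\<le>\<^sub>0" using that by (auto elim!: nonpos_Ints_cases)
      then show ?thesis using Gamma_real_nonzero[OF that] by (simp add: pochhammer_Gamma)
    qed
    have "(\<Prod>j=1..n. x j ^ \<alpha> j / fact (\<alpha> j)) * ((\<Prod>j=1..n. Gamma (?b \<alpha> j)) / Gamma (\<Sum>j=1..n. ?b \<alpha> j)) =
        (\<Prod>j=1..n. Gamma (a j)) / Gamma ?c *
        ((\<Prod>j=1..n. pochhammer (a j) (\<alpha> j) / fact (\<alpha> j) * x j ^ \<alpha> j) / pochhammer ?c m)"
      if "\<alpha> \<in> graded_indices {1..n} m" for \<alpha>
    proof -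
      have "(\<Sum>j=1..n. ?b \<alpha> j) = ?c + real m"
        using that by (simp add: graded_indices_def sum.distrib flip: of_nat_sum)
      moreover have "(\<Prod>j=1..n. Gamma (?b \<alpha> j)) = (\<Prod>j=1..n. Gamma (a j) * pochhammer (a j) (\<alpha> j))"
        using a by (intro prod.cong refl G)
      ultimately show ?thesis by (simp only: G[OF c]) (simp add: prod.distrib prod_dividef mult_ac)
    qed
    then show ?thesis
      unfolding graded_coeff_def gen_fps_def fps_nth_prod[OF finite_atLeastAtMost] binomial_fps_nth
        sum_divide_distrib sum_distrib_left by (intro sum.cong refl)
  qed
  ultimately show ?thesis by simp
qed

text \<open>
  The exponential is integrated termwise; the dominating series uses that the barycentric
  coordinates lie in $[0,1]$ wherever the density is nonzero.
\<close>

lemma integral_exp_dirichlet: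
  fixes x a :: "nat \<Rightarrow> real"
  assumes n: "n \<ge> 1" and a: "\<And>j. j \<in> {1..n} \<Longrightarrow> a j > 0"
  shows "(\<lambda>m. (\<Prod>j=1..n. Gamma (a j)) / Gamma (\<Sum>j=1..n. a j) * graded_coeff {1..n} a (\<Sum>j=1..n. a j) x m) sums
    (\<integral>t. exp (\<Sum>j=1..n. x j * simplex_extend n t j) * (\<Prod>j=1..n. pos_powr (a j) (simplex_extend n t j))
       \<partial>Pi\<^sub>M {1..n-1} (\<lambda>_. lborel))"
proof -
  let ?M = "Pi\<^sub>M {1..n-1} (\<lambda>_. lborel :: real measure)"
  let ?w = "\<lambda>t. \<Prod>j=1..n. pos_powr (a j) (simplex_extend n t j)"
  let ?S = "\<lambda>t. \<Sum>j=1..n. x j * simplex_extend n t j"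
  let ?f = "\<lambda>m t. ?S t ^ m / fact m * ?w t"
  have moment: "has_bochner_integral ?M (?f m)
      ((\<Prod>j=1..n. Gamma (a j)) / Gamma (\<Sum>j=1..n. a j) * graded_coeff {1..n} a (\<Sum>j=1..n. a j) x m)" for m
    by (rule has_bochner_integral_dirichlet_moment[OF n a])
  have w: "integrable ?M ?w"
    by (rule integrable.intros, rule has_bochner_integral_dirichlet[OF n a])
  define R where "R = (\<Sum>j=1..n. \<bar>x j\<bar>)"
  have w0: "?w t \<ge> 0" for t by (intro prod_nonneg) auto
  have bound: "norm (?f m t) \<le> R ^ m / fact m * ?w t" for m t
  proof (cases "?w t = 0")
    case False
    then have pos: "simplex_extend n t j > 0" if "j \<in> {1..n}" for j
      using that by (auto simp: pos_powr_def split: if_splits)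
    have le1: "simplex_extend n t j \<le> 1" if j: "j \<in> {1..n}" for j
    proof -
      have "(\<Sum>j=1..n. simplex_extend n t j) = 1"
      proof -
        have "n \<notin> {1..n-1}" using n by auto
        moreover have "(\<Sum>j\<in>{1..n-1}. simplex_extend n t j) = (\<Sum>j\<in>{1..n-1}. t j)"
          using n by (intro sum.cong) (auto simp: simplex_extend_def)
        ultimately show ?thesis unfolding atLeastAtMost_insert_last[OF n] by (simp add: simplex_extend_def)
      qed
      moreover have "simplex_extend n t j \<le> (\<Sum>j=1..n. simplex_extend n t j)"
        using pos j by (intro member_le_sum) (auto simp: less_imp_le)
      ultimately show ?thesis by simp
    qed
    have "\<bar>?S t\<bar> \<le> (\<Sum>j=1..n. \<bar>x j * simplex_extend n t j\<bar>)" by (rule sum_abs)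
    also have "\<dots> \<le> R"
      unfolding R_def
    proof (rule sum_mono)
      fix j assume j: "j \<in> {1..n}"
      show "\<bar>x j * simplex_extend n t j\<bar> \<le> \<bar>x j\<bar>"
        using pos[OF j] le1[OF j] by (simp add: abs_mult mult_left_le)
    qed
    finally have "\<bar>?S t\<bar> ^ m \<le> R ^ m" by (intro power_mono) auto
    then show ?thesis using w0[of t]
      by (simp add: abs_mult power_abs divide_right_mono mult_right_mono)
  next
    case True
    show ?thesis unfolding True by simp
  qed
  have int: "integrable ?M (?f m)" for m using moment[where m = m] by (rule integrable.intros)
  have sm: "summable (\<lambda>m. R ^ m / fact m * c)" for c
    using summable_exp[of R] by (intro summable_mult2) (simp add: divide_inverse mult.commute)
  have "(\<lambda>m. \<integral>t. ?f m t \<partial>?M) sums (\<integral>t. (\<Sum>m. ?f m t) \<partial>?M)"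
  proof (rule sums_integral[OF int])
    show "AE t in ?M. summable (\<lambda>m. norm (?f m t))"
    proof (rule AE_I2)
      fix t
      show "summable (\<lambda>m. norm (?f m t))"
        by (rule summable_comparison_test'[OF sm[of "?w t"]]) (use bound in simp)
    qed
    show "summable (\<lambda>m. \<integral>t. norm (?f m t) \<partial>?M)"
    proof (rule summable_comparison_test'[OF sm[of "\<integral>t. ?w t \<partial>?M"]])
      fix m
      have "(\<integral>t. norm (?f m t) \<partial>?M) \<le> (\<integral>t. R ^ m / fact m * ?w t \<partial>?M)"
        by (intro integral_mono integrable_norm integrable_mult_right int w bound)
      then show "norm (\<integral>t. norm (?f m t) \<partial>?M) \<le> R ^ m / fact m * (\<integral>t. ?w t \<partial>?M)"
        by simp
    qed
  qed
  moreover have "(\<integral>t. ?f m t \<partial>?M) =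
      (\<Prod>j=1..n. Gamma (a j)) / Gamma (\<Sum>j=1..n. a j) * graded_coeff {1..n} a (\<Sum>j=1..n. a j) x m" for m
    using moment[where m = m] by (rule has_bochner_integral_integral_eq)
  moreover have "(\<Sum>m. ?f m t) = exp (?S t) * ?w t" for t
  proof -
    have "(\<lambda>m. ?S t ^ m / fact m) sums exp (?S t)"
      using exp_converges[of "?S t"] by (simp add: divide_inverse mult.commute)
    from sums_mult2[OF this, of "?w t"] show ?thesis by (rule sums_unique[symmetric])
  qed
  ultimately show ?thesis by simp
qed

lemma simplex_integrand:
  assumes n: "n \<ge> 1" and l: "l \<in> {1..n}" and t: "t \<in> {1..n-1} \<rightarrow>\<^sub>E UNIV"
  shows "indicator (open_simplex (n - 1)) t * (simplex_extend n t l *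
      (\<Prod>j=1..n. simplex_extend n t j powr (\<kappa> - 1))) =
    (\<Prod>j=1..n. pos_powr (weight l \<kappa> j) (simplex_extend n t j))"
proof (cases "t \<in> open_simplex (n - 1)")
  case True
  have pos: "simplex_extend n t j > 0" if "j \<in> {1..n}" for j
    using True that by (auto simp: open_simplex_def simplex_extend_def)
  have "(\<Prod>j=1..n. pos_powr (weight l \<kappa> j) (simplex_extend n t j)) =
      (\<Prod>j=1..n. (if j = l then simplex_extend n t j else 1) * simplex_extend n t j powr (\<kappa> - 1))"
  proof (rule prod.cong)
    fix j assume j: "j \<in> {1..n}"
    show "pos_powr (weight l \<kappa> j) (simplex_extend n t j) =
        (if j = l then simplex_extend n t j else 1) * simplex_extend n t j powr (\<kappa> - 1)"
      using pos[OF j] powr_mult_base[of "simplex_extend n t j" "\<kappa> - 1"]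
      by (cases "j = l") (simp_all add: weight_def pos_powr_def)
  qed simp
  then show ?thesis using True l by (simp add: prod.distrib)
next
  case False
  have "\<exists>j\<in>{1..n}. simplex_extend n t j \<le> 0"
  proof (rule ccontr)
    assume "\<not> ?thesis"
    then have pos: "simplex_extend n t j > 0" if "j \<in> {1..n}" for j using that by force
    have "t j > 0" if "j \<in> {1..n-1}" for j
    proof -
      have "j \<in> {1..n}" "j \<noteq> n" using that n by auto
      then show ?thesis using pos[of j] by (simp add: simplex_extend_def)
    qed
    moreover have "(\<Sum>j=1..n-1. t j) < 1" using pos[of n] n by (simp add: simplex_extend_def)
    ultimately show False using False t by (simp add: open_simplex_def)
  qed
  then have "\<exists>j\<in>{1..n}. pos_powr (weight l \<kappa> j) (simplex_extend n t j) = 0"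
    by (force simp: pos_powr_def)
  then have "(\<Prod>j=1..n. pos_powr (weight l \<kappa> j) (simplex_extend n t j)) = 0"
    by (intro prod_zero) auto
  then show ?thesis using False by simp
qed

text \<open>The normalisation: $n c_\kappa$ is the inverse of the total mass of the density.\<close>

lemma dunkl_const_eq:
  assumes l: "l \<in> {1..n}" and "\<kappa> > 0"
  shows "real n * dunkl_const n \<kappa> * ((\<Prod>j=1..n. Gamma (weight l \<kappa> j)) / Gamma (real n * \<kappa> + 1)) = 1"
proof -
  have n: "n > 0" using l by auto
  have "\<kappa> \<notin> \<int>\<^sub>\<le>\<^sub>0" using \<open>\<kappa> > 0\<close> by (auto elim!: nonpos_Ints_cases)
  then have G: "Gamma (\<kappa> + 1) = \<kappa> * Gamma \<kappa>" by (rule Gamma_plus1)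
  have "(\<Prod>j=1..n. Gamma (weight l \<kappa> j)) = (\<Prod>j=1..n. (if j = l then \<kappa> else 1) * Gamma \<kappa>)"
    by (intro prod.cong refl) (simp add: weight_def G)
  also have "\<dots> = \<kappa> * Gamma \<kappa> ^ n" using l by (simp add: prod.distrib)
  finally have 1: "(\<Prod>j=1..n. Gamma (weight l \<kappa> j)) = \<kappa> * Gamma \<kappa> ^ n" .
  have "real n * \<kappa> > 0" using n \<open>\<kappa> > 0\<close> by simp
  then have 2: "Gamma (real n * \<kappa> + 1) = real n * \<kappa> * Gamma (real n * \<kappa>)" "Gamma (real n * \<kappa>) > 0"
    by (auto intro!: Gamma_plus1 Gamma_real_pos elim!: nonpos_Ints_cases)
  show ?thesis
    unfolding 1 2(1) dunkl_const_def using less_imp_neq[OF 2(2)] Gamma_real_nonzero[OF \<open>\<kappa> > 0\<close>] n \<open>\<kappa> > 0\<close> by simp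
qed

lemma intertwining_exp_eq_integral:
  assumes n: "n \<ge> 1" and l: "l \<in> {1..n}" and "\<kappa> > 0"
  shows "intertwining_exp n \<kappa> (std_basis l) x = real n * dunkl_const n \<kappa> *
     (LINT t : open_simplex (n - 1) | Pi\<^sub>M {1..n-1} (\<lambda>_. lborel).
           exp (\<Sum>j=1..n. x j * simplex_extend n t j) * simplex_extend n t l *
           (\<Prod>j=1..n. simplex_extend n t j powr (\<kappa> - 1)))"
proof -
  let ?M = "Pi\<^sub>M {1..n-1} (\<lambda>_. lborel :: real measure)" and ?c = "real n * \<kappa> + 1"
  let ?K = "(\<Prod>j=1..n. Gamma (weight l \<kappa> j)) / Gamma ?c"
  have w: "weight l \<kappa> j > 0" for j using \<open>\<kappa> > 0\<close> by (simp add: weight_def)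
  have K: "real n * dunkl_const n \<kappa> * ?K = 1" by (rule dunkl_const_eq[OF l \<open>\<kappa> > 0\<close>])
  have "(LINT t : open_simplex (n - 1) | ?M.
           exp (\<Sum>j=1..n. x j * simplex_extend n t j) * simplex_extend n t l *
           (\<Prod>j=1..n. simplex_extend n t j powr (\<kappa> - 1))) =
      (\<integral>t. exp (\<Sum>j=1..n. x j * simplex_extend n t j) *
        (\<Prod>j=1..n. pos_powr (weight l \<kappa> j) (simplex_extend n t j)) \<partial>?M)"
    unfolding set_lebesgue_integral_def
  proof (rule Bochner_Integration.integral_cong[OF refl])
    fix t assume "t \<in> space ?M"
    then have "t \<in> {1..n-1} \<rightarrow>\<^sub>E UNIV" by (simp add: space_PiM)
    note eq = simplex_integrand[OF n l this, of \<kappa>, symmetric]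
    show "indicat_real (open_simplex (n - 1)) t *\<^sub>R (exp (\<Sum>j=1..n. x j * simplex_extend n t j) *
        simplex_extend n t l * (\<Prod>j=1..n. simplex_extend n t j powr (\<kappa> - 1))) =
      exp (\<Sum>j=1..n. x j * simplex_extend n t j) * (\<Prod>j=1..n. pos_powr (weight l \<kappa> j) (simplex_extend n t j))"
      by (simp only: eq real_scaleR_def mult_ac)
  qed
  moreover have "(\<lambda>m. ?K * graded_coeff {1..n} (weight l \<kappa>) ?c x m) sums \<dots>"
    using integral_exp_dirichlet[where a = "weight l \<kappa>", OF n w, where x = x] by (simp only: sum_weight[OF l])
  ultimately have "(\<lambda>m. real n * dunkl_const n \<kappa> * (?K * graded_coeff {1..n} (weight l \<kappa>) ?c x m)) sums
     (real n * dunkl_const n \<kappa> * (LINT t : open_simplex (n - 1) | ?M.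
           exp (\<Sum>j=1..n. x j * simplex_extend n t j) * simplex_extend n t l *
           (\<Prod>j=1..n. simplex_extend n t j powr (\<kappa> - 1))))"
    by (intro sums_mult) simp
  moreover have "real n * dunkl_const n \<kappa> * (?K * g) = g" for g
    using K by (simp only: mult.assoc[symmetric] mult_1)
  ultimately show ?thesis
    unfolding intertwining_exp_eq_suminf[OF l less_imp_le[OF \<open>\<kappa> > 0\<close>]] by (simp only: sums_iff)
qed

theorem theorem4p2:
  fixes n l :: nat and \<kappa> :: real and x :: "nat \<Rightarrow> real"
  assumes "n \<ge> 2" and "\<kappa> \<ge> 0" and "1 \<le> l" and "l \<le> n"
  shows "dunkl_kernel n \<kappa> x (std_basis l) = intertwining_exp n \<kappa> (std_basis l) x \<and>
    intertwining_exp n \<kappa> (std_basis l) x =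
      exp (x n) * humbert_Phi2 (n - 1) (\<lambda>j. if j = l then \<kappa> + 1 else \<kappa>)
                    (real n * \<kappa> + 1) (\<lambda>j. x j - x n) \<and>
    (\<kappa> > 0 \<longrightarrow>
      dunkl_kernel n \<kappa> x (std_basis l) =
        real n * dunkl_const n \<kappa> *
        (LINT t : open_simplex (n - 1) | Pi\<^sub>M {1..n-1} (\<lambda>_. lborel).
           exp (\<Sum>j=1..n. x j * simplex_extend n t j) * simplex_extend n t l *
           (\<Prod>j=1..n. simplex_extend n t j powr (\<kappa> - 1))))"
proof -
  have n: "n \<ge> 1" and l: "l \<in> {1..n}" using assms by auto
  have w: "(\<lambda>j. if j = l then \<kappa> + 1 else \<kappa>) = weight l \<kappa>" by (simp add: weight_def fun_eq_iff)
  show ?thesis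
    unfolding w dunkl_kernel_def
    using intertwining_exp_eq_humbert[OF n l \<open>\<kappa> \<ge> 0\<close>, of x] intertwining_exp_eq_integral[OF n l, of \<kappa> x]
    by blast
qed

end
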